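(* Let $\Phi:M\to\mathcal{L}$ be a special embedding and let $G$ be a Riemannian metric in an open set $\mathcal{U}\subset\mathcal{L}$ containing $\Phi(M)$ that is special with respect to $\Phi$. Then for every $x\in M$ and every vector $V\in\mathcal{L}$ orthogonal to $T_x\Phi$ (with respect to $G$) one has $$H_V^{\Phi,x}=0.$$
   Context: $M=(M,g)$ is an $n$-dimensional Riemannian manifold in which every two points are connected by a geodesic realizing the distance. $S=S^{n-1}$ is equipped with the standard (Haar) probability measure $ds$, and $\mathcal{L}=L^\infty(S)$. $UT_xM$ is the unit sphere of $T_xM$, equipped with its standard Haar probability measure. Special embedding: a map $\Phi:M\to\mathcal{L}$ for which there is a family $\{\Phi_s\}_{s\in S}$ of real-valued functions on $M$ such that (1) for every $x\in M$, $\Phi(x)$ is the element of $\mathcal{L}$ represented by $s\mapsto\Phi_s(x)$; (2) $(x,s)\mapsto\Phi_s(x)$ is smooth on $M\times S$; (3) $|\mathrm{grad}\,\Phi_s|\equiv1$ on $M$ for every $s$; (4) for every $x\in M$ the map $s\mapsto\mathrm{grad}\,\Phi_s(x)$ is a diffeomorphism between $S$ and $UT_xM$. Then $\Phi$ is smooth; $T_x\Phi$ denotes the image of $d_x\Phi:T_xM\to\mathcal{L}$. Let $\alpha_x:UT_xM\to S$ be the inverse of the diffeomorphism in (4), and let $\mu_x$ be the push-forward under $\alpha_x$ of the Haar probability measure on $UT_xM$. A scalar product on $\mathcal{L}$ is a symmetric bilinear form $G$ on $\mathcal{L}$ with $c\|u\|_{L^2(S)}^2\le G(u,u)\le C\|u\|_{L^2(S)}^2$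 for some constants $c,C>0$; its norm is the minimal possible $C$. A Riemannian metric in an open set $\mathcal{U}\subset\mathcal{L}$ is a family $G=\{G_\phi\}_{\phi\in\mathcal{U}}$ of scalar products on $\mathcal{L}$ depending smoothly on $\phi\in\mathcal{U}\subset L^\infty(S)$ (with respect to the norm on scalar products given by the minimal constant $C$ such that $G(u,u)\le C\|u\|_{L^2(S)}^2$ for all $u\in\mathcal{L}$). $G$ is special with respect to $\Phi$ if (1) for every $\phi\in\mathcal{U}$, $G_\phi(X,Y)=n\int_S X(s)Y(s)\,d\nu_\phi(s)$ for $X,Y\in\mathcal{L}$, where $\nu_\phi$ is a probability measure on $S$; (2) every $\nu_\phi$ has positive density (with respect to $ds$) separated away from zero, and these densities depend smoothly on $\phi$; (3) if $\phi=\Phi(x)$ for some $x\in M$, then $\nu_\phi=\mu_x$. Mean curvature: let $x\in M$, $\phi=\Phi(x)$, and let $V\in\mathcal{L}$ be orthogonal to $T_x\Phi$ with respect to $G_\phi$. Let $F$ be a smooth finite-dimensional submanifold of $\mathcal{U}$ containing a neighborhood of $\phi$ in $\Phi(M)$ and such that $V$ is tangent to $F$ at $\phi$. For $T\in T_x\Phi$ choose a smooth vector field $\tilde T$ tangent to $\Phi$ near $\phi$ with $\tilde T(\phi)=T$, and define the second fundamental form $\mathbf{II}_V^{\Phi,x}(T,T)=G(\nabla_T\tilde T,V)$, where $\nabla$ is the Levi-Civita connection of the metric induced by $G$ on $F$; this is independent of the choices of $F$ and $\tilde T$. The mean curvature $H_V^{\Phi,x}$ is the trace of the quadratic form $T\mapsto\mathbf{II}_V^{\Phi,x}(T,T)$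 on $T_x\Phi$ with respect to the Euclidean structure $G_\phi|_{T_x\Phi}$. *)

theory Defs
  imports "HOL-Probability.Probability"
begin

section \<open>Smooth maps\<close>

text \<open>
  Frechet smoothness (class C-infinity) on an open set, for maps between arbitrary normed spaces.
  \<open>D x [v\<^sub>1, \<dots>, v\<^sub>k]\<close> is the \<open>k\<close>-th derivative at \<open>x\<close>, a bounded \<open>k\<close>-linear map; the last clause
  says that the \<open>(k+1)\<close>-st derivative is the derivative of the \<open>k\<close>-th one in the norm of bounded
  \<open>k\<close>-linear maps.
\<close>

definition smooth_on :: "'a::real_normed_vector set \<Rightarrow> ('a \<Rightarrow> 'b::real_normed_vector) \<Rightarrow> bool" where
  "smooth_on U f \<longleftrightarrow> (\<exists>D :: 'a \<Rightarrow> 'a list \<Rightarrow> 'b.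
     (\<forall>x\<in>U. D x [] = f x) \<and>
     (\<forall>x\<in>U. \<forall>vs ws. linear (\<lambda>v. D x (vs @ v # ws))) \<and>
     (\<forall>x\<in>U. \<forall>k. \<exists>C. \<forall>vs. length vs = k \<longrightarrow> norm (D x vs) \<le> C * prod_list (map norm vs)) \<and>
     (\<forall>x\<in>U. \<forall>k. \<forall>e>0. \<exists>d>0. \<forall>y\<in>U. norm (y - x) < d \<longrightarrow>
        (\<forall>vs. length vs = k \<longrightarrow>
          norm (D y vs - D x vs - D x ((y - x) # vs)) \<le> e * norm (y - x) * prod_list (map norm vs))))"

text \<open>Smoothness on an arbitrary subset, in the sense of local smooth extensions.\<close>

definition smooth_on_subset :: "'a::real_normed_vector set \<Rightarrow> ('a \<Rightarrow> 'b::real_normed_vector) \<Rightarrow> bool" where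
  "smooth_on_subset X f \<longleftrightarrow>
     (\<forall>x\<in>X. \<exists>W F. open W \<and> x \<in> W \<and> smooth_on W F \<and> (\<forall>y\<in>W \<inter> X. F y = f y))"

definition diffeomorphism ::
  "'a::real_normed_vector set \<Rightarrow> 'b::real_normed_vector set \<Rightarrow> ('a \<Rightarrow> 'b) \<Rightarrow> bool" where
  "diffeomorphism X Y f \<longleftrightarrow>
     bij_betw f X Y \<and> smooth_on_subset X f \<and> smooth_on_subset Y (inv_into X f)"


section \<open>The sphere and the space of essentially bounded functions on it\<close>

text \<open>
  The rotation invariant probability measure on the unit sphere, as the image of the normalized
  Lebesgue measure of the unit ball under \<open>x \<mapsto> x / \<bar>x\<bar>\<close> (\<open>sgn\<close> in the library).
\<close>

definition sphere_measure :: "(real^'n::finite) measure" where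
  "sphere_measure = restrict_space (distr (uniform_measure lborel (ball 0 1)) borel sgn) (sphere 0 1)"

lemma space_sphere_measure: "space sphere_measure = sphere 0 1"
  by (simp add: sphere_measure_def space_restrict_space)

lemma sets_sphere_measure: "sets sphere_measure = sets (restrict_space borel (sphere 0 1))"
  by (simp add: sphere_measure_def sets_restrict_space)

lemma emeasure_sphere_measure:
  fixes B :: "(real^'n::finite) set"
  assumes "B \<in> sets borel" "B \<subseteq> sphere 0 1"
  shows "emeasure sphere_measure B =
    emeasure lborel (ball 0 1 \<inter> sgn -` B) / emeasure lborel (ball 0 1 :: (real^'n) set)"
proof -
  have m: "(sgn :: real^'n \<Rightarrow> _) \<in> borel_measurable borel"
    unfolding sgn_div_norm by measurable
  have v: "sgn -` B \<in> sets borel"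
    using measurable_sets[OF m assms(1)] by simp
  show ?thesis
    using assms m v unfolding sphere_measure_def
    by (subst emeasure_restrict_space) (auto simp: emeasure_distr emeasure_uniform_measure)
qed

lemma prob_space_sphere_measure: "prob_space (sphere_measure :: (real^'n::finite) measure)"
proof (rule prob_spaceI)
  have fin: "emeasure lborel (ball 0 1 :: (real^'n) set) < \<infinity>"
    by (rule emeasure_bounded_finite) simp
  have "emeasure lborel (ball 0 1 :: (real^'n) set) \<noteq> 0"
    using unit_ball_vol_pos[of "real CARD('n)"] by (simp add: emeasure_ball del: unit_ball_vol_pos)
  moreover have "emeasure lborel (ball 0 1 \<inter> sgn -` sphere 0 1 :: (real^'n) set) = emeasure lborel (ball 0 1 :: (real^'n) set)"
  proof (rule emeasure_eq_AE)
    have "AE x in lborel. (x::real^'n) \<noteq> 0"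
      by (rule AE_lborel_singleton)
    then show "AE x in lborel. (x \<in> ball 0 1 \<inter> sgn -` sphere 0 1) = (x \<in> ball (0::real^'n) 1)"
      by eventually_elim (auto simp: norm_sgn)
    have m: "(sgn :: real^'n \<Rightarrow> _) \<in> borel_measurable borel"
      unfolding sgn_div_norm by measurable
    show "ball 0 1 \<inter> sgn -` sphere 0 1 \<in> sets (lborel :: (real^'n) measure)"
      using measurable_sets[OF m, of "sphere 0 1"] by simp
  qed simp
  ultimately show "emeasure (sphere_measure :: (real^'n) measure) (space sphere_measure) = 1"
    using fin by (simp add: space_sphere_measure emeasure_sphere_measure ennreal_divide_self)
qed

lemma sphere_measure_orthogonal:
  fixes f :: "real^'n::{finite,wellorder} \<Rightarrow> real^'n::_"
  assumes f: "orthogonal_transformation f"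
  shows "distr sphere_measure sphere_measure f = sphere_measure"
proof (rule measure_eqI)
  have lin: "linear f" and nf: "\<And>x. norm (f x) = norm x"
    using f by (auto simp: orthogonal_transformation)
  have cont: "f \<in> borel_measurable borel"
    using lin by (intro borel_measurable_continuous_onI linear_continuous_on linear_conv_bounded_linear[THEN iffD1])
  have meas: "f \<in> measurable sphere_measure sphere_measure"
    using cont nf
    by (subst measurable_cong_sets[OF sets_sphere_measure sets_sphere_measure])
       (auto intro!: measurable_restrict_space3)
  have bijf: "bij f" by (rule orthogonal_transformation_bij[OF f])
  define g where "g = inv f"
  have g: "orthogonal_transformation g"
    unfolding g_def using f by (rule orthogonal_transformation_inv)
  have gf: "\<And>x. g (f x) = x" "\<And>x. f (g x) = x"
    unfolding g_def using bijf by (simp_all add: bij_is_inj bij_is_surj surj_f_inv_f)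
  fix B assume "B \<in> sets (distr sphere_measure sphere_measure f)"
  then have "B \<in> sets (sphere_measure :: (real^'n::_) measure)" by simp
  then have B: "B \<in> sets borel" "B \<subseteq> sphere 0 1"
    by (auto simp: sets_sphere_measure sets_restrict_space)
  have B': "f -` B \<in> sets borel" "f -` B \<subseteq> sphere 0 1"
    using measurable_sets[OF cont B(1)] B(2) nf by auto
  have m: "(sgn :: real^'n::_ \<Rightarrow> _) \<in> borel_measurable borel"
    unfolding sgn_div_norm by measurable
  let ?S = "\<lambda>C::(real^'n::_) set. ball 0 1 \<inter> sgn -` C"
  have S: "?S C \<in> sets borel" if "C \<in> sets borel" for C
    using measurable_sets[OF m that] by auto
  have fin: "?S C \<in> lmeasurable" if "C \<in> sets borel" for C
    using S[OF that] by (intro bounded_set_imp_lmeasurable) (auto intro: bounded_subset[of "ball 0 1"])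
  have sg: "sgn (f x) = f (sgn x)" for x
    by (simp add: sgn_div_norm nf linear_cmul[OF lin])
  have img: "?S (f -` B) = g ` ?S B"
  proof (intro equalityI subsetI)
    fix x assume "x \<in> ?S (f -` B)"
    then have "f x \<in> ?S B" by (auto simp: sg nf)
    then show "x \<in> g ` ?S B" using gf(1)[of x] by (metis imageI)
  next
    fix x assume "x \<in> g ` ?S B"
    then have "f x \<in> ?S B" using gf by auto
    then show "x \<in> ?S (f -` B)" by (auto simp: sg nf)
  qed
  have "measure lebesgue (?S (f -` B)) = measure lebesgue (?S B)"
    unfolding img by (rule measure_orthogonal_image[OF g fin[OF B(1)]])
  moreover have "emeasure lborel (?S C) = ennreal (measure lebesgue (?S C))" if "C \<in> sets borel" for C
  proof -
    have "?S C \<in> sets lborel" using S[OF that] by simp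
    then have "emeasure lborel (?S C) = emeasure lebesgue (?S C)" by simp
    then show ?thesis using emeasure_eq_measure2[OF fin[OF that]] by simp
  qed
  ultimately have eq: "emeasure lborel (?S (f -` B)) = emeasure lborel (?S B)"
    using B(1) B'(1) by simp
  have sp: "f -` B \<inter> space sphere_measure = f -` B"
    using B'(2) by (auto simp: space_sphere_measure)
  show "emeasure (distr sphere_measure sphere_measure f) B = emeasure sphere_measure B"
    unfolding emeasure_distr[OF meas \<open>B \<in> sets sphere_measure\<close>] sp
      emeasure_sphere_measure[OF B] emeasure_sphere_measure[OF B'] eq ..
qed simp

definition ess_bound :: "(real^'n::finite \<Rightarrow> real) \<Rightarrow> real \<Rightarrow> bool" where
  "ess_bound f C \<longleftrightarrow> 0 \<le> C \<and> (AE s in sphere_measure. \<bar>f s\<bar> \<le> C)"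

definition linf_rel :: "(real^'n::finite \<Rightarrow> real) \<Rightarrow> (real^'n \<Rightarrow> real) \<Rightarrow> bool" where
  "linf_rel f h \<longleftrightarrow>
     f \<in> borel_measurable sphere_measure \<and> (\<exists>C. ess_bound f C) \<and>
     h \<in> borel_measurable sphere_measure \<and> (\<exists>C. ess_bound h C) \<and>
     (AE s in sphere_measure. f s = h s)"

lemma ess_bound_0: "ess_bound (\<lambda>_. 0) 0"
  by (simp add: ess_bound_def)

lemma ess_bound_add: "ess_bound f C \<Longrightarrow> ess_bound h D \<Longrightarrow> ess_bound (\<lambda>s. f s + h s) (C + D)"
  unfolding ess_bound_def by (auto elim!: eventually_elim2)

lemma ess_bound_scale: "ess_bound f C \<Longrightarrow> ess_bound (\<lambda>s. r * f s) (\<bar>r\<bar> * C)"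
  unfolding ess_bound_def by (auto simp: abs_mult mult_left_mono elim!: eventually_mono)

lemma ess_bound_cong:
  "(AE s in sphere_measure. f s = h s) \<Longrightarrow> ess_bound f C \<longleftrightarrow> ess_bound h C"
  unfolding ess_bound_def by (auto elim!: eventually_elim2)

lemma linf_rel_intro:
  assumes "f \<in> borel_measurable sphere_measure" "h \<in> borel_measurable sphere_measure"
    "ess_bound f C" "AE s in sphere_measure. f s = h s"
  shows "linf_rel f h"
  using assms ess_bound_cong[OF assms(4)] unfolding linf_rel_def by blast

lemma linf_rel_add:
  assumes "linf_rel f f'" "linf_rel h h'"
  shows "linf_rel (\<lambda>s. f s + h s) (\<lambda>s. f' s + h' s)"
proof -
  obtain C D where C: "ess_bound f C" "ess_bound h D"
    using assms by (auto simp: linf_rel_def)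
  show ?thesis
    using assms by (intro linf_rel_intro[OF _ _ ess_bound_add[OF C]])
      (auto simp: linf_rel_def elim!: eventually_elim2)
qed

lemma linf_rel_scale:
  assumes "linf_rel f f'"
  shows "linf_rel (\<lambda>s. r * f s) (\<lambda>s. r * f' s)"
proof -
  obtain C where C: "ess_bound f C"
    using assms by (auto simp: linf_rel_def)
  show ?thesis
    using assms by (intro linf_rel_intro[OF _ _ ess_bound_scale[OF C]])
      (auto simp: linf_rel_def elim!: eventually_mono)
qed

lemma linf_rel_part_equivp: "part_equivp linf_rel"
proof (rule part_equivpI)
  have "linf_rel (\<lambda>_. 0) (\<lambda>_::real^'n::finite. 0)"
    by (rule linf_rel_intro[OF _ _ ess_bound_0]) auto
  then show "\<exists>x. linf_rel x (x :: real^'n \<Rightarrow> real)" by blast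
  show "symp linf_rel"
    unfolding symp_def linf_rel_def by (auto elim!: eventually_mono)
  show "transp linf_rel"
    unfolding transp_def linf_rel_def by (auto elim!: eventually_elim2)
qed

quotient_type (overloaded) 'n linf = "real^'n::finite \<Rightarrow> real" / partial: linf_rel
  morphisms linf_rep linf_class
  by (rule linf_rel_part_equivp)

definition ess_norm :: "(real^'n::finite \<Rightarrow> real) \<Rightarrow> real" where
  "ess_norm f = Inf {C. ess_bound f C}"

lemma ess_bound_ess_norm:
  assumes "ess_bound f C0"
  shows "ess_bound f (ess_norm f)"
proof -
  let ?A = "{C. ess_bound f C}"
  have bdd: "bdd_below ?A" by (rule bdd_belowI[of _ 0]) (auto simp: ess_bound_def)
  have ne: "?A \<noteq> {}" using assms by blast
  have "0 \<le> ess_norm f"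
    unfolding ess_norm_def using ne by (intro cInf_greatest) (auto simp: ess_bound_def)
  moreover have "AE s in sphere_measure. \<forall>k::nat. \<bar>f s\<bar> \<le> ess_norm f + inverse (real (Suc k))"
  proof (subst AE_all_countable, intro allI)
    fix k :: nat
    have "ess_norm f < ess_norm f + inverse (real (Suc k))" by simp
    then obtain C where "ess_bound f C" "C < ess_norm f + inverse (real (Suc k))"
      unfolding ess_norm_def cInf_less_iff[OF ne bdd] by blast
    then show "AE s in sphere_measure. \<bar>f s\<bar> \<le> ess_norm f + inverse (real (Suc k))"
      unfolding ess_bound_def by (auto elim!: eventually_mono)
  qed
  then have "AE s in sphere_measure. \<bar>f s\<bar> \<le> ess_norm f"
  proof eventually_elim
    case (elim s)
    show ?case
    proof (rule field_le_epsilon)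
      fix e :: real assume "0 < e"
      then obtain k where "inverse (real (Suc k)) < e" using reals_Archimedean by blast
      then show "\<bar>f s\<bar> \<le> ess_norm f + e" using elim[rule_format, of k] by linarith
    qed
  qed
  ultimately show ?thesis by (simp add: ess_bound_def)
qed

lemma ess_norm_le: "ess_bound f C \<Longrightarrow> ess_norm f \<le> C"
  unfolding ess_norm_def by (rule cInf_lower) (auto intro!: bdd_belowI[of _ 0] simp: ess_bound_def)

lemma ess_norm_cong:
  "(AE s in sphere_measure. f s = h s) \<Longrightarrow> ess_norm f = ess_norm h"
  using ess_bound_cong[of f h] unfolding ess_norm_def by presburger

instantiation linf :: (finite) real_vector
begin

lift_definition zero_linf :: "'a linf" is "\<lambda>_. 0"
  by (rule linf_rel_intro[OF _ _ ess_bound_0]) auto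

lift_definition plus_linf :: "'a linf \<Rightarrow> 'a linf \<Rightarrow> 'a linf" is "\<lambda>f h s. f s + h s"
  by (rule linf_rel_add)

lift_definition scaleR_linf :: "real \<Rightarrow> 'a linf \<Rightarrow> 'a linf" is "\<lambda>r f s. r * f s"
  by (rule linf_rel_scale)

lift_definition uminus_linf :: "'a linf \<Rightarrow> 'a linf" is "\<lambda>f s. - f s"
  using linf_rel_scale[of _ _ "-1"] by simp

lift_definition minus_linf :: "'a linf \<Rightarrow> 'a linf \<Rightarrow> 'a linf" is "\<lambda>f h s. f s - h s"
  using linf_rel_add[OF _ linf_rel_scale[of _ _ "-1"]] by simp

instance
proof
  fix a b c :: "'a linf" and r q :: real
  show "a + b + c = a + (b + c)"
    by transfer (simp add: add.assoc linf_rel_add)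
  show "a + b = b + a"
    by transfer (simp add: add.commute linf_rel_add)
  show "0 + a = a"
    by transfer simp
  show "- a + a = 0"
    by transfer (auto intro!: linf_rel_intro[OF _ _ ess_bound_0])
  show "a - b = a + - b"
    by transfer (use linf_rel_add[OF _ linf_rel_scale[of _ _ "-1"]] in simp)
  show "r *\<^sub>R (a + b) = r *\<^sub>R a + r *\<^sub>R b"
    by transfer (simp add: distrib_left linf_rel_add linf_rel_scale)
  show "(r + q) *\<^sub>R a = r *\<^sub>R a + q *\<^sub>R a"
    by transfer (simp add: distrib_right linf_rel_add linf_rel_scale)
  show "r *\<^sub>R q *\<^sub>R a = (r * q) *\<^sub>R a"
    by transfer (use linf_rel_scale in \<open>simp flip: mult.assoc\<close>)
  show "1 *\<^sub>R a = a"
    by transfer simp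
qed

end

instantiation linf :: (finite) real_normed_vector
begin

lift_definition norm_linf :: "'a linf \<Rightarrow> real" is ess_norm
  by (auto simp: linf_rel_def intro: ess_norm_cong)

definition sgn_linf :: "'a linf \<Rightarrow> 'a linf" where "sgn_linf x = x /\<^sub>R norm x"
definition dist_linf :: "'a linf \<Rightarrow> 'a linf \<Rightarrow> real" where "dist_linf x y = norm (x - y)"
definition uniformity_linf :: "('a linf \<times> 'a linf) filter" where
  "uniformity_linf = (INF e\<in>{0 <..}. principal {(x, y). dist x y < e})"
definition open_linf :: "'a linf set \<Rightarrow> bool" where
  "open_linf S = (\<forall>x\<in>S. \<forall>\<^sub>F (x', y) in uniformity. x' = x \<longrightarrow> y \<in> S)"

instance
proof
  fix a b c :: "'a linf" and r q :: real
  show "sgn a = a /\<^sub>R norm a" by (rule sgn_linf_def)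
  show "dist a b = norm (a - b)" by (rule dist_linf_def)
  show "(uniformity :: ('a linf \<times> 'a linf) filter) = (INF e\<in>{0 <..}. principal {(x, y). dist x y < e})"
    by (rule uniformity_linf_def)
  show "open S = (\<forall>x\<in>S. \<forall>\<^sub>F (x', y) in uniformity. x' = x \<longrightarrow> y \<in> S)" for S :: "'a linf set"
    by (rule open_linf_def)
  show "norm a = 0 \<longleftrightarrow> a = 0"
  proof transfer
    fix f :: "real^'a \<Rightarrow> real" assume f: "linf_rel f f"
    then obtain C where C: "ess_bound f C" and m: "f \<in> borel_measurable sphere_measure"
      by (auto simp: linf_rel_def)
    show "ess_norm f = 0 \<longleftrightarrow> linf_rel f (\<lambda>_. 0)"
    proof
      assume "ess_norm f = 0"
      then have "AE s in sphere_measure. f s = 0"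
        using ess_bound_ess_norm[OF C] by (simp add: ess_bound_def)
      then show "linf_rel f (\<lambda>_. 0)"
        using m C by (intro linf_rel_intro) auto
    next
      assume "linf_rel f (\<lambda>_. 0)"
      then have "ess_bound f 0"
        using ess_bound_0 ess_bound_cong[of f "\<lambda>_. 0" 0] by (simp add: linf_rel_def)
      then have "ess_norm f \<le> 0" by (rule ess_norm_le)
      then show "ess_norm f = 0"
        using ess_bound_ess_norm[OF C] by (simp add: ess_bound_def)
    qed
  qed
  show "norm (a + b) \<le> norm a + norm b"
  proof transfer
    fix f h :: "real^'a \<Rightarrow> real" assume f: "linf_rel f f" and h: "linf_rel h h"
    obtain C D where "ess_bound f C" "ess_bound h D"
      using f h by (auto simp: linf_rel_def)
    then show "ess_norm (\<lambda>s. f s + h s) \<le> ess_norm f + ess_norm h"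
      by (rule ess_norm_le[OF ess_bound_add[OF ess_bound_ess_norm ess_bound_ess_norm]])
  qed
  show "norm (r *\<^sub>R a) = \<bar>r\<bar> * norm a"
  proof transfer
    fix r :: real and f :: "real^'a \<Rightarrow> real" assume "linf_rel f f"
    then obtain C where C: "ess_bound f C" by (auto simp: linf_rel_def)
    have le: "ess_norm (\<lambda>s. t * h s) \<le> \<bar>t\<bar> * ess_norm h" if "ess_bound h D" for t D and h :: "real^'a \<Rightarrow> real"
      by (rule ess_norm_le[OF ess_bound_scale[OF ess_bound_ess_norm[OF that]]])
    show "ess_norm (\<lambda>s. r * f s) = \<bar>r\<bar> * ess_norm f"
    proof (cases "r = 0")
      case True
      have "ess_norm (\<lambda>s::real^'a. 0) \<le> 0" "ess_bound (\<lambda>s::real^'a. 0) (ess_norm (\<lambda>s::real^'a. 0))"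
        using ess_norm_le[OF ess_bound_0] ess_bound_ess_norm[OF ess_bound_0] by auto
      then show ?thesis using True by (simp add: ess_bound_def)
    next
      case False
      have "ess_norm f \<le> \<bar>inverse r\<bar> * ess_norm (\<lambda>s. r * f s)"
        using le[OF ess_bound_scale[OF C, of r], of "inverse r"] False by (simp flip: mult.assoc)
      then have "\<bar>r\<bar> * ess_norm f \<le> ess_norm (\<lambda>s. r * f s)"
        using False by (simp add: field_simps)
      then show ?thesis using le[OF C, of r] by simp
    qed
  qed
qed

end

definition l2norm :: "'n::finite linf \<Rightarrow> real" where
  "l2norm u = sqrt (\<integral>s. (linf_rep u s)\<^sup>2 \<partial>sphere_measure)"


section \<open>Scalar products and Riemannian metrics on the space of bounded functions\<close>

text \<open>
  Symmetric bilinear forms that are bounded with respect to the \<open>L\<^sup>2\<close> norm, normed by the minimal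
  constant \<open>C\<close> with \<open>\<bar>B(u,u)\<bar> \<le> C \<parallel>u\<parallel>\<^sup>2\<close>.  They form the vector space in which metrics take values.
\<close>

typedef (overloaded) 'n sform =
  "{B :: 'n::finite linf \<Rightarrow> 'n linf \<Rightarrow> real.
      (\<forall>u. linear (B u)) \<and> (\<forall>u v. B u v = B v u) \<and> (\<exists>C\<ge>0. \<forall>u. \<bar>B u u\<bar> \<le> C * (l2norm u)\<^sup>2)}"
  morphisms sform_app Abs_sform
  by (rule exI[of _ "\<lambda>_ _. 0"]) (auto intro!: exI[of _ 0] linearI)

setup_lifting type_definition_sform

definition form_norm :: "('n::finite linf \<Rightarrow> 'n linf \<Rightarrow> real) \<Rightarrow> real" where
  "form_norm B = Inf {C. 0 \<le> C \<and> (\<forall>u. \<bar>B u u\<bar> \<le> C * (l2norm u)\<^sup>2)}"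

lemma form_norm_bound:
  assumes "0 \<le> C" "\<forall>u. \<bar>B u u\<bar> \<le> C * (l2norm u)\<^sup>2"
  shows "0 \<le> form_norm B" "\<bar>B u u\<bar> \<le> form_norm B * (l2norm u)\<^sup>2"
proof -
  let ?A = "{C. 0 \<le> C \<and> (\<forall>u. \<bar>B u u\<bar> \<le> C * (l2norm u)\<^sup>2)}"
  have ne: "?A \<noteq> {}" using assms by blast
  show "0 \<le> form_norm B"
    unfolding form_norm_def using ne by (intro cInf_greatest) auto
  show "\<bar>B u u\<bar> \<le> form_norm B * (l2norm u)\<^sup>2"
  proof (cases "l2norm u = 0")
    case True
    then show ?thesis using assms(2)[rule_format, of u] by simp
  next
    case False
    then have p: "0 < (l2norm u)\<^sup>2" by simp
    have "\<bar>B u u\<bar> / (l2norm u)\<^sup>2 \<le> form_norm B"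
      unfolding form_norm_def using ne p by (intro cInf_greatest) (auto simp: pos_divide_le_eq)
    then show ?thesis using p by (simp add: pos_divide_le_eq)
  qed
qed

lemma form_norm_le:
  assumes "0 \<le> C" "\<And>u. \<bar>B u u\<bar> \<le> C * (l2norm u)\<^sup>2"
  shows "form_norm B \<le> C"
  unfolding form_norm_def using assms by (intro cInf_lower) (auto intro!: bdd_belowI[of _ 0])

instantiation sform :: (finite) "{zero, plus, scaleR}"
begin

lift_definition zero_sform :: "'a sform" is "\<lambda>_ _. 0"
  by (auto intro!: exI[of _ 0] linearI)

lift_definition plus_sform :: "'a sform \<Rightarrow> 'a sform \<Rightarrow> 'a sform" is "\<lambda>A B u v. A u v + B u v"
proof (intro conjI allI)
  fix A B :: "'a linf \<Rightarrow> 'a linf \<Rightarrow> real"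
  assume A: "(\<forall>u. linear (A u)) \<and> (\<forall>u v. A u v = A v u) \<and> (\<exists>C\<ge>0. \<forall>u. \<bar>A u u\<bar> \<le> C * (l2norm u)\<^sup>2)"
    and B: "(\<forall>u. linear (B u)) \<and> (\<forall>u v. B u v = B v u) \<and> (\<exists>C\<ge>0. \<forall>u. \<bar>B u u\<bar> \<le> C * (l2norm u)\<^sup>2)"
  show "linear (\<lambda>v. A u v + B u v)" for u
    using A B by (intro linear_compose_add) blast+
  show "A u v + B u v = A v u + B v u" for u v
    using A B by metis
  obtain C D where "C \<ge> 0" "D \<ge> 0" "\<And>u. \<bar>A u u\<bar> \<le> C * (l2norm u)\<^sup>2" "\<And>u. \<bar>B u u\<bar> \<le> D * (l2norm u)\<^sup>2"
    using A B by blast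
  then have "\<bar>A u u + B u u\<bar> \<le> (C + D) * (l2norm u)\<^sup>2" for u
    by (smt (verit) distrib_right)
  then show "\<exists>C\<ge>0. \<forall>u. \<bar>A u u + B u u\<bar> \<le> C * (l2norm u)\<^sup>2"
    using \<open>C \<ge> 0\<close> \<open>D \<ge> 0\<close> by (intro exI[of _ "C + D"]) auto
qed

lift_definition scaleR_sform :: "real \<Rightarrow> 'a sform \<Rightarrow> 'a sform" is "\<lambda>r B u v. r * B u v"
proof (intro conjI allI)
  fix r :: real and B :: "'a linf \<Rightarrow> 'a linf \<Rightarrow> real"
  assume B: "(\<forall>u. linear (B u)) \<and> (\<forall>u v. B u v = B v u) \<and> (\<exists>C\<ge>0. \<forall>u. \<bar>B u u\<bar> \<le> C * (l2norm u)\<^sup>2)"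
  show "linear (\<lambda>v. r * B u v)" for u
    using B linear_compose_scale_right[of "B u" r] by simp
  show "r * B u v = r * B v u" for u v
    using B by metis
  obtain C where C: "C \<ge> 0" "\<And>u. \<bar>B u u\<bar> \<le> C * (l2norm u)\<^sup>2"
    using B by blast
  have "\<bar>r * B u u\<bar> \<le> (\<bar>r\<bar> * C) * (l2norm u)\<^sup>2" for u
    using C(2)[of u] by (simp add: abs_mult mult.assoc mult_left_mono)
  then show "\<exists>C\<ge>0. \<forall>u. \<bar>r * B u u\<bar> \<le> C * (l2norm u)\<^sup>2"
    using C(1) by (intro exI[of _ "\<bar>r\<bar> * C"]) auto
qed

instance ..

end

instantiation sform :: (finite) real_vector
begin

definition uminus_sform :: "'a sform \<Rightarrow> 'a sform" where "uminus_sform B = (-1) *\<^sub>R B"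
definition minus_sform :: "'a sform \<Rightarrow> 'a sform \<Rightarrow> 'a sform" where "minus_sform A B = A + - B"

instance
proof
  fix a b c :: "'a sform" and r q :: real
  show "a + b + c = a + (b + c)" by transfer (simp add: add.assoc)
  show "a + b = b + a" by transfer (simp add: add.commute)
  show "0 + a = a" by transfer simp
  show "- a + a = 0" unfolding uminus_sform_def by transfer simp
  show "a - b = a + - b" by (rule minus_sform_def)
  show "r *\<^sub>R (a + b) = r *\<^sub>R a + r *\<^sub>R b" by transfer (simp add: algebra_simps)
  show "(r + q) *\<^sub>R a = r *\<^sub>R a + q *\<^sub>R a" by transfer (simp add: algebra_simps)
  show "r *\<^sub>R q *\<^sub>R a = (r * q) *\<^sub>R a" by transfer (simp add: algebra_simps)
  show "1 *\<^sub>R a = a" by transfer simp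
qed

end

instantiation sform :: (finite) real_normed_vector
begin

lift_definition norm_sform :: "'a sform \<Rightarrow> real" is form_norm .

definition sgn_sform :: "'a sform \<Rightarrow> 'a sform" where "sgn_sform x = x /\<^sub>R norm x"
definition dist_sform :: "'a sform \<Rightarrow> 'a sform \<Rightarrow> real" where "dist_sform x y = norm (x - y)"
definition uniformity_sform :: "('a sform \<times> 'a sform) filter" where
  "uniformity_sform = (INF e\<in>{0 <..}. principal {(x, y). dist x y < e})"
definition open_sform :: "'a sform set \<Rightarrow> bool" where
  "open_sform S = (\<forall>x\<in>S. \<forall>\<^sub>F (x', y) in uniformity. x' = x \<longrightarrow> y \<in> S)"

instance
proof
  fix a b c :: "'a sform" and r q :: real
  show "sgn a = a /\<^sub>R norm a" by (rule sgn_sform_def)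
  show "dist a b = norm (a - b)" by (rule dist_sform_def)
  show "(uniformity :: ('a sform \<times> 'a sform) filter) = (INF e\<in>{0 <..}. principal {(x, y). dist x y < e})"
    by (rule uniformity_sform_def)
  show "open S = (\<forall>x\<in>S. \<forall>\<^sub>F (x', y) in uniformity. x' = x \<longrightarrow> y \<in> S)" for S :: "'a sform set"
    by (rule open_sform_def)
  show "norm a = 0 \<longleftrightarrow> a = 0"
  proof transfer
    fix B :: "'a linf \<Rightarrow> 'a linf \<Rightarrow> real"
    assume B: "(\<forall>u. linear (B u)) \<and> (\<forall>u v. B u v = B v u) \<and> (\<exists>C\<ge>0. \<forall>u. \<bar>B u u\<bar> \<le> C * (l2norm u)\<^sup>2)"
    then obtain C where C: "C \<ge> 0" "\<forall>u. \<bar>B u u\<bar> \<le> C * (l2norm u)\<^sup>2" by blast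
    show "form_norm B = 0 \<longleftrightarrow> B = (\<lambda>_ _. 0)"
    proof
      assume 0: "form_norm B = 0"
      have d: "B u u = 0" for u using form_norm_bound(2)[of C B, OF C, of u] 0 by simp
      have "B u v = 0" for u v
      proof -
        have add: "B w (u + v) = B w u + B w v" for w u v using B linear_add by blast
        have "B (u + v) (u + v) = B u u + B u v + (B u v + B v v)"
          using B by (metis add)
        then show ?thesis using d by simp
      qed
      then show "B = (\<lambda>_ _. 0)" by blast
    next
      assume B: "B = (\<lambda>_ _. 0)"
      have "form_norm B \<le> 0" by (rule form_norm_le) (simp_all add: B)
      then show "form_norm B = 0" using form_norm_bound(1)[of C B, OF C] by simp
    qed
  qed
  show "norm (a + b) \<le> norm a + norm b"
  proof transfer
    fix A B :: "'a linf \<Rightarrow> 'a linf \<Rightarrow> real"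
    assume "(\<forall>u. linear (A u)) \<and> (\<forall>u v. A u v = A v u) \<and> (\<exists>C\<ge>0. \<forall>u. \<bar>A u u\<bar> \<le> C * (l2norm u)\<^sup>2)"
      and "(\<forall>u. linear (B u)) \<and> (\<forall>u v. B u v = B v u) \<and> (\<exists>C\<ge>0. \<forall>u. \<bar>B u u\<bar> \<le> C * (l2norm u)\<^sup>2)"
    then obtain C D where C: "C \<ge> 0" "\<forall>u. \<bar>A u u\<bar> \<le> C * (l2norm u)\<^sup>2"
      and D: "D \<ge> 0" "\<forall>u. \<bar>B u u\<bar> \<le> D * (l2norm u)\<^sup>2" by blast
    show "form_norm (\<lambda>u v. A u v + B u v) \<le> form_norm A + form_norm B"
    proof (rule form_norm_le)
      show "0 \<le> form_norm A + form_norm B"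
        using form_norm_bound(1)[of C A, OF C] form_norm_bound(1)[of D B, OF D] by simp
      show "\<bar>A u u + B u u\<bar> \<le> (form_norm A + form_norm B) * (l2norm u)\<^sup>2" for u
        using form_norm_bound(2)[of C A, OF C, of u] form_norm_bound(2)[of D B, OF D, of u]
        by (simp add: distrib_right)
    qed
  qed
  show "norm (r *\<^sub>R a) = \<bar>r\<bar> * norm a"
  proof transfer
    fix r :: real and B :: "'a linf \<Rightarrow> 'a linf \<Rightarrow> real"
    assume "(\<forall>u. linear (B u)) \<and> (\<forall>u v. B u v = B v u) \<and> (\<exists>C\<ge>0. \<forall>u. \<bar>B u u\<bar> \<le> C * (l2norm u)\<^sup>2)"
    then obtain C where C: "C \<ge> 0" "\<forall>u. \<bar>B u u\<bar> \<le> C * (l2norm u)\<^sup>2" by blast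
    have b: "\<bar>r * B u u\<bar> \<le> \<bar>r\<bar> * form_norm B * (l2norm u)\<^sup>2" for u
      using form_norm_bound(2)[of C B, OF C, of u] by (simp add: abs_mult mult.assoc mult_left_mono)
    have n: "0 \<le> \<bar>r\<bar> * form_norm B" using form_norm_bound(1)[of C B, OF C] by simp
    have le: "form_norm (\<lambda>u v. r * B u v) \<le> \<bar>r\<bar> * form_norm B"
      using form_norm_le[of "\<bar>r\<bar> * form_norm B" "\<lambda>u v. r * B u v"] n b by blast
    have b': "\<forall>u. \<bar>r * B u u\<bar> \<le> \<bar>r\<bar> * form_norm B * (l2norm u)\<^sup>2"
      using b by blast
    note rb = form_norm_bound[of "\<bar>r\<bar> * form_norm B" "\<lambda>u v. r * B u v", OF n b']
    show "form_norm (\<lambda>u v. r * B u v) = \<bar>r\<bar> * form_norm B"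
    proof (cases "r = 0")
      case True
      then show ?thesis using le rb(1) by simp
    next
      case False
      have "form_norm B \<le> form_norm (\<lambda>u v. r * B u v) / \<bar>r\<bar>"
        using rb False by (intro form_norm_le) (auto simp: abs_mult field_simps)
      then show ?thesis using le False by (simp add: field_simps)
    qed
  qed
qed

end

definition scalar_product :: "'n::finite sform \<Rightarrow> bool" where
  "scalar_product B \<longleftrightarrow> (\<exists>c>0. \<forall>u. c * (l2norm u)\<^sup>2 \<le> sform_app B u u)"

definition riemannian_metric_on :: "'n::finite linf set \<Rightarrow> ('n linf \<Rightarrow> 'n sform) \<Rightarrow> bool" where
  "riemannian_metric_on U G \<longleftrightarrow> open U \<and> smooth_on U G \<and> (\<forall>p\<in>U. scalar_product (G p))"


section \<open>Connections\<close>

text \<open>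
  The Levi-Civita connection of a metric \<open>h\<close> on an open subset \<open>W\<close> of a Euclidean space:
  \<open>nabla Y u a\<close> is the covariant derivative at \<open>u\<close> of the field \<open>Y\<close> in the direction \<open>a\<close>.
\<close>

abbreviation deriv_at :: "('a::real_normed_vector \<Rightarrow> 'b::real_normed_vector) \<Rightarrow> 'a \<Rightarrow> 'a \<Rightarrow> 'b" where
  "deriv_at f u a \<equiv> frechet_derivative f (at u) a"

definition levi_civita ::
  "'k::euclidean_space set \<Rightarrow> ('k \<Rightarrow> 'k \<Rightarrow> 'k \<Rightarrow> real) \<Rightarrow> (('k \<Rightarrow> 'k) \<Rightarrow> 'k \<Rightarrow> 'k \<Rightarrow> 'k) \<Rightarrow> bool" where
  "levi_civita W h nabla \<longleftrightarrow>
     (\<forall>Y. smooth_on W Y \<longrightarrow> (\<forall>u\<in>W. linear (nabla Y u))) \<and>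
     (\<forall>X Y. smooth_on W X \<longrightarrow> smooth_on W Y \<longrightarrow> smooth_on W (\<lambda>u. nabla Y u (X u))) \<and>
     (\<forall>Y Z. smooth_on W Y \<longrightarrow> smooth_on W Z \<longrightarrow>
        (\<forall>u\<in>W. \<forall>a. nabla (\<lambda>w. Y w + Z w) u a = nabla Y u a + nabla Z u a)) \<and>
     (\<forall>f Y. smooth_on W f \<longrightarrow> smooth_on W Y \<longrightarrow>
        (\<forall>u\<in>W. \<forall>a. nabla (\<lambda>w. f w *\<^sub>R Y w) u a = deriv_at f u a *\<^sub>R Y u + f u *\<^sub>R nabla Y u a)) \<and>
     (\<forall>X Y. smooth_on W X \<longrightarrow> smooth_on W Y \<longrightarrow>
        (\<forall>u\<in>W. nabla Y u (X u) - nabla X u (Y u) = deriv_at Y u (X u) - deriv_at X u (Y u))) \<and>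
     (\<forall>Y Z. smooth_on W Y \<longrightarrow> smooth_on W Z \<longrightarrow>
        (\<forall>u\<in>W. \<forall>a. deriv_at (\<lambda>w. h w (Y w) (Z w)) u a = h u (nabla Y u a) (Z u) + h u (Y u) (nabla Z u a)))"


section \<open>Riemannian manifolds\<close>

text \<open>
  The underlying space of \<open>M\<close> is a type; a chart is a pair of its domain and its coordinate map.
  A tangent vector at \<open>x\<close> is the family of its coordinates in all charts of the atlas around \<open>x\<close>
  (and \<open>0\<close> for the other charts), subject to the usual transformation law.
\<close>

type_synonym ('m, 'n) chart = "'m set \<times> ('m \<Rightarrow> real^'n)"
type_synonym ('m, 'n) tvec = "('m, 'n) chart \<Rightarrow> real^'n"

abbreviation chart_inv :: "('m, 'n::finite) chart \<Rightarrow> real^'n \<Rightarrow> 'm" where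
  "chart_inv c \<equiv> inv_into (fst c) (snd c)"

definition smooth_atlas :: "('m::topological_space, 'n::finite) chart set \<Rightarrow> bool" where
  "smooth_atlas A \<longleftrightarrow>
     (\<Union>c\<in>A. fst c) = UNIV \<and>
     (\<forall>c\<in>A. open (fst c) \<and> open (snd c ` fst c) \<and>
        homeomorphism (fst c) (snd c ` fst c) (snd c) (chart_inv c)) \<and>
     (\<forall>c\<in>A. \<forall>d\<in>A. smooth_on (snd c ` (fst c \<inter> fst d)) (snd d \<circ> chart_inv c))"

definition charts_at :: "('m, 'n::finite) chart set \<Rightarrow> 'm \<Rightarrow> ('m, 'n) chart set" where
  "charts_at A x = {c \<in> A. x \<in> fst c}"

definition chart_at :: "('m, 'n::finite) chart set \<Rightarrow> 'm \<Rightarrow> ('m, 'n) chart" where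
  "chart_at A x = (SOME c. c \<in> charts_at A x)"

definition tangent_space :: "('m, 'n::finite) chart set \<Rightarrow> 'm \<Rightarrow> ('m, 'n) tvec set" where
  "tangent_space A x =
     {v. (\<forall>c. c \<notin> charts_at A x \<longrightarrow> v c = 0) \<and>
         (\<forall>c\<in>charts_at A x. \<forall>d\<in>charts_at A x. v d = deriv_at (snd d \<circ> chart_inv c) (snd c x) (v c))}"

text \<open>The tangent vector at \<open>x\<close> with coordinates \<open>a\<close> in the chart \<open>c\<close>.\<close>

definition coord_vec ::
  "('m, 'n::finite) chart set \<Rightarrow> 'm \<Rightarrow> ('m, 'n) chart \<Rightarrow> real^'n \<Rightarrow> ('m, 'n) tvec" where
  "coord_vec A x c a =
     (\<lambda>d. if d \<in> charts_at A x then deriv_at (snd d \<circ> chart_inv c) (snd c x) a else 0)"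

definition metric_coords ::
  "('m, 'n::finite) chart set \<Rightarrow> ('m \<Rightarrow> ('m, 'n) tvec \<Rightarrow> ('m, 'n) tvec \<Rightarrow> real) \<Rightarrow>
     ('m, 'n) chart \<Rightarrow> real^'n \<Rightarrow> real^'n \<Rightarrow> real^'n \<Rightarrow> real" where
  "metric_coords A g c u a b =
     (let x = chart_inv c u in g x (coord_vec A x c a) (coord_vec A x c b))"

definition riemannian_manifold ::
  "('m::{t2_space, second_countable_topology}, 'n::finite) chart set \<Rightarrow>
     ('m \<Rightarrow> ('m, 'n) tvec \<Rightarrow> ('m, 'n) tvec \<Rightarrow> real) \<Rightarrow> bool" where
  "riemannian_manifold A g \<longleftrightarrow> smooth_atlas A \<and>
     (\<forall>c\<in>A. \<forall>u\<in>snd c ` fst c.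
        bilinear (metric_coords A g c u) \<and>
        (\<forall>a b. metric_coords A g c u a b = metric_coords A g c u b a) \<and>
        (\<forall>a. a \<noteq> 0 \<longrightarrow> metric_coords A g c u a a > 0)) \<and>
     (\<forall>c\<in>A. \<forall>a b. smooth_on (snd c ` fst c) (\<lambda>u. metric_coords A g c u a b))"

text \<open>By the transformation law the differential does not depend on the chart chosen at \<open>x\<close>.\<close>

definition mdiff ::
  "('m, 'n::finite) chart set \<Rightarrow> ('m \<Rightarrow> 'b::real_normed_vector) \<Rightarrow> 'm \<Rightarrow> ('m, 'n) tvec \<Rightarrow> 'b" where
  "mdiff A f x v = (let c = chart_at A x in deriv_at (f \<circ> chart_inv c) (snd c x) (v c))"

definition grad ::
  "('m, 'n::finite) chart set \<Rightarrow> ('m \<Rightarrow> ('m, 'n) tvec \<Rightarrow> ('m, 'n) tvec \<Rightarrow> real) \<Rightarrow>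
     ('m \<Rightarrow> real) \<Rightarrow> 'm \<Rightarrow> ('m, 'n) tvec" where
  "grad A g f x =
     (THE v. v \<in> tangent_space A x \<and> (\<forall>w\<in>tangent_space A x. g x v w = mdiff A f x w))"

definition unit_tangent_sphere ::
  "('m, 'n::finite) chart set \<Rightarrow> ('m \<Rightarrow> ('m, 'n) tvec \<Rightarrow> ('m, 'n) tvec \<Rightarrow> real) \<Rightarrow>
     'm \<Rightarrow> ('m, 'n) tvec set" where
  "unit_tangent_sphere A g x = {v \<in> tangent_space A x. g x v v = 1}"

text \<open>
  The Haar probability measure of the unit tangent sphere, transported from the standard sphere by
  a linear isometry; the choice of the isometry is irrelevant by \<open>sphere_measure_orthogonal\<close>.
  The sigma-algebra is the Borel one, described in the coordinates of a chart.
\<close>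

definition unit_tangent_haar ::
  "('m, 'n::finite) chart set \<Rightarrow> ('m \<Rightarrow> ('m, 'n) tvec \<Rightarrow> ('m, 'n) tvec \<Rightarrow> real) \<Rightarrow>
     'm \<Rightarrow> ('m, 'n) tvec measure" where
  "unit_tangent_haar A g x =
     (let c = chart_at A x;
          J = (SOME L :: real^'n \<Rightarrow> real^'n. linear L \<and>
                 (\<forall>a. g x (coord_vec A x c (L a)) (coord_vec A x c (L a)) = (norm a)\<^sup>2))
      in distr sphere_measure (vimage_algebra (unit_tangent_sphere A g x) (\<lambda>v. v c) borel)
           (\<lambda>s. coord_vec A x c (J s)))"


subsection \<open>Distance and geodesics\<close>

definition velocity ::
  "('m, 'n::finite) chart set \<Rightarrow> (real \<Rightarrow> 'm) \<Rightarrow> real \<Rightarrow> ('m, 'n) tvec" where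
  "velocity A \<gamma> t =
     (\<lambda>c. if c \<in> charts_at A (\<gamma> t) then vector_derivative (snd c \<circ> \<gamma>) (at t) else 0)"

definition piecewise_C1_curve ::
  "('m::topological_space, 'n::finite) chart set \<Rightarrow> (real \<Rightarrow> 'm) \<Rightarrow> bool" where
  "piecewise_C1_curve A \<gamma> \<longleftrightarrow> continuous_on {0..1} \<gamma> \<and>
     (\<forall>c\<in>A. \<forall>a b. {a..b} \<subseteq> {0..1} \<and> \<gamma> ` {a..b} \<subseteq> fst c \<longrightarrow>
        (snd c \<circ> \<gamma>) piecewise_C1_differentiable_on {a..b})"

definition curve_length ::
  "('m, 'n::finite) chart set \<Rightarrow> ('m \<Rightarrow> ('m, 'n) tvec \<Rightarrow> ('m, 'n) tvec \<Rightarrow> real) \<Rightarrow>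
     (real \<Rightarrow> 'm) \<Rightarrow> ennreal" where
  "curve_length A g \<gamma> =
     (\<integral>\<^sup>+t\<in>{0..1}. ennreal (sqrt (g (\<gamma> t) (velocity A \<gamma> t) (velocity A \<gamma> t))) \<partial>lborel)"

definition riemannian_dist ::
  "('m::topological_space, 'n::finite) chart set \<Rightarrow> ('m \<Rightarrow> ('m, 'n) tvec \<Rightarrow> ('m, 'n) tvec \<Rightarrow> real) \<Rightarrow>
     'm \<Rightarrow> 'm \<Rightarrow> ennreal" where
  "riemannian_dist A g x y =
     (INF \<gamma>\<in>{\<gamma>. piecewise_C1_curve A \<gamma> \<and> \<gamma> 0 = x \<and> \<gamma> 1 = y}. curve_length A g \<gamma>)"

text \<open>
  The geodesic equation \<open>\<gamma>'' + \<Gamma>(\<gamma>', \<gamma>') = 0\<close> in each chart; the Christoffel term \<open>\<Gamma>(v, v)\<close> is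
  the covariant derivative in the direction \<open>v\<close> of the field with constant coordinates \<open>v\<close>.
\<close>

definition geodesic ::
  "('m::topological_space, 'n::finite) chart set \<Rightarrow> ('m \<Rightarrow> ('m, 'n) tvec \<Rightarrow> ('m, 'n) tvec \<Rightarrow> real) \<Rightarrow>
     (real \<Rightarrow> 'm) \<Rightarrow> bool" where
  "geodesic A g \<gamma> \<longleftrightarrow> continuous_on {0..1} \<gamma> \<and>
     (\<forall>c\<in>A. smooth_on_subset ({0..1} \<inter> \<gamma> -` fst c) (snd c \<circ> \<gamma>) \<and>
        (\<exists>nabla. levi_civita (snd c ` fst c) (metric_coords A g c) nabla \<and>
           (\<forall>t\<in>{0<..<1} \<inter> \<gamma> -` fst c.
              let v = vector_derivative (snd c \<circ> \<gamma>) (at t) in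
              vector_derivative (\<lambda>r. vector_derivative (snd c \<circ> \<gamma>) (at r)) (at t)
                + nabla (\<lambda>_. v) (snd c (\<gamma> t)) v = 0)))"

definition minimally_geodesic ::
  "('m::topological_space, 'n::finite) chart set \<Rightarrow> ('m \<Rightarrow> ('m, 'n) tvec \<Rightarrow> ('m, 'n) tvec \<Rightarrow> real) \<Rightarrow>
     bool" where
  "minimally_geodesic A g \<longleftrightarrow>
     (\<forall>x y. \<exists>\<gamma>. geodesic A g \<gamma> \<and> \<gamma> 0 = x \<and> \<gamma> 1 = y \<and> curve_length A g \<gamma> = riemannian_dist A g x y)"


section \<open>Special embeddings and special metrics\<close>

text \<open>\<open>\<phi> s x\<close> is the value at \<open>x\<close> of the function with index \<open>s\<close>.\<close>

definition special_embedding ::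
  "('m, 'n::finite) chart set \<Rightarrow> ('m \<Rightarrow> ('m, 'n) tvec \<Rightarrow> ('m, 'n) tvec \<Rightarrow> real) \<Rightarrow>
     (real^'n \<Rightarrow> 'm \<Rightarrow> real) \<Rightarrow> ('m \<Rightarrow> 'n linf) \<Rightarrow> bool" where
  "special_embedding A g \<phi> \<Phi> \<longleftrightarrow>
     (\<forall>x. linf_rel (\<lambda>s. \<phi> s x) (linf_rep (\<Phi> x))) \<and>
     (\<forall>c\<in>A. smooth_on_subset ((snd c ` fst c) \<times> sphere 0 1) (\<lambda>(u, s). \<phi> s (chart_inv c u))) \<and>
     (\<forall>s\<in>sphere 0 1. \<forall>x. sqrt (g x (grad A g (\<phi> s) x) (grad A g (\<phi> s) x)) = 1) \<and>
     (\<forall>x. bij_betw (\<lambda>s. grad A g (\<phi> s) x) (sphere 0 1) (unit_tangent_sphere A g x) \<and>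
        (\<forall>c\<in>charts_at A x.
           diffeomorphism (sphere 0 1) ((\<lambda>v. v c) ` unit_tangent_sphere A g x)
             (\<lambda>s. grad A g (\<phi> s) x c)))"

definition special_measure ::
  "('m, 'n::finite) chart set \<Rightarrow> ('m \<Rightarrow> ('m, 'n) tvec \<Rightarrow> ('m, 'n) tvec \<Rightarrow> real) \<Rightarrow>
     (real^'n \<Rightarrow> 'm \<Rightarrow> real) \<Rightarrow> 'm \<Rightarrow> (real^'n) measure" where
  "special_measure A g \<phi> x =
     distr (unit_tangent_haar A g x) sphere_measure (inv_into (sphere 0 1) (\<lambda>s. grad A g (\<phi> s) x))"

text \<open>
  The densities \<open>\<rho> p\<close> are bounded, since \<open>G p\<close> is bounded by a multiple of the \<open>L\<^sup>2\<close> norm; they depend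
  smoothly on \<open>p\<close> as elements of the space of bounded functions.
\<close>

definition special_metric ::
  "('m, 'n::finite) chart set \<Rightarrow> ('m \<Rightarrow> ('m, 'n) tvec \<Rightarrow> ('m, 'n) tvec \<Rightarrow> real) \<Rightarrow>
     (real^'n \<Rightarrow> 'm \<Rightarrow> real) \<Rightarrow> ('m \<Rightarrow> 'n linf) \<Rightarrow> 'n linf set \<Rightarrow> ('n linf \<Rightarrow> 'n sform) \<Rightarrow> bool" where
  "special_metric A g \<phi> \<Phi> U G \<longleftrightarrow>
     (\<exists>(\<nu> :: 'n linf \<Rightarrow> (real^'n) measure) (\<rho> :: 'n linf \<Rightarrow> 'n linf).
        (\<forall>p\<in>U. prob_space (\<nu> p) \<and>
           (\<forall>X Y. sform_app (G p) X Y = real CARD('n) * (\<integral>s. linf_rep X s * linf_rep Y s \<partial>\<nu> p)) \<and>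
           \<nu> p = density sphere_measure (\<lambda>s. ennreal (linf_rep (\<rho> p) s)) \<and>
           (\<exists>c>0. AE s in sphere_measure. c \<le> linf_rep (\<rho> p) s)) \<and>
        smooth_on U \<rho> \<and>
        (\<forall>x. \<Phi> x \<in> U \<longrightarrow> \<nu> (\<Phi> x) = special_measure A g \<phi> x))"


section \<open>Mean curvature\<close>

definition tangent_image ::
  "('m, 'n::finite) chart set \<Rightarrow> ('m \<Rightarrow> 'n linf) \<Rightarrow> 'm \<Rightarrow> 'n linf set" where
  "tangent_image A \<Phi> x = mdiff A \<Phi> x ` tangent_space A x"

definition local_param ::
  "'n::finite linf set \<Rightarrow> 'k::euclidean_space set \<Rightarrow> ('k \<Rightarrow> 'n linf) \<Rightarrow> bool" where
  "local_param F W \<psi> \<longleftrightarrow> open W \<and> smooth_on W \<psi> \<and> (\<forall>u\<in>W. inj (frechet_derivative \<psi> (at u))) \<and>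
     openin (top_of_set F) (\<psi> ` W) \<and> homeomorphism W (\<psi> ` W) \<psi> (inv_into W \<psi>)"

text \<open>Smooth embedded submanifolds modelled on the Euclidean space \<open>'k\<close>.\<close>

definition submanifold :: "'k::euclidean_space itself \<Rightarrow> 'n::finite linf set \<Rightarrow> bool" where
  "submanifold _ F \<longleftrightarrow> (\<forall>p\<in>F. \<exists>W (\<psi> :: 'k \<Rightarrow> 'n linf). local_param F W \<psi> \<and> p \<in> \<psi> ` W)"

definition submanifold_tangent ::
  "'k::euclidean_space itself \<Rightarrow> 'n::finite linf set \<Rightarrow> 'n linf \<Rightarrow> 'n linf set" where
  "submanifold_tangent _ F p =
     {X. \<exists>W (\<psi> :: 'k \<Rightarrow> 'n linf) u a. local_param F W \<psi> \<and> u \<in> W \<and> \<psi> u = p \<and> X = deriv_at \<psi> u a}"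

text \<open>
  The finite-dimensional submanifolds \<open>F\<close> by means of which the second fundamental form at \<open>x\<close> in
  the direction \<open>V\<close> is computed.
\<close>

definition extends_image_at ::
  "'k::euclidean_space itself \<Rightarrow> ('m \<Rightarrow> 'n::finite linf) \<Rightarrow> 'n linf set \<Rightarrow> 'm \<Rightarrow> 'n linf \<Rightarrow>
     'n linf set \<Rightarrow> bool" where
  "extends_image_at K \<Phi> U x V F \<longleftrightarrow> submanifold K F \<and> F \<subseteq> U \<and>
     (\<exists>N. open N \<and> \<Phi> x \<in> N \<and> N \<inter> range \<Phi> \<subseteq> F) \<and> V \<in> submanifold_tangent K F (\<Phi> x)"

definition pullback_metric ::
  "('n::finite linf \<Rightarrow> 'n sform) \<Rightarrow> ('k::euclidean_space \<Rightarrow> 'n linf) \<Rightarrow> 'k \<Rightarrow> 'k \<Rightarrow> 'k \<Rightarrow> real" where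
  "pullback_metric G \<psi> u a b = sform_app (G (\<psi> u)) (deriv_at \<psi> u a) (deriv_at \<psi> u b)"

text \<open>
  \<open>second_fundamental_form K A \<Phi> G F x V q\<close>: for every \<open>T\<close> tangent to the image of \<open>\<Phi>\<close>, the number
  \<open>q T\<close> is the value on \<open>(T, T)\<close> of the second fundamental form, computed with some admissible
  choice of the extending field.  The field is given near \<open>\<Phi> x\<close> by its coordinates \<open>\<tau>\<close> in a local
  parametrization \<open>\<psi>\<close> of \<open>F\<close>; it takes values tangent to the image of \<open>\<Phi>\<close> at all points of that
  image.  The connection \<open>nabla\<close> is the Levi-Civita connection of the metric induced on \<open>F\<close>, read in
  the same parametrization.
\<close>

definition second_fundamental_form ::
  "'k::euclidean_space itself \<Rightarrow> ('m, 'n::finite) chart set \<Rightarrow> ('m \<Rightarrow> 'n linf) \<Rightarrow>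
     ('n linf \<Rightarrow> 'n sform) \<Rightarrow> 'n linf set \<Rightarrow> 'm \<Rightarrow> 'n linf \<Rightarrow> ('n linf \<Rightarrow> real) \<Rightarrow> bool" where
  "second_fundamental_form _ A \<Phi> G F x V q \<longleftrightarrow>
     (\<forall>T\<in>tangent_image A \<Phi> x. \<exists>W (\<psi> :: 'k \<Rightarrow> 'n linf) u nabla \<tau>.
        local_param F W \<psi> \<and> u \<in> W \<and> \<psi> u = \<Phi> x \<and>
        levi_civita W (pullback_metric G \<psi>) nabla \<and>
        smooth_on W \<tau> \<and> (\<forall>w\<in>W. \<forall>y. \<psi> w = \<Phi> y \<longrightarrow> deriv_at \<psi> w (\<tau> w) \<in> tangent_image A \<Phi> y) \<and>
        deriv_at \<psi> u (\<tau> u) = T \<and>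
        q T = sform_app (G (\<Phi> x)) (deriv_at \<psi> u (nabla \<tau> u (\<tau> u))) V)"

definition orthonormal_basis :: "'n::finite sform \<Rightarrow> 'n linf set \<Rightarrow> 'n linf set \<Rightarrow> bool" where
  "orthonormal_basis B L E \<longleftrightarrow> finite E \<and> span E = L \<and>
     (\<forall>e\<in>E. \<forall>f\<in>E. sform_app B e f = (if e = f then 1 else 0))"

definition form_trace :: "'n::finite sform \<Rightarrow> 'n linf set \<Rightarrow> ('n linf \<Rightarrow> real) \<Rightarrow> real" where
  "form_trace B L q = (THE r. \<forall>E. orthonormal_basis B L E \<longrightarrow> r = (\<Sum>e\<in>E. q e))"

text \<open>The mean curvature, as a function of the second fundamental form \<open>q\<close> at \<open>x\<close>.\<close>

definition mean_curvature ::
  "('m, 'n::finite) chart set \<Rightarrow> ('m \<Rightarrow> 'n linf) \<Rightarrow> ('n linf \<Rightarrow> 'n sform) \<Rightarrow> 'm \<Rightarrow>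
     ('n linf \<Rightarrow> real) \<Rightarrow> real" where
  "mean_curvature A \<Phi> G x q = form_trace (G (\<Phi> x)) (tangent_image A \<Phi> x) q"

end

theory Submission
  imports Defs
begin

text \<open>
  In a chart write \<open>f u s\<close> for the value of the function with index \<open>s\<close> at the point with coordinates
  \<open>u\<close>, and \<open>R u\<close> for the density of the measure attached to that point.  The functions \<open>f u s\<close> solve
  the eikonal equation, and \<open>s \<mapsto> grad (f u s)\<close> carries \<open>R u\<close> to the uniform measure of the unit
  tangent sphere.

  The metric is \<open>G (X, Y) = n \<integral> X Y \<rho>\<close> on an open subset of a vector space of functions.  In the
  linear structure of that space, the Koszul formula expresses the second fundamental form on
  \<open>T = d\<Phi> (v)\<close> in the direction \<open>V\<close> by integrals over the sphere
  (\<open>second_fundamental_form_value\<close>):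
  \<open>n (\<integral> D\<^sup>2f (v, v) V R + \<integral> T V \<rho>' (T) - \<integral> T\<^sup>2 \<rho>' (V) / 2)\<close>.
  When this is summed over an orthonormal frame \<open>v\<close>, the third term disappears: the squares
  \<open>T\<^sup>2\<close> add up to \<open>\<bar>grad f\<bar>\<^sup>2 = 1\<close>, and \<open>\<integral> \<rho>' (V) = 0\<close> because all densities have total mass \<open>1\<close>.
  The first two terms add up to \<open>\<integral> V div (R grad f)\<close> and a term that is tangent to the image, hence
  orthogonal to \<open>V\<close>.

  So everything rests on \<open>div (R grad f) = 0\<close> for almost every \<open>s\<close> (\<open>weighted_divergence\<close>).
  Geometrically, the gradient lines of \<open>f\<close> are geodesics, so the map \<open>(x, s) \<mapsto> grad (f x s)\<close>
  conjugates the geodesic flow to a flow that fixes \<open>s\<close>, and the divergence vanishes by Liouville's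
  theorem on the invariance of the measure of the unit tangent bundle.  The proof below is
  infinitesimal.  By rotation invariance the integral of \<open>exp (df (a)) df (b) R\<close> is
  \<open>\<kappa> (\<gamma> (a, a)) \<gamma> (a, b)\<close> at every point, for a universal function \<open>\<kappa>\<close> (\<open>pairing_exp\<close>).
  The trace over \<open>b\<close> of its derivative in the direction \<open>b\<close> contains the divergence tested against
  \<open>exp (df (a))\<close>.  The geodesic property \<open>D\<^sup>2f (a, grad f) = d\<gamma> (a) (grad f, grad f) / 2\<close>
  (\<open>hessian_gradient\<close>) turns the other term into a second moment of the sphere, whose contribution
  cancels the derivative of \<open>\<kappa>\<close>.  Only the contracted Christoffel symbols of the chart remain, that
  is, a tangential term.  Finally, the functions \<open>exp (df (a))\<close> of \<open>s\<close> span an algebra that separates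
  the points of the sphere, so they determine an essentially bounded function
  (\<open>linf_zero_if_orthogonal_to_exponentials\<close>).
\<close>

section \<open>The algebra of essentially bounded functions\<close>

instantiation linf :: (finite) times
begin

lift_definition times_linf :: "'a linf \<Rightarrow> 'a linf \<Rightarrow> 'a linf" is "\<lambda>f h s. f s * h s"
proof -
  fix f f' h h' :: "real^'a \<Rightarrow> real"
  assume "linf_rel f f'" "linf_rel h h'"
  then obtain C D where C: "ess_bound f C" "ess_bound h D"
    and m: "f \<in> borel_measurable sphere_measure" "f' \<in> borel_measurable sphere_measure"
      "h \<in> borel_measurable sphere_measure" "h' \<in> borel_measurable sphere_measure"
    and e: "AE s in sphere_measure. f s = f' s" "AE s in sphere_measure. h s = h' s"
    by (auto simp: linf_rel_def)
  have "AE s in sphere_measure. \<bar>f s * h s\<bar> \<le> C * D"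
    using C unfolding ess_bound_def
    by (auto simp: abs_mult intro!: mult_mono elim!: eventually_elim2)
  with C have "ess_bound (\<lambda>s. f s * h s) (C * D)" by (auto simp: ess_bound_def)
  then show "linf_rel (\<lambda>s. f s * h s) (\<lambda>s. f' s * h' s)"
    using m e by (intro linf_rel_intro[of _ _ "C * D"]) (auto elim!: eventually_elim2)
qed

instance ..

end

lemma linf_rel_rep: "linf_rel (linf_rep X) (linf_rep X)"
  using Quotient_linf unfolding Quotient_def by blast

lemma linf_rep_measurable [measurable]: "linf_rep X \<in> borel_measurable sphere_measure"
  using linf_rel_rep by (auto simp: linf_rel_def)

lemma linf_rep_class:
  assumes "linf_rel f f"
  shows "AE s in sphere_measure. linf_rep (linf_class f) s = f s"
proof -
  have "linf_rel (linf_rep (linf_class f)) f"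
    using Quotient3_linf assms unfolding Quotient3_def by (metis (no_types, lifting))
  then show ?thesis by (auto simp: linf_rel_def)
qed

lemma linf_rep_add: "AE s in sphere_measure. linf_rep (X + Y) s = linf_rep X s + linf_rep Y s"
  unfolding plus_linf_def map_fun_def o_def
  by (rule linf_rep_class[OF linf_rel_add[OF linf_rel_rep linf_rel_rep]])

lemma linf_rep_scaleR: "AE s in sphere_measure. linf_rep (r *\<^sub>R X) s = r * linf_rep X s"
  unfolding scaleR_linf_def map_fun_def o_def id_def
  by (rule linf_rep_class[OF linf_rel_scale[OF linf_rel_rep]])

lemma linf_rep_diff: "AE s in sphere_measure. linf_rep (X - Y) s = linf_rep X s - linf_rep Y s"
proof -
  have "X - Y = X + (-1) *\<^sub>R Y" by simp
  then show ?thesis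
    using linf_rep_add[of X "(-1) *\<^sub>R Y"] linf_rep_scaleR[of "-1" Y] by (auto elim!: eventually_elim2)
qed

lemma linf_rep_mult: "AE s in sphere_measure. linf_rep (X * Y) s = linf_rep X s * linf_rep Y s"
proof -
  have "linf_rel (\<lambda>s. linf_rep X s * linf_rep Y s) (\<lambda>s. linf_rep X s * linf_rep Y s)"
    using times_linf.rsp linf_rel_rep unfolding rel_fun_def by blast
  then show ?thesis
    unfolding times_linf_def map_fun_def o_def by (rule linf_rep_class)
qed

lemma norm_linf_eq: "norm X = ess_norm (linf_rep X)"
  by (simp add: norm_linf_def)

lemma linf_rep_bound: "AE s in sphere_measure. \<bar>linf_rep X s\<bar> \<le> norm X"
proof -
  obtain C where "ess_bound (linf_rep X) C"
    using linf_rel_rep[of X] by (auto simp: linf_rel_def)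
  from ess_bound_ess_norm[OF this] show ?thesis
    by (simp add: ess_bound_def norm_linf_eq)
qed

lemma norm_linf_le:
  assumes "0 \<le> C" "AE s in sphere_measure. \<bar>linf_rep X s\<bar> \<le> C"
  shows "norm X \<le> C"
  using assms ess_norm_le[of "linf_rep X" C] by (simp add: ess_bound_def norm_linf_eq)

lemma linf_eqI:
  assumes "AE s in sphere_measure. linf_rep X s = linf_rep Y s"
  shows "X = Y"
proof -
  have "linf_rel (linf_rep X) (linf_rep Y)"
    using assms linf_rel_rep by (auto simp: linf_rel_def)
  then show ?thesis
    using Quotient3_linf by (metis Quotient3_rel_rep)
qed

lemma linf_classI:
  assumes [measurable]: "f \<in> borel_measurable sphere_measure" and "\<And>s. s \<in> sphere 0 1 \<Longrightarrow> \<bar>f s\<bar> \<le> C"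
  shows "linf_rel f f"
proof -
  have "AE s in sphere_measure. \<bar>f s\<bar> \<le> \<bar>C\<bar>"
    using assms(2) by (intro AE_I2) (force simp: space_sphere_measure)
  then show ?thesis
    by (intro linf_rel_intro[of _ _ "\<bar>C\<bar>"]) (auto simp: ess_bound_def)
qed

interpretation sphere: prob_space "sphere_measure :: (real^'n::finite) measure"
  by (rule prob_space_sphere_measure)

lemma linf_integrable [simp]: "integrable sphere_measure (linf_rep X)"
  by (rule sphere.integrable_const_bound[of _ "norm X"]) (use linf_rep_bound in auto)

lemma bounded_bilinear_linf_mult: "bounded_bilinear ((*) :: 'n::finite linf \<Rightarrow> _)"
proof
  fix X Y Z :: "'n linf" and r :: real
  show "(X + Y) * Z = X * Z + Y * Z"
    apply (rule linf_eqI)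
    using linf_rep_mult[of "X + Y" Z] linf_rep_add[of X Y] linf_rep_mult[of X Z]
      linf_rep_mult[of Y Z] linf_rep_add[of "X * Z" "Y * Z"]
    by eventually_elim (simp add: distrib_right)
  show "X * (Y + Z) = X * Y + X * Z"
    apply (rule linf_eqI)
    using linf_rep_mult[of X "Y + Z"] linf_rep_add[of Y Z] linf_rep_mult[of X Y]
      linf_rep_mult[of X Z] linf_rep_add[of "X * Y" "X * Z"]
    by eventually_elim (simp add: distrib_left)
  show "(r *\<^sub>R X) * Y = r *\<^sub>R (X * Y)"
    apply (rule linf_eqI)
    using linf_rep_mult[of "r *\<^sub>R X" Y] linf_rep_scaleR[of r X] linf_rep_mult[of X Y]
      linf_rep_scaleR[of r "X * Y"]
    by eventually_elim simp
  show "X * (r *\<^sub>R Y) = r *\<^sub>R (X * Y)"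
    apply (rule linf_eqI)
    using linf_rep_mult[of X "r *\<^sub>R Y"] linf_rep_scaleR[of r Y] linf_rep_mult[of X Y]
      linf_rep_scaleR[of r "X * Y"]
    by eventually_elim simp
  have "norm (X * Y) \<le> norm X * norm Y * 1" for X Y :: "'n linf"
  proof (rule norm_linf_le)
    show "AE s in sphere_measure. \<bar>linf_rep (X * Y) s\<bar> \<le> norm X * norm Y * 1"
      using linf_rep_mult[of X Y] linf_rep_bound[of X] linf_rep_bound[of Y]
      by eventually_elim (auto simp: abs_mult intro!: mult_mono)
  qed simp
  then show "\<exists>K. \<forall>X Y :: 'n linf. norm (X * Y) \<le> norm X * norm Y * K" by blast
qed

interpretation linf_mult: bounded_bilinear "(*) :: 'n::finite linf \<Rightarrow> _"
  by (rule bounded_bilinear_linf_mult)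

instance linf :: (finite) comm_ring
proof
  fix X Y Z :: "'a linf"
  show "X * Y * Z = X * (Y * Z)"
    apply (rule linf_eqI)
    using linf_rep_mult[of X Y] linf_rep_mult[of "X * Y" Z] linf_rep_mult[of X "Y * Z"] linf_rep_mult[of Y Z]
    by eventually_elim simp
  show "X * Y = Y * X"
    apply (rule linf_eqI)
    using linf_rep_mult[of X Y] linf_rep_mult[of Y X] by eventually_elim simp
  show "(X + Y) * Z = X * Z + Y * Z"
    by (rule linf_mult.add_left)
qed

text \<open>Integrals are taken in the algebra of classes: products of classes and this functional are continuous,
  so that integrals of products are differentiated by the rules for bounded (bi)linear maps.\<close>

definition linf_int :: "'n::finite linf \<Rightarrow> real" where
  "linf_int X = (\<integral>s. linf_rep X s \<partial>sphere_measure)"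

lemma bounded_linear_linf_int: "bounded_linear (linf_int :: 'n::finite linf \<Rightarrow> real)"
proof
  fix X Y :: "'n linf" and r :: real
  have "linf_int (X + Y) = (\<integral>s. linf_rep X s + linf_rep Y s \<partial>sphere_measure)"
    unfolding linf_int_def by (rule integral_cong_AE) (use linf_rep_add in auto)
  then show "linf_int (X + Y) = linf_int X + linf_int Y" by (simp add: linf_int_def)
  have "linf_int (r *\<^sub>R X) = (\<integral>s. r * linf_rep X s \<partial>sphere_measure)"
    unfolding linf_int_def by (rule integral_cong_AE) (use linf_rep_scaleR in auto)
  then show "linf_int (r *\<^sub>R X) = r *\<^sub>R linf_int X" by (simp add: linf_int_def)
  have "norm (linf_int X) \<le> norm X * 1" for X :: "'n linf"
  proof -
    have "\<bar>linf_int X\<bar> \<le> (\<integral>s. \<bar>linf_rep X s\<bar> \<partial>(sphere_measure :: (real^'n) measure))"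
      unfolding linf_int_def by (rule integral_abs_bound)
    also have "\<dots> \<le> (\<integral>s. norm X \<partial>(sphere_measure :: (real^'n) measure))"
      by (rule integral_mono_AE) (use linf_rep_bound in auto)
    finally show ?thesis by (simp add: sphere.prob_space)
  qed
  then show "\<exists>K. \<forall>X :: 'n linf. norm (linf_int X) \<le> norm X * K" by blast
qed

lemma linf_int_mult3:
  "linf_int (X * Y * Z) = (\<integral>s. linf_rep X s * linf_rep Y s * linf_rep Z s \<partial>sphere_measure)"
  unfolding linf_int_def
proof (rule integral_cong_AE)
  show "AE s in sphere_measure. linf_rep (X * Y * Z) s = linf_rep X s * linf_rep Y s * linf_rep Z s"
    using linf_rep_mult[of "X * Y" Z] linf_rep_mult[of X Y] by eventually_elim simp
qed measurable

section \<open>Derivatives of smooth maps\<close>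

lemma prod_list_norm_nonneg: "0 \<le> prod_list (map norm (vs :: 'a::real_normed_vector list))"
  by (induction vs) auto

text \<open>A choice of the higher derivatives whose existence \<open>smooth_on\<close> asserts.\<close>

locale derivative_family =
  fixes U :: "'a::real_normed_vector set" and f :: "'a \<Rightarrow> 'b::real_normed_vector"
    and D :: "'a \<Rightarrow> 'a list \<Rightarrow> 'b"
  assumes open_domain: "open U"
    and D_Nil: "\<And>x. x \<in> U \<Longrightarrow> D x [] = f x"
    and D_linear: "\<And>x vs ws. x \<in> U \<Longrightarrow> linear (\<lambda>v. D x (vs @ v # ws))"
    and D_bounded: "\<And>x k. x \<in> U \<Longrightarrow> \<exists>C. \<forall>vs. length vs = k \<longrightarrow> norm (D x vs) \<le> C * prod_list (map norm vs)"
    and D_step: "\<And>x k e. x \<in> U \<Longrightarrow> e > 0 \<Longrightarrow> \<exists>d>0. \<forall>y\<in>U. norm (y - x) < d \<longrightarrow>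
        (\<forall>vs. length vs = k \<longrightarrow>
          norm (D y vs - D x vs - D x ((y - x) # vs)) \<le> e * norm (y - x) * prod_list (map norm vs))"
begin

lemma bounded_linear_D: 
  assumes "x \<in> U" shows "bounded_linear (\<lambda>v. D x (v # vs))"
proof -
  obtain C where "\<forall>ws. length ws = Suc (length vs) \<longrightarrow> norm (D x ws) \<le> C * prod_list (map norm ws)"
    using D_bounded[OF assms] by blast
  from this[rule_format, of "v # vs" for v]
  have "norm (D x (v # vs)) \<le> norm v * (C * prod_list (map norm vs))" for v
    by (simp add: mult_ac)
  with D_linear[OF assms, of "[]" vs] show ?thesis
    by (intro bounded_linear_intro[of _ "C * prod_list (map norm vs)"])
      (auto simp: linear_iff)
qed

lemma has_derivative_D:
  assumes "x \<in> U" shows "((\<lambda>y. D y vs) has_derivative (\<lambda>v. D x (v # vs))) (at x)"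
proof -
  have "((\<lambda>y. D y vs) has_derivative (\<lambda>v. D x (v # vs))) (at x within U)"
    unfolding has_derivative_within_alt
  proof (intro conjI allI impI bounded_linear_D[OF assms])
    fix e :: real assume "0 < e"
    define p where "p = prod_list (map norm vs)"
    have "0 \<le> p" by (simp add: p_def prod_list_norm_nonneg)
    with \<open>0 < e\<close> have "0 < e / (p + 1)" by simp
    from D_step[OF assms this, of "length vs"] obtain d where "d > 0"
      and d: "\<And>y. y \<in> U \<Longrightarrow> norm (y - x) < d \<Longrightarrow>
        norm (D y vs - D x vs - D x ((y - x) # vs)) \<le> e / (p + 1) * norm (y - x) * p"
      unfolding p_def by metis
    have "e / (p + 1) * norm z * p \<le> e * norm z" for z :: 'a
    proof -
      have "p / (p + 1) \<le> 1" using \<open>0 \<le> p\<close> by simp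
      then have "e * norm z * (p / (p + 1)) \<le> e * norm z * 1"
        using \<open>0 < e\<close> by (intro mult_left_mono) auto
      then show ?thesis by (simp add: mult_ac)
    qed
    with d \<open>d > 0\<close> show "\<exists>d>0. \<forall>y\<in>U. norm (y - x) < d \<longrightarrow>
        norm (D y vs - D x vs - D x ((y - x) # vs)) \<le> e * norm (y - x)"
      by (meson order_trans)
  qed
  then show ?thesis using at_within_open[OF assms open_domain] by simp
qed

lemma has_derivative_f:
  assumes "x \<in> U" shows "(f has_derivative (\<lambda>v. D x [v])) (at x)"
  by (rule has_derivative_transform_within_open[OF has_derivative_D[OF assms] open_domain assms])
    (rule D_Nil)

lemma deriv_at_f: "x \<in> U \<Longrightarrow> deriv_at f x = (\<lambda>v. D x [v])"
  using frechet_derivative_at[OF has_derivative_f] by simp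

lemma D_locally_bounded:
  assumes "x \<in> U"
  obtains d C where "d > 0" "C \<ge> 0"
    "\<And>y vs. y \<in> U \<Longrightarrow> norm (y - x) < d \<Longrightarrow> length vs = k \<Longrightarrow> norm (D y vs) \<le> C * prod_list (map norm vs)"
proof -
  obtain C0 where C0: "\<And>vs. length vs = k \<Longrightarrow> norm (D x vs) \<le> C0 * prod_list (map norm vs)"
    using D_bounded[OF assms] by metis
  obtain C1 where C1: "\<And>vs. length vs = Suc k \<Longrightarrow> norm (D x vs) \<le> C1 * prod_list (map norm vs)"
    using D_bounded[OF assms] by metis
  obtain d where "d > 0" and d: "\<And>y vs. y \<in> U \<Longrightarrow> norm (y - x) < d \<Longrightarrow> length vs = k \<Longrightarrow>
       norm (D y vs - D x vs - D x ((y - x) # vs)) \<le> 1 * norm (y - x) * prod_list (map norm vs)"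
    using D_step[OF assms zero_less_one] by metis
  show ?thesis
  proof (rule that[of "min d 1" "\<bar>C0\<bar> + \<bar>C1\<bar> + 1"])
    fix y and vs :: "'a list" assume y: "y \<in> U" "norm (y - x) < min d 1" and vs: "length vs = k"
    define p where "p = prod_list (map norm vs)"
    have p: "0 \<le> p" by (simp add: p_def prod_list_norm_nonneg)
    have "norm (D y vs) \<le> norm (D y vs - D x vs - D x ((y - x) # vs)) + norm (D x vs) + norm (D x ((y - x) # vs))"
      using order_trans[OF norm_triangle_ineq add_right_mono[OF norm_triangle_ineq],
          of "D y vs - D x vs - D x ((y - x) # vs)" "D x vs" "D x ((y - x) # vs)"] by simp
    also have "norm (D x ((y - x) # vs)) \<le> C1 * (norm (y - x) * p)"
      using C1[of "(y - x) # vs"] vs by (simp add: p_def)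
    also have "C1 * (norm (y - x) * p) \<le> \<bar>C1\<bar> * (1 * p)"
      using y p by (intro mult_mono) auto
    also have "norm (D x vs) \<le> \<bar>C0\<bar> * p"
      using C0[OF vs] mult_right_mono[OF abs_ge_self[of C0] p] by (simp add: p_def)
    also have "norm (D y vs - D x vs - D x ((y - x) # vs)) \<le> 1 * p"
      using d[of y vs] y vs mult_right_mono[OF _ p, of "norm (y - x)" 1] by (fastforce simp: p_def)
    finally show "norm (D y vs) \<le> (\<bar>C0\<bar> + \<bar>C1\<bar> + 1) * p"
      by (simp add: algebra_simps)
  qed (use \<open>d > 0\<close> in auto)
qed

text \<open>Both mixed second derivatives are the limit of the second difference
  \<open>(f (x + t v + t w) - f (x + t v) - f (x + t w) + f x) / t\<^sup>2\<close>, which is symmetric in \<open>v\<close>, \<open>w\<close>.\<close>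

lemma second_difference:
  assumes "x \<in> U" "0 < e"
  shows "\<exists>d>0. \<forall>t. 0 < t \<longrightarrow> t < d \<longrightarrow>
    norm (f (x + t *\<^sub>R v + t *\<^sub>R w) - f (x + t *\<^sub>R v) - f (x + t *\<^sub>R w) + f x - t\<^sup>2 *\<^sub>R D x [w, v]) \<le> e * t\<^sup>2"
proof -
  define m where "m = norm v + norm w + 1"
  have m: "0 < m" by (simp add: m_def add_nonneg_pos)
  obtain r where r: "r > 0" "ball x r \<subseteq> U"
    using assms open_domain open_contains_ball by blast
  have "0 < e / (2 * m)" using assms m by simp
  with has_derivative_D[OF assms(1), of "[v]"] obtain d where "d > 0"
    and d: "\<And>y. norm (y - x) < d \<Longrightarrow> norm (D y [v] - D x [v] - D x [y - x, v]) \<le> e / (2 * m) * norm (y - x)"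
    unfolding has_derivative_within_alt by (metis UNIV_I)
  let ?L = "D x [w, v]"
  show ?thesis
  proof (rule exI[of _ "min d r / m"], intro conjI allI impI)
    show "min d r / m > 0" using \<open>d > 0\<close> r m by simp
    fix t :: real assume t: "0 < t" "t < min d r / m"
    have small: "norm (\<alpha> *\<^sub>R v + \<beta> *\<^sub>R w) \<le> t * m \<and> norm (\<alpha> *\<^sub>R v + \<beta> *\<^sub>R w) < min d r"
      if "\<alpha> \<in> {0..t}" "\<beta> \<in> {0..t}" for \<alpha> \<beta>
    proof -
      have "norm (\<alpha> *\<^sub>R v + \<beta> *\<^sub>R w) \<le> \<bar>\<alpha>\<bar> * norm v + \<bar>\<beta>\<bar> * norm w"
        using norm_triangle_ineq[of "\<alpha> *\<^sub>R v" "\<beta> *\<^sub>R w"] by simp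
      also have "\<dots> \<le> t * norm v + t * norm w"
        using that by (intro add_mono mult_right_mono) auto
      also have "\<dots> \<le> t * m" using t by (simp add: m_def algebra_simps)
      finally show ?thesis using t m by (simp add: pos_less_divide_eq)
    qed
    have inU: "x + (\<alpha> *\<^sub>R v + \<beta> *\<^sub>R w) \<in> U" if "\<alpha> \<in> {0..t}" "\<beta> \<in> {0..t}" for \<alpha> \<beta>
      using r small[OF that] by (auto intro!: subsetD[OF r(2)] simp: dist_norm norm_minus_commute[of 0] minus_add_distrib[symmetric] simp del: minus_add_distrib)
    define g where "g \<rho> = f (x + (\<rho> *\<^sub>R v + t *\<^sub>R w)) - f (x + (\<rho> *\<^sub>R v + 0 *\<^sub>R w)) - (\<rho> * t) *\<^sub>R ?L" for \<rho>
    define g' where "g' \<rho> = D (x + (\<rho> *\<^sub>R v + t *\<^sub>R w)) [v] - D (x + (\<rho> *\<^sub>R v + 0 *\<^sub>R w)) [v] - t *\<^sub>R ?L" for \<rho>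
    have der: "(g has_derivative (\<lambda>h. h *\<^sub>R g' \<rho>)) (at \<rho> within {0..t})" if "\<rho> \<in> {0..t}" for \<rho>
    proof -
      have 1: "((\<lambda>\<rho>. f (x + (\<rho> *\<^sub>R v + \<beta> *\<^sub>R w))) has_derivative
          (\<lambda>h. h *\<^sub>R D (x + (\<rho> *\<^sub>R v + \<beta> *\<^sub>R w)) [v])) (at \<rho> within {0..t})" if b: "\<beta> \<in> {0..t}" for \<beta>
      proof -
        have "((\<lambda>\<rho>. f (x + (\<rho> *\<^sub>R v + \<beta> *\<^sub>R w))) has_derivative
          (\<lambda>h. D (x + (\<rho> *\<^sub>R v + \<beta> *\<^sub>R w)) [h *\<^sub>R v])) (at \<rho> within {0..t})"
          by (rule has_derivative_compose[of "\<lambda>\<rho>. x + (\<rho> *\<^sub>R v + \<beta> *\<^sub>R w)" "\<lambda>h. h *\<^sub>R v",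
                OF _ has_derivative_f[OF inU[OF \<open>\<rho> \<in> {0..t}\<close> b]]])
            (auto intro!: derivative_eq_intros)
        moreover have "D (x + (\<rho> *\<^sub>R v + \<beta> *\<^sub>R w)) [h *\<^sub>R v] = h *\<^sub>R D (x + (\<rho> *\<^sub>R v + \<beta> *\<^sub>R w)) [v]" for h
          using linear_cmul[OF D_linear[OF inU[OF \<open>\<rho> \<in> {0..t}\<close> b], of "[]" "[]"]] by simp
        ultimately show ?thesis by simp
      qed
      have tt: "t \<in> {0..t}" "0 \<in> {0..t}" using t by auto
      show ?thesis unfolding g_def g'_def
        by (rule has_derivative_eq_rhs, (rule has_derivative_diff 1 tt)+,
            (rule derivative_eq_intros refl)+) (auto simp: algebra_simps)
    qed
    have bd: "onorm (\<lambda>h. h *\<^sub>R g' \<rho>) \<le> e * t" if "\<rho> \<in> {0..t}" for \<rho>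
    proof (rule onorm_le)
      fix h :: real
      let ?y = "x + (\<rho> *\<^sub>R v + t *\<^sub>R w)" and ?z = "x + (\<rho> *\<^sub>R v + 0 *\<^sub>R w)"
      have tt: "t \<in> {0..t}" "0 \<in> {0..t}" using t by auto
      have lin: "D x [?y - x, v] - D x [?z - x, v] = t *\<^sub>R ?L"
        using linear_add[OF D_linear[OF assms(1), of "[]" "[v]"], of "\<rho> *\<^sub>R v" "t *\<^sub>R w"]
          linear_cmul[OF D_linear[OF assms(1), of "[]" "[v]"], of t w] by simp
      have est: "e / (2 * m) * norm (\<rho> *\<^sub>R v + \<beta> *\<^sub>R w) \<le> e * t / 2" if "\<beta> \<in> {0..t}" for \<beta>
      proof -
        have "e / (2 * m) * norm (\<rho> *\<^sub>R v + \<beta> *\<^sub>R w) \<le> e / (2 * m) * (t * m)"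
          using small[OF \<open>\<rho> \<in> {0..t}\<close> that] assms m by (intro mult_left_mono) auto
        then show ?thesis using m by simp
      qed
      have y: "norm (D ?y [v] - D x [v] - D x [?y - x, v]) \<le> e * t / 2"
        by (rule order_trans[OF d])
          (use small[OF that tt(1)] in simp, use est[OF tt(1)] in \<open>simp only: add_diff_cancel_left'\<close>)
      have z: "norm (D ?z [v] - D x [v] - D x [?z - x, v]) \<le> e * t / 2"
        by (rule order_trans[OF d])
          (use small[OF that tt(2)] in simp, use est[OF tt(2)] in \<open>simp only: add_diff_cancel_left'\<close>)
      have "g' \<rho> = (D ?y [v] - D x [v] - D x [?y - x, v]) - (D ?z [v] - D x [v] - D x [?z - x, v])"
        unfolding g'_def lin[symmetric] by simp
      also have "norm \<dots> \<le> e * t / 2 + e * t / 2"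
        by (rule order_trans[OF norm_triangle_ineq4 add_mono[OF y z]])
      finally have "norm (g' \<rho>) \<le> e * t" by simp
      then show "norm (h *\<^sub>R g' \<rho>) \<le> e * t * norm h"
        using mult_right_mono[of "norm (g' \<rho>)" "e * t" "\<bar>h\<bar>"] by (simp add: mult.commute)
    qed
    have "norm (g t - g 0) \<le> e * t * norm (t - 0)"
      by (rule differentiable_bound[OF _ der bd]) (use t in auto)
    moreover have "g t - g 0 = f (x + t *\<^sub>R v + t *\<^sub>R w) - f (x + t *\<^sub>R v) - f (x + t *\<^sub>R w) + f x - t\<^sup>2 *\<^sub>R ?L"
      by (simp add: g_def power2_eq_square add.assoc)
    ultimately show "norm (f (x + t *\<^sub>R v + t *\<^sub>R w) - f (x + t *\<^sub>R v) - f (x + t *\<^sub>R w) + f x - t\<^sup>2 *\<^sub>R ?L) \<le> e * t\<^sup>2"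
      using t by (simp add: power2_eq_square mult.assoc)
  qed
qed

lemma D_symmetric:
  assumes "x \<in> U" shows "D x [v, w] = D x [w, v]"
proof -
  let ?\<Delta> = "\<lambda>t. f (x + t *\<^sub>R v + t *\<^sub>R w) - f (x + t *\<^sub>R v) - f (x + t *\<^sub>R w) + f x"
  have "norm (D x [v, w] - D x [w, v]) \<le> 2 * e" if "e > 0" for e
  proof -
    obtain d where "d > 0" and d: "\<And>t. 0 < t \<Longrightarrow> t < d \<Longrightarrow>
      norm (?\<Delta> t - t\<^sup>2 *\<^sub>R D x [w, v]) \<le> e * t\<^sup>2"
      using second_difference[OF assms \<open>e > 0\<close>, of v w] by auto
    obtain c where "c > 0" and c: "\<And>t. 0 < t \<Longrightarrow> t < c \<Longrightarrow>
      norm (?\<Delta> t - t\<^sup>2 *\<^sub>R D x [v, w]) \<le> e * t\<^sup>2"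
      using second_difference[OF assms \<open>e > 0\<close>, of w v] by (auto simp: algebra_simps)
    define t where "t = min c d / 2"
    have t: "0 < t" "t < d" "t < c" using \<open>c > 0\<close> \<open>d > 0\<close> by (auto simp: t_def)
    have "t\<^sup>2 * norm (D x [v, w] - D x [w, v]) = norm (t\<^sup>2 *\<^sub>R (D x [v, w] - D x [w, v]))"
      by simp
    also have "t\<^sup>2 *\<^sub>R (D x [v, w] - D x [w, v]) =
        (?\<Delta> t - t\<^sup>2 *\<^sub>R D x [w, v]) - (?\<Delta> t - t\<^sup>2 *\<^sub>R D x [v, w])"
      by (simp add: scaleR_diff_right)
    also have "norm \<dots> \<le> e * t\<^sup>2 + e * t\<^sup>2"
      by (rule order_trans[OF norm_triangle_ineq4 add_mono[OF d[OF t(1,2)] c[OF t(1,3)]]])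
    also have "\<dots> = t\<^sup>2 * (2 * e)" by simp
    finally show ?thesis using t by simp
  qed
  from this[of "norm (D x [v, w] - D x [w, v]) / 4"] show ?thesis
    by (cases "D x [v, w] = D x [w, v]") auto
qed

end

lemma smooth_on_derivative_family:
  assumes "open U" "smooth_on U f"
  obtains D where "derivative_family U f D"
proof -
  obtain D where D: "\<forall>x\<in>U. D x [] = f x" "\<forall>x\<in>U. \<forall>vs ws. linear (\<lambda>v. D x (vs @ v # ws))"
    "\<forall>x\<in>U. \<forall>k. \<exists>C. \<forall>vs. length vs = k \<longrightarrow> norm (D x vs) \<le> C * prod_list (map norm vs)"
    "\<forall>x\<in>U. \<forall>k. \<forall>e>0. \<exists>d>0. \<forall>y\<in>U. norm (y - x) < d \<longrightarrow>
        (\<forall>vs. length vs = k \<longrightarrow>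
          norm (D y vs - D x vs - D x ((y - x) # vs)) \<le> e * norm (y - x) * prod_list (map norm vs))"
    using assms(2) unfolding smooth_on_def by (elim exE conjE) (rule that)
  show thesis
    by (rule that, rule derivative_family.intro[OF assms(1) D(1)[rule_format] D(2)[rule_format]
      D(3)[rule_format] D(4)[rule_format]])
qed

lemma smooth_on_differentiable:
  assumes "open U" "smooth_on U f" "x \<in> U"
  shows "(f has_derivative deriv_at f x) (at x)"
proof -
  obtain D where "derivative_family U f D"
    by (rule smooth_on_derivative_family[OF assms(1,2)])
  then interpret derivative_family U f D .
  show ?thesis
    using has_derivative_f[OF assms(3)] unfolding deriv_at_f[OF assms(3)] .
qed

lemma smooth_on_const: "smooth_on U (\<lambda>_. c)"
  unfolding smooth_on_def
proof (rule exI[of _ "\<lambda>_ vs. if vs = [] then c else 0"], intro conjI ballI allI impI)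
  show "linear (\<lambda>v. if vs @ v # ws = [] then c else 0)" for vs ws :: "'a list"
    by (simp add: linear_iff)
  show "\<exists>C. \<forall>vs. length vs = k \<longrightarrow> norm (if vs = [] then c else 0) \<le> C * prod_list (map norm vs)"
    for k and x :: 'a
    by (rule exI[of _ "norm c"]) (auto simp: prod_list_norm_nonneg)
  show "\<exists>d>0. \<forall>y\<in>U. norm (y - x) < d \<longrightarrow> (\<forall>vs. length vs = k \<longrightarrow>
      norm ((if vs = [] then c else 0) - (if vs = [] then c else 0) - (if (y - x) # vs = [] then c else 0))
        \<le> e * norm (y - x) * prod_list (map norm vs))" if "0 < e" for x :: 'a and k e
    using that by (intro exI[of _ 1]) (auto simp: prod_list_norm_nonneg)
qed simp

section \<open>Smooth families of functions with a compact parameter space\<close>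

abbreviation partial1 :: "('a::real_normed_vector \<Rightarrow> 's \<Rightarrow> real) \<Rightarrow> 'a \<Rightarrow> 's \<Rightarrow> 'a \<Rightarrow> real" where
  "partial1 f u s b \<equiv> deriv_at (\<lambda>u. f u s) u b"
abbreviation partial2 :: "('a::real_normed_vector \<Rightarrow> 's \<Rightarrow> real) \<Rightarrow> 'a \<Rightarrow> 's \<Rightarrow> 'a \<Rightarrow> 'a \<Rightarrow> real" where
  "partial2 f u s a b \<equiv> deriv_at (\<lambda>u. partial1 f u s b) u a"

text \<open>The parameter space is a compact set that need not be open.  The partial derivatives in \<open>u\<close> are those
  of local smooth extensions to open sets; this makes them continuous in \<open>s\<close> and bounded uniformly in \<open>s\<close>.\<close>

locale smooth_family =
  fixes \<Omega> :: "'a::real_normed_vector set" and K :: "'s::real_normed_vector set" and f :: "'a \<Rightarrow> 's \<Rightarrow> real"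
  assumes open_\<Omega>: "open \<Omega>" and compact_K: "compact K"
    and smooth_f: "smooth_on_subset (\<Omega> \<times> K) (\<lambda>(u, s). f u s)"
begin

lemma local_extension:
  assumes "u0 \<in> \<Omega>" "s0 \<in> K"
  obtains W F D where "derivative_family W F D" "(u0, s0) \<in> W"
    "\<forall>u s. (u, s) \<in> W \<longrightarrow> u \<in> \<Omega> \<longrightarrow> s \<in> K \<longrightarrow>
       ((\<lambda>u. f u s) has_derivative (\<lambda>b. D (u, s) [(b, 0)])) (at u)"
    "\<forall>u s b. (u, s) \<in> W \<longrightarrow> u \<in> \<Omega> \<longrightarrow> s \<in> K \<longrightarrow>
       ((\<lambda>u. partial1 f u s b) has_derivative (\<lambda>a. D (u, s) [(a, 0), (b, 0)])) (at u)"
proof -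
  obtain W F where W: "open W" "(u0, s0) \<in> W" "smooth_on W F"
    and F: "\<And>y. y \<in> W \<inter> \<Omega> \<times> K \<Longrightarrow> F y = (\<lambda>(u, s). f u s) y"
    using smooth_f[unfolded smooth_on_subset_def, rule_format, OF SigmaI[OF assms]] by blast
  obtain D where D: "derivative_family W F D"
    by (rule smooth_on_derivative_family[OF W(1,3)])
  interpret derivative_family W F D by fact
  have slice: "((\<lambda>u. D (u, s) vs) has_derivative (\<lambda>b. D (u, s) ((b, 0) # vs))) (at u)"
    if "(u, s) \<in> W" for u s vs
    by (rule has_derivative_compose[of "\<lambda>u. (u, s)" "\<lambda>b. (b, 0)", OF _ has_derivative_D[OF that, of vs]])
      (auto intro!: derivative_eq_intros)
  have nb: "open {u \<in> \<Omega>. (u, s) \<in> W}" for s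
  proof -
    have "open ((\<lambda>u. (u, s)) -` W)"
      by (rule open_vimage[OF W(1)]) (intro continuous_intros)
    moreover have "{u \<in> \<Omega>. (u, s) \<in> W} = \<Omega> \<inter> (\<lambda>u. (u, s)) -` W" by auto
    ultimately show ?thesis using open_\<Omega> by auto
  qed
  have 1: "((\<lambda>u. f u s) has_derivative (\<lambda>b. D (u, s) [(b, 0)])) (at u)"
    if "(u, s) \<in> W" "u \<in> \<Omega>" "s \<in> K" for u s
    by (rule has_derivative_transform_within_open[OF slice[OF that(1), of "[]"] nb[of s]])
      (use that in \<open>auto simp: D_Nil F\<close>)
  have 2: "partial1 f u s b = D (u, s) [(b, 0)]" if "(u, s) \<in> W" "u \<in> \<Omega>" "s \<in> K" for u s b
    by (rule fun_cong[OF frechet_derivative_at[OF 1[OF that]], symmetric])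
  have 3: "((\<lambda>u. partial1 f u s b) has_derivative (\<lambda>a. D (u, s) [(a, 0), (b, 0)])) (at u)"
    if "(u, s) \<in> W" "u \<in> \<Omega>" "s \<in> K" for u s b
    by (rule has_derivative_transform_within_open[OF slice[OF that(1), of "[(b, 0)]"] nb[of s]])
      (use that in \<open>auto simp only: 2 mem_Collect_eq\<close>)
  show thesis by (rule that[OF D W(2)]) (intro allI impI, rule 1 3, assumption+)+
qed

lemma has_derivative_family:
  assumes "u \<in> \<Omega>" "s \<in> K"
  shows "((\<lambda>u. f u s) has_derivative partial1 f u s) (at u)"
    and "((\<lambda>u. partial1 f u s b) has_derivative (\<lambda>a. partial2 f u s a b)) (at u)"
proof -
  obtain W F D where "derivative_family W F D" and D: "(u, s) \<in> W"
    and d: "\<forall>u s. (u, s) \<in> W \<longrightarrow> u \<in> \<Omega> \<longrightarrow> s \<in> K \<longrightarrow>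
       ((\<lambda>u. f u s) has_derivative (\<lambda>b. D (u, s) [(b, 0)])) (at u)"
    "\<forall>u s b. (u, s) \<in> W \<longrightarrow> u \<in> \<Omega> \<longrightarrow> s \<in> K \<longrightarrow>
       ((\<lambda>u. partial1 f u s b) has_derivative (\<lambda>a. D (u, s) [(a, 0), (b, 0)])) (at u)"
    by (rule local_extension[OF assms])
  show "((\<lambda>u. f u s) has_derivative partial1 f u s) (at u)"
    using d(1)[rule_format, OF D assms] unfolding frechet_derivative_at[OF d(1)[rule_format, OF D assms]] .
  show "((\<lambda>u. partial1 f u s b) has_derivative (\<lambda>a. partial2 f u s a b)) (at u)"
    using d(2)[rule_format, OF D assms, of b] unfolding frechet_derivative_at[OF d(2)[rule_format, OF D assms, of b]] .
qed

lemma linear_partial: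
  assumes "u \<in> \<Omega>" "s \<in> K"
  shows "linear (partial1 f u s)" "linear (\<lambda>b. partial2 f u s a b)" "linear (\<lambda>a. partial2 f u s a b)"
    and partial2_commute: "partial2 f u s a b = partial2 f u s b a"
    and continuous_partial: "continuous (at s within K) (\<lambda>s. partial1 f u s b)"
      "continuous (at s within K) (\<lambda>s. partial2 f u s a b)"
proof -
  show l1: "linear (partial1 f u s)"
    by (rule has_derivative_linear[OF has_derivative_family(1)[OF assms]])
  show l: "linear (\<lambda>a. partial2 f u s a b)" for b
    by (rule has_derivative_linear[OF has_derivative_family(2)[OF assms]])
  obtain W F D where D: "derivative_family W F D" "(u, s) \<in> W"
    and d: "\<forall>u s. (u, s) \<in> W \<longrightarrow> u \<in> \<Omega> \<longrightarrow> s \<in> K \<longrightarrow>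
       ((\<lambda>u. f u s) has_derivative (\<lambda>b. D (u, s) [(b, 0)])) (at u)"
    "\<forall>u s b. (u, s) \<in> W \<longrightarrow> u \<in> \<Omega> \<longrightarrow> s \<in> K \<longrightarrow>
       ((\<lambda>u. partial1 f u s b) has_derivative (\<lambda>a. D (u, s) [(a, 0), (b, 0)])) (at u)"
    by (rule local_extension[OF assms])
  interpret derivative_family W F D by fact
  have eq: "partial1 f u s b = D (u, s) [(b, 0)]" "partial2 f u s a b = D (u, s) [(a, 0), (b, 0)]"
    if "(u, s) \<in> W" "u \<in> \<Omega>" "s \<in> K" for u s a b
    by (rule fun_cong[OF frechet_derivative_at[OF d(1)[rule_format, OF that]], symmetric]
        fun_cong[OF frechet_derivative_at[OF d(2)[rule_format, OF that]], symmetric])+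
  show c: "partial2 f u s a b = partial2 f u s b a" for a b
    using eq D_symmetric D assms by metis
  show "linear (\<lambda>b. partial2 f u s a b)" using l[of a] by (simp add: c[of a])
  have nb: "\<forall>\<^sub>F s' in at s within K. (u, s') \<in> W \<and> s' \<in> K"
  proof -
    have "open ((\<lambda>s. (u, s)) -` W)"
      by (rule open_vimage[OF open_domain]) (intro continuous_intros)
    then show ?thesis using D(2) by (auto simp: eventually_at_topological)
  qed
  have cont: "((\<lambda>s. D (u, s) vs) \<longlongrightarrow> D (u, s) vs) (at s within K)" for vs
  proof -
    have "continuous (at (u, s)) (\<lambda>y. D y vs)"
      using has_derivative_continuous[OF has_derivative_D[OF D(2)]] .
    then have *: "((\<lambda>y. D y vs) \<longlongrightarrow> D (u, s) vs) (at (u, s))"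
      by (simp add: continuous_at)
    show ?thesis
      by (rule tendsto_compose[OF *]) (auto intro!: tendsto_intros)
  qed
  show "continuous (at s within K) (\<lambda>s. partial1 f u s b)"
    unfolding continuous_within eq(1)[OF D(2) assms]
    by (rule Lim_transform_eventually[OF cont]) (use nb in eventually_elim, use eq assms in simp)
  show "continuous (at s within K) (\<lambda>s. partial2 f u s a b)"
    unfolding continuous_within eq(2)[OF D(2) assms]
    by (rule Lim_transform_eventually[OF cont]) (use nb in eventually_elim, use eq assms in simp)
qed

text \<open>Around every point of \<open>{u0} \<times> K\<close> the derivatives of a local extension are bounded, and finitely many
  of these neighbourhoods cover the compact set \<open>K\<close>.\<close>

lemma partials_uniformly_bounded:
  assumes "u0 \<in> \<Omega>"
  obtains r C where "r > 0" "C \<ge> 0" "ball u0 r \<subseteq> \<Omega>"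
    "\<And>u s b. u \<in> ball u0 r \<Longrightarrow> s \<in> K \<Longrightarrow> \<bar>partial1 f u s b\<bar> \<le> C * norm b"
    "\<And>u s a b. u \<in> ball u0 r \<Longrightarrow> s \<in> K \<Longrightarrow> \<bar>partial2 f u s a b\<bar> \<le> C * norm a * norm b"
proof -
  obtain r0 where r0: "r0 > 0" "ball u0 r0 \<subseteq> \<Omega>"
    using assms open_\<Omega> open_contains_ball by blast
  define bd where "bd s0 r C \<longleftrightarrow> r > 0 \<and> C \<ge> 0 \<and> (\<forall>u\<in>ball u0 r \<inter> \<Omega>. \<forall>s\<in>ball s0 r \<inter> K.
      (\<forall>b. \<bar>partial1 f u s b\<bar> \<le> C * norm b) \<and> (\<forall>a b. \<bar>partial2 f u s a b\<bar> \<le> C * norm a * norm b))"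
    for s0 r C
  have "\<exists>r C. bd s0 r C"
    if s0: "s0 \<in> K" for s0
  proof -
    obtain W F D where D: "derivative_family W F D" "(u0, s0) \<in> W"
      and d: "\<forall>u s. (u, s) \<in> W \<longrightarrow> u \<in> \<Omega> \<longrightarrow> s \<in> K \<longrightarrow>
         ((\<lambda>u. f u s) has_derivative (\<lambda>b. D (u, s) [(b, 0)])) (at u)"
      "\<forall>u s b. (u, s) \<in> W \<longrightarrow> u \<in> \<Omega> \<longrightarrow> s \<in> K \<longrightarrow>
         ((\<lambda>u. partial1 f u s b) has_derivative (\<lambda>a. D (u, s) [(a, 0), (b, 0)])) (at u)"
      by (rule local_extension[OF assms s0])
    interpret derivative_family W F D by fact
    have eq: "partial1 f u s b = D (u, s) [(b, 0)]" "partial2 f u s a b = D (u, s) [(a, 0), (b, 0)]"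
      if "(u, s) \<in> W" "u \<in> \<Omega>" "s \<in> K" for u s a b
      by (rule fun_cong[OF frechet_derivative_at[OF d(1)[rule_format, OF that]], symmetric]
        fun_cong[OF frechet_derivative_at[OF d(2)[rule_format, OF that]], symmetric])+
    obtain d1 C1 where 1: "d1 > 0" "C1 \<ge> 0"
      "\<And>y vs. y \<in> W \<Longrightarrow> norm (y - (u0, s0)) < d1 \<Longrightarrow> length vs = 1 \<Longrightarrow> norm (D y vs) \<le> C1 * prod_list (map norm vs)"
      using D_locally_bounded[OF D(2), of 1] by metis
    obtain d2 C2 where 2: "d2 > 0" "C2 \<ge> 0"
      "\<And>y vs. y \<in> W \<Longrightarrow> norm (y - (u0, s0)) < d2 \<Longrightarrow> length vs = 2 \<Longrightarrow> norm (D y vs) \<le> C2 * prod_list (map norm vs)"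
      using D_locally_bounded[OF D(2), of 2] by metis
    obtain d3 where 3: "d3 > 0" "ball (u0, s0) d3 \<subseteq> W"
      using open_domain D(2) open_contains_ball by blast
    define r where "r = min d1 (min d2 d3) / 2"
    have r: "r > 0" using 1 2 3 by (simp add: r_def)
    have near: "norm ((u, s) - (u0, s0)) < min d1 (min d2 d3)" if "u \<in> ball u0 r" "s \<in> ball s0 r" for u s
    proof -
      have "norm ((u, s) - (u0, s0)) \<le> norm (u - u0) + norm (s - s0)"
        using norm_Pair_le[of "u - u0" "s - s0"] by simp
      also have "\<dots> < r + r" using that by (intro add_strict_mono) (auto simp: dist_norm norm_minus_commute)
      finally show ?thesis by (simp add: r_def)
    qed
    have inW: "(u, s) \<in> W" if "u \<in> ball u0 r" "s \<in> ball s0 r" for u s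
      
    proof -
      have "dist (u, s) (u0, s0) < d3" using near[OF that] by (simp only: dist_norm min_less_iff_conj)
      then show ?thesis using 3(2) unfolding dist_commute[of "(u, s)"] mem_ball[symmetric] by (rule subsetD[rotated])
    qed
    show ?thesis unfolding bd_def
    proof (rule exI[of _ r], rule exI[of _ "C1 + C2"], intro conjI ballI allI)
      fix u s assume "u \<in> ball u0 r \<inter> \<Omega>" "s \<in> ball s0 r \<inter> K"
      then have us: "u \<in> ball u0 r" "s \<in> ball s0 r" and us': "u \<in> \<Omega>" "s \<in> K" by auto
      note n = near[OF us] and W = inW[OF us]
      show "\<bar>partial1 f u s b\<bar> \<le> (C1 + C2) * norm b" for b
        using 1(3)[OF W, of "[(b, 0)]"] n eq(1)[OF W us'] mult_right_mono[of C1 "C1 + C2" "norm b"] 2(2)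
        by simp
      show "\<bar>partial2 f u s a b\<bar> \<le> (C1 + C2) * norm a * norm b" for a b
        using 2(3)[OF W, of "[(a, 0), (b, 0)]"] n eq(2)[OF W us'] 1(2)
          mult_right_mono[of C2 "C1 + C2" "norm a * norm b"]
        by (simp add: mult.assoc)
    qed (use r 1 2 in auto)
  qed
  then obtain r C where bd: "\<And>s0. s0 \<in> K \<Longrightarrow> bd s0 (r s0) (C s0)"
    by metis
  have rC: "r s0 > 0" "C s0 \<ge> 0" if "s0 \<in> K" for s0
    using bd[OF that] by (simp_all add: bd_def)
  have bds: "\<bar>partial1 f u s b\<bar> \<le> C s0 * norm b" "\<bar>partial2 f u s a b\<bar> \<le> C s0 * norm a * norm b"
    if "s0 \<in> K" "u \<in> ball u0 (r s0) \<inter> \<Omega>" "s \<in> ball s0 (r s0) \<inter> K" for s0 u s a b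
    using bd[OF that(1)] that(2,3) by (simp_all add: bd_def)
  obtain T where T: "finite T" "T \<subseteq> K" "K \<subseteq> (\<Union>s0\<in>T. ball s0 (r s0))"
    by (rule compactE_image[OF compact_K, of K "\<lambda>s0. ball s0 (r s0)"]) (use rC(1) in force)+
  define \<rho> where "\<rho> = Min (insert r0 (r ` T))"
  define B where "B = Max (insert 0 (C ` T))"
  have \<rho>: "\<rho> > 0" "\<rho> \<le> r0" "\<And>s0. s0 \<in> T \<Longrightarrow> \<rho> \<le> r s0"
    using T rC(1) r0(1) by (auto simp: \<rho>_def Min_gr_iff)
  have B: "B \<ge> 0" "\<And>s0. s0 \<in> T \<Longrightarrow> C s0 \<le> B"
    using T by (auto simp: B_def)
  show thesis
  proof (rule that[OF \<rho>(1) B(1)])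
    show sub: "ball u0 \<rho> \<subseteq> \<Omega>" using r0 \<rho>(2) by auto
    fix u s assume u: "u \<in> ball u0 \<rho>" and s: "s \<in> K"
    obtain s0 where s0: "s0 \<in> T" "s \<in> ball s0 (r s0)" using T s by auto
    have h: "s0 \<in> K" "u \<in> ball u0 (r s0) \<inter> \<Omega>" "s \<in> ball s0 (r s0) \<inter> K"
      using s0 T u s \<rho>(3)[OF s0(1)] sub by auto
    show "\<bar>partial1 f u s b\<bar> \<le> B * norm b" for b
      using bds(1)[OF h, of b] mult_right_mono[OF B(2)[OF s0(1)], of "norm b"] by simp
    show "\<bar>partial2 f u s a b\<bar> \<le> B * norm a * norm b" for a b
      using bds(2)[OF h, of a b] bds(2)[OF h, of b a] mult_right_mono[OF B(2)[OF s0(1)], of "norm a * norm b"]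
      by (simp add: mult.assoc)
  qed
qed

end

section \<open>Pairing continuous functions with essentially bounded ones\<close>

lemma measurable_sphere_continuous:
  fixes f :: "real^'n::finite \<Rightarrow> 'b::topological_space"
  assumes "continuous_on (sphere 0 1) f"
  shows "f \<in> borel_measurable sphere_measure"
  using borel_measurable_continuous_on_restrict[OF assms]
  by (simp add: measurable_cong_sets[OF sets_sphere_measure refl])

lemma continuous_sphere_bounded:
  fixes f :: "real^'n::finite \<Rightarrow> real"
  assumes "continuous_on (sphere 0 1) f"
  obtains B where "B \<ge> 0" "\<And>s. s \<in> sphere 0 1 \<Longrightarrow> \<bar>f s\<bar> \<le> B"
proof -
  have "bounded (f ` sphere 0 1)"
    using compact_continuous_image[OF assms compact_sphere] by (rule compact_imp_bounded)
  then obtain B where "\<And>s. s \<in> sphere 0 1 \<Longrightarrow> \<bar>f s\<bar> \<le> B"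
    unfolding bounded_iff by (metis imageI real_norm_def)
  then show thesis by (intro that[of "\<bar>B\<bar>"]) force+
qed

lemma AE_sphere: "AE s in sphere_measure. s \<in> sphere 0 1"
  by (rule AE_I2) (simp add: space_sphere_measure)

lemma integrable_continuous_sphere:
  fixes f :: "real^'n::finite \<Rightarrow> real"
  assumes "continuous_on (sphere 0 1) f"
  shows "integrable sphere_measure f"
proof -
  obtain B where "\<And>s. s \<in> sphere 0 1 \<Longrightarrow> \<bar>f s\<bar> \<le> B"
    using continuous_sphere_bounded[OF assms] by metis
  then show ?thesis
    by (intro sphere.integrable_const_bound[of _ B] measurable_sphere_continuous assms)
      (use AE_sphere in \<open>auto elim!: eventually_mono\<close>)
qed

text \<open>The first argument is an actual function, which may be differentiated pointwise; the second one is a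
  class, which varies in norm.\<close>

definition pairing :: "(real^'n::finite \<Rightarrow> real) \<Rightarrow> 'n linf \<Rightarrow> real" where
  "pairing f X = (\<integral>s. f s * linf_rep X s \<partial>sphere_measure)"

lemma integrable_pairing:
  assumes f: "continuous_on (sphere 0 1) f"
  shows "integrable sphere_measure (\<lambda>s. f s * linf_rep X s)"
proof -
  obtain B where B: "\<And>s. s \<in> sphere 0 1 \<Longrightarrow> \<bar>f s\<bar> \<le> B" "B \<ge> 0"
    using continuous_sphere_bounded[OF f] by metis
  note measurable_sphere_continuous[OF f, measurable]
  show ?thesis
  proof (rule sphere.integrable_const_bound[of _ "B * norm X"])
    show "AE s in sphere_measure. norm (f s * linf_rep X s) \<le> B * norm X"
      using AE_sphere linf_rep_bound[of X]
      by eventually_elim (use B in \<open>auto simp: abs_mult intro!: mult_mono\<close>)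
  qed measurable
qed

lemma pairing_bound:
  assumes f: "continuous_on (sphere 0 1) f" and B: "\<And>s. s \<in> sphere 0 1 \<Longrightarrow> \<bar>f s\<bar> \<le> B" 
  shows "\<bar>pairing f X\<bar> \<le> B * norm (X :: 'n::finite linf)"
proof -
  have "0 \<le> \<bar>f (axis undefined 1)\<bar>" "\<bar>f (axis undefined 1)\<bar> \<le> B"
    by (auto intro!: B simp: norm_axis_1)
  then have "0 \<le> B" by linarith
  have "\<bar>pairing f X\<bar> \<le> (\<integral>s. \<bar>f s * linf_rep X s\<bar> \<partial>sphere_measure)"
    unfolding pairing_def by (rule integral_abs_bound)
  also have "\<dots> \<le> (\<integral>s. B * norm X \<partial>(sphere_measure :: (real^'n) measure))"
  proof (rule integral_mono_AE)
    show "AE s in sphere_measure. \<bar>f s * linf_rep X s\<bar> \<le> B * norm X"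
      using AE_sphere linf_rep_bound[of X]
      by eventually_elim (use B \<open>0 \<le> B\<close> in \<open>auto simp: abs_mult intro!: mult_mono\<close>)
  qed (use integrable_pairing[OF f] in auto)
  finally show ?thesis by (simp add: sphere.prob_space)
qed

lemma bounded_linear_pairing:
  assumes f: "continuous_on (sphere 0 1) f"
  shows "bounded_linear (pairing f)"
proof -
  obtain B where B: "\<And>s. s \<in> sphere 0 1 \<Longrightarrow> \<bar>f s\<bar> \<le> B"
    using continuous_sphere_bounded[OF f] by metis
  note i = integrable_pairing[OF f] and [measurable] = measurable_sphere_continuous[OF f]
  show ?thesis
  proof (rule bounded_linear_intro[of _ B])
    fix X Y :: "'a linf" and r :: real
    have "pairing f (X + Y) = (\<integral>s. f s * linf_rep X s + f s * linf_rep Y s \<partial>sphere_measure)"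
      unfolding pairing_def
    proof (rule integral_cong_AE)
      show "AE s in sphere_measure. f s * linf_rep (X + Y) s = f s * linf_rep X s + f s * linf_rep Y s"
        using linf_rep_add[of X Y] by eventually_elim (simp add: distrib_left)
    qed measurable
    then show "pairing f (X + Y) = pairing f X + pairing f Y"
      by (simp add: pairing_def i)
    have "pairing f (r *\<^sub>R X) = (\<integral>s. r * (f s * linf_rep X s) \<partial>sphere_measure)"
      unfolding pairing_def
    proof (rule integral_cong_AE)
      show "AE s in sphere_measure. f s * linf_rep (r *\<^sub>R X) s = r * (f s * linf_rep X s)"
        using linf_rep_scaleR[of r X] by eventually_elim simp
    qed measurable
    then show "pairing f (r *\<^sub>R X) = r *\<^sub>R pairing f X"
      by (simp add: pairing_def)
    show "norm (pairing f X) \<le> norm X * B"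
      using pairing_bound[OF f B, of X] by (simp add: mult.commute)
  qed
qed

lemma pairing_add_left:
  assumes "continuous_on (sphere 0 1) f" "continuous_on (sphere 0 1) h"
  shows "pairing (\<lambda>s. f s + h s) X = pairing f X + pairing h X"
  unfolding pairing_def
  using integrable_pairing[OF assms(1), of X] integrable_pairing[OF assms(2), of X]
  by (simp add: distrib_right)

lemma pairing_diff_left:
  assumes "continuous_on (sphere 0 1) f" "continuous_on (sphere 0 1) h"
  shows "pairing (\<lambda>s. f s - h s) X = pairing f X - pairing h X"
  unfolding pairing_def
  using integrable_pairing[OF assms(1), of X] integrable_pairing[OF assms(2), of X]
  by (simp add: left_diff_distrib)

lemma pairing_cmult_left: "pairing (\<lambda>s. r * f s) X = r * pairing f X"
  unfolding pairing_def by (simp add: mult.assoc)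

lemma pairing_sum_left:
  assumes "\<And>i. i \<in> I \<Longrightarrow> continuous_on (sphere 0 1) (f i)"
  shows "pairing (\<lambda>s. \<Sum>i\<in>I. f i s) X = (\<Sum>i\<in>I. pairing (f i) X)"
  unfolding pairing_def using integrable_pairing[OF assms]
  by (simp add: sum_distrib_right)

lemma pairing_cong:
  assumes "\<And>s. s \<in> sphere 0 1 \<Longrightarrow> f s = h s"
  shows "pairing f X = pairing h X"
  unfolding pairing_def
  by (rule Bochner_Integration.integral_cong) (use assms in \<open>auto simp: space_sphere_measure\<close>)

lemma linf_class_continuous:
  fixes h :: "real^'n::finite \<Rightarrow> real"
  assumes "continuous_on (sphere 0 1) h"
  shows "AE s in sphere_measure. linf_rep (linf_class h) s = h s"
proof -
  obtain B where "\<And>s. s \<in> sphere 0 1 \<Longrightarrow> \<bar>h s\<bar> \<le> B"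
    using continuous_sphere_bounded[OF assms] by metis
  then show ?thesis
    by (intro linf_rep_class linf_classI[of _ B] measurable_sphere_continuous assms)
qed

lemma pairing_mult_class:
  fixes f h :: "real^'n::finite \<Rightarrow> real"
  assumes f: "continuous_on (sphere 0 1) f" and h: "continuous_on (sphere 0 1) h"
  shows "pairing f (linf_class h * X) = pairing (\<lambda>s. f s * h s) X"
  unfolding pairing_def
proof (rule integral_cong_AE)
  note [measurable] = measurable_sphere_continuous[OF f] measurable_sphere_continuous[OF h]
  show "(\<lambda>s. f s * linf_rep (linf_class h * X) s) \<in> borel_measurable sphere_measure"
    "(\<lambda>s. f s * h s * linf_rep X s) \<in> borel_measurable sphere_measure" by measurable
  show "AE s in sphere_measure. f s * linf_rep (linf_class h * X) s = f s * h s * linf_rep X s"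
    using linf_class_continuous[OF h] linf_rep_mult[of "linf_class h" X] by eventually_elim simp
qed

lemma linf_int_class:
  assumes "continuous_on (sphere 0 1) h"
  shows "linf_int (linf_class h * X) = pairing h X"
  unfolding linf_int_def pairing_def
proof (rule integral_cong_AE)
  note [measurable] = measurable_sphere_continuous[OF assms]
  show "(\<lambda>s. h s * linf_rep X s) \<in> borel_measurable sphere_measure" by measurable
  show "AE s in sphere_measure. linf_rep (linf_class h * X) s = h s * linf_rep X s"
    using linf_class_continuous[OF assms] linf_rep_mult[of "linf_class h" X] by eventually_elim simp
qed measurable

lemma has_vector_derivative_quotient:
  "(R has_vector_derivative R') (at (0::real)) \<longleftrightarrow> ((\<lambda>t. (R t - R 0) /\<^sub>R t) \<longlongrightarrow> R') (at 0)"
proof -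
  have "(R has_vector_derivative R') (at 0) \<longleftrightarrow>
      ((\<lambda>t. norm (R t - R 0 - t *\<^sub>R R') / norm t) \<longlongrightarrow> 0) (at 0)"
    by (simp add: has_vector_derivative_def has_derivative_at bounded_linear_scaleR_left)
  also have "\<dots> \<longleftrightarrow> ((\<lambda>t. norm ((R t - R 0) /\<^sub>R t - R')) \<longlongrightarrow> 0) (at 0)"
  proof (rule filterlim_cong[OF refl refl])
    show "\<forall>\<^sub>F t in at 0. norm (R t - R 0 - t *\<^sub>R R') / norm t = norm ((R t - R 0) /\<^sub>R t - R')"
      unfolding eventually_at
    proof (intro exI[of _ 1] conjI ballI impI)
      fix t :: real assume "t \<noteq> 0 \<and> dist t 0 < 1"
      then have "(R t - R 0) /\<^sub>R t - R' = (R t - R 0 - t *\<^sub>R R') /\<^sub>R t"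
        by (simp add: scaleR_diff_right)
      then show "norm (R t - R 0 - t *\<^sub>R R') / norm t = norm ((R t - R 0) /\<^sub>R t - R')"
        by (simp add: divide_inverse mult.commute)
    qed simp
  qed
  also have "\<dots> \<longleftrightarrow> ((\<lambda>t. (R t - R 0) /\<^sub>R t) \<longlongrightarrow> R') (at 0)"
    by (simp add: tendsto_norm_zero_iff Lim_null[symmetric])
  finally show ?thesis .
qed

text \<open>Differentiation under the integral sign.  Pointwise differentiability together with a uniform
  Lipschitz bound suffices for the first factor, by dominated convergence.\<close>

lemma has_derivative_pairing:
  fixes f :: "real \<Rightarrow> real^'n::finite \<Rightarrow> real" and R :: "real \<Rightarrow> 'n linf"
  assumes "0 < d"
    and f: "\<And>t. \<bar>t\<bar> < d \<Longrightarrow> continuous_on (sphere 0 1) (f t)"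
    and f': "continuous_on (sphere 0 1) f'"
    and lip: "\<And>t s. \<bar>t\<bar> < d \<Longrightarrow> s \<in> sphere 0 1 \<Longrightarrow> \<bar>f t s - f 0 s\<bar> \<le> C * \<bar>t\<bar>"
    and der: "\<And>s. s \<in> sphere 0 1 \<Longrightarrow> ((\<lambda>t. f t s) has_real_derivative f' s) (at 0)"
    and R: "(R has_vector_derivative R') (at 0)"
  shows "((\<lambda>t. pairing (f t) (R t)) has_real_derivative pairing f' (R 0) + pairing (f 0) R') (at 0)"
  unfolding has_field_derivative_iff LIMSEQ_SEQ_conv[symmetric]
proof (intro allI impI, elim conjE)
  fix T :: "nat \<Rightarrow> real" assume T0: "\<forall>n. T n \<noteq> 0" and T: "T \<longlonglongrightarrow> 0"
  have c0: "continuous_on (sphere 0 1) (f 0)" using f[of 0] \<open>0 < d\<close> by simp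
  interpret p0: bounded_linear "pairing (f 0)" by (rule bounded_linear_pairing[OF c0])
  interpret p': bounded_linear "pairing f'" by (rule bounded_linear_pairing[OF f'])
  have Td: "\<forall>\<^sub>F n in sequentially. \<bar>T n\<bar> < d"
    using tendstoD[OF T \<open>0 < d\<close>] by (simp add: dist_real_def)
  then obtain N where N: "\<And>n. \<bar>T (n + N)\<bar> < d"
    unfolding eventually_sequentially by (metis le_add2)
  have Tat: "filterlim T (at 0) sequentially"
    using T T0 by (simp add: filterlim_at)
  have Rq: "(\<lambda>n. (R (T n) - R 0) /\<^sub>R T n) \<longlonglongrightarrow> R'"
    by (rule filterlim_compose[OF has_vector_derivative_quotient[THEN iffD1, OF R] Tat])
  have RT: "(\<lambda>n. R (T n)) \<longlonglongrightarrow> R 0"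
    using has_vector_derivative_continuous[OF R] T
    by (auto simp: continuous_at intro: isCont_tendsto_compose)
  define h where "h n s = (f (T n) s - f 0 s) / T n" for n s
  have hc: "continuous_on (sphere 0 1) (h n)" if "\<bar>T n\<bar> < d" for n
    unfolding h_def using f[OF that] c0 T0 by (intro continuous_intros) auto
  have hb: "\<bar>h n s\<bar> \<le> C" if "\<bar>T n\<bar> < d" "s \<in> sphere 0 1" for n s
    using lip[OF that] T0 by (simp add: h_def pos_divide_le_eq)
  have "(\<lambda>n. pairing (h (n + N)) (R 0)) \<longlonglongrightarrow> pairing f' (R 0)"
    unfolding pairing_def
  proof (rule integral_dominated_convergence[where w = "\<lambda>_. C * norm (R 0)"])
    note [measurable] = measurable_sphere_continuous[OF f'] measurable_sphere_continuous[OF hc[OF N]]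
    show "(\<lambda>s. f' s * linf_rep (R 0) s) \<in> borel_measurable sphere_measure" by measurable
    show "(\<lambda>s. h (n + N) s * linf_rep (R 0) s) \<in> borel_measurable sphere_measure" for n by measurable
    show "AE s in sphere_measure. (\<lambda>n. h (n + N) s * linf_rep (R 0) s) \<longlonglongrightarrow> f' s * linf_rep (R 0) s"
      using AE_sphere
    proof eventually_elim
      case (elim s)
      have "((\<lambda>t. (f t s - f 0 s) / t) \<longlongrightarrow> f' s) (at 0)"
        using der[OF elim] by (simp add: has_field_derivative_iff)
      then have "(\<lambda>n. h n s) \<longlonglongrightarrow> f' s"
        unfolding h_def using filterlim_compose Tat by blast
      then show ?case by (intro tendsto_intros LIMSEQ_ignore_initial_segment)
    qed
    show "AE s in sphere_measure. norm (h (n + N) s * linf_rep (R 0) s) \<le> C * norm (R 0)" for n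
      using AE_sphere linf_rep_bound[of "R 0"]
    proof eventually_elim
      case (elim s)
      have "\<bar>h (n + N) s\<bar> \<le> C" using hb[OF N elim(1)] .
      then show ?case using elim by (auto simp: abs_mult intro!: mult_mono)
    qed
  qed simp
  then have l1: "(\<lambda>n. pairing (h n) (R 0)) \<longlonglongrightarrow> pairing f' (R 0)"
    by (rule LIMSEQ_offset)
  have l2: "(\<lambda>n. pairing (h n) (R (T n) - R 0)) \<longlonglongrightarrow> 0"
  proof (rule Lim_null_comparison)
    show "\<forall>\<^sub>F n in sequentially. norm (pairing (h n) (R (T n) - R 0)) \<le> C * norm (R (T n) - R 0)"
      using Td
    proof eventually_elim
      case (elim n)
      show ?case using pairing_bound[OF hc[OF elim] hb[OF elim]] by simp
    qed
    have "(\<lambda>n. C * norm (R (T n) - R 0)) \<longlonglongrightarrow> C * norm (R 0 - R 0)"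
      by (intro tendsto_intros RT)
    then show "(\<lambda>n. C * norm (R (T n) - R 0)) \<longlonglongrightarrow> 0" by simp
  qed
  have l3: "(\<lambda>n. pairing (f 0) ((R (T n) - R 0) /\<^sub>R T n)) \<longlonglongrightarrow> pairing (f 0) R'"
    by (rule p0.tendsto[OF Rq])
  have "(\<lambda>n. pairing (h n) (R 0) + pairing (h n) (R (T n) - R 0) + pairing (f 0) ((R (T n) - R 0) /\<^sub>R T n))
      \<longlonglongrightarrow> pairing f' (R 0) + 0 + pairing (f 0) R'"
    by (intro tendsto_add l1 l2 l3)
  moreover have "\<forall>\<^sub>F n in sequentially.
      pairing (h n) (R 0) + pairing (h n) (R (T n) - R 0) + pairing (f 0) ((R (T n) - R 0) /\<^sub>R T n)
      = (pairing (f (T n)) (R (T n)) - pairing (f 0) (R 0)) / (T n - 0)"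
    using Td
  proof eventually_elim
    case (elim n)
    interpret ph: bounded_linear "pairing (h n)" by (rule bounded_linear_pairing[OF hc[OF elim]])
    have ft: "pairing (f (T n)) X = pairing (f 0) X + T n * pairing (h n) X" for X
      using pairing_add_left[OF c0 continuous_on_mult[OF continuous_on_const hc[OF elim]], of "T n" X]
        T0 pairing_cmult_left[of "T n" "h n" X]
      by (simp add: h_def mult.commute)
    show ?case
      using T0[rule_format, of n]
      by (simp add: ft ph.diff p0.diff p0.scaleR field_simps)
  qed
  ultimately have "(\<lambda>n. (pairing (f (T n)) (R (T n)) - pairing (f 0) (R 0)) / (T n - 0))
      \<longlonglongrightarrow> pairing f' (R 0) + 0 + pairing (f 0) R'"
    by (rule Lim_transform_eventually)
  then show "(\<lambda>n. (pairing (f (T n)) (R (T n)) - pairing (f 0) (R 0)) / (T n - 0))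
      \<longlonglongrightarrow> pairing f' (R 0) + pairing (f 0) R'" by simp
qed

text \<open>By the mean value inequality a bound on the derivative gives the Lipschitz bound.\<close>

lemma has_derivative_pairing_bounded:
  fixes f :: "real \<Rightarrow> real^'n::finite \<Rightarrow> real" and R :: "real \<Rightarrow> 'n linf"
  assumes "0 < d"
    and f: "\<And>t. \<bar>t\<bar> < d \<Longrightarrow> continuous_on (sphere 0 1) (f t)"
    and f': "continuous_on (sphere 0 1) (f' 0)"
    and der: "\<And>t s. \<bar>t\<bar> < d \<Longrightarrow> s \<in> sphere 0 1 \<Longrightarrow> ((\<lambda>t. f t s) has_real_derivative f' t s) (at t)"
    and bd: "\<And>t s. \<bar>t\<bar> < d \<Longrightarrow> s \<in> sphere 0 1 \<Longrightarrow> \<bar>f' t s\<bar> \<le> C"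
    and R: "(R has_vector_derivative R') (at 0)"
  shows "((\<lambda>t. pairing (f t) (R t)) has_real_derivative pairing (f' 0) (R 0) + pairing (f 0) R') (at 0)"
proof (rule has_derivative_pairing[OF \<open>0 < d\<close> f f' _ _ R])
  fix t s :: "_" assume t: "\<bar>t\<bar> < d" and s: "s \<in> sphere (0::real^'n) 1"
  have "norm (f t s - f 0 s) \<le> C * norm (t - 0)"
  proof (rule field_differentiable_bound[of "ball 0 d" "\<lambda>t. f t s" "\<lambda>t. f' t s"])
    show "((\<lambda>t. f t s) has_field_derivative f' z s) (at z within ball 0 d)" if "z \<in> ball 0 d" for z
      using der[of z s] that s by (auto intro: has_field_derivative_at_within)
    show "norm (f' z s) \<le> C" if "z \<in> ball 0 d" for z
      using bd[of z s] that s by auto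
  qed (use t \<open>0 < d\<close> in auto)
  then show "\<bar>f t s - f 0 s\<bar> \<le> C * \<bar>t\<bar>" by simp
qed (use der \<open>0 < d\<close> in auto)

section \<open>Moments of the rotation invariant measure\<close>

lemma sphere_integral_orthogonal:
  fixes T :: "real^'n::{finite,wellorder} \<Rightarrow> real^'n::_" and f :: "real^'n::_ \<Rightarrow> real"
  assumes T: "orthogonal_transformation T" and f: "continuous_on (sphere 0 1) f"
  shows "(\<integral>s. f (T s) \<partial>sphere_measure) = (\<integral>s. f s \<partial>sphere_measure)"
proof -
  have "T \<in> borel_measurable borel"
    using T by (intro borel_measurable_continuous_onI linear_continuous_on
        linear_conv_bounded_linear[THEN iffD1]) (auto simp: orthogonal_transformation)
  then have "T \<in> measurable sphere_measure sphere_measure"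
    using T by (subst measurable_cong_sets[OF sets_sphere_measure sets_sphere_measure])
      (auto intro!: measurable_restrict_space3 simp: orthogonal_transformation)
  from integral_distr[OF this measurable_sphere_continuous[OF f]] show ?thesis
    by (simp add: sphere_measure_orthogonal[OF T])
qed

lemma continuous_ridge [continuous_intros]:
  "continuous_on S (\<lambda>s. h (a \<bullet> s))" if "continuous_on UNIV (h :: real \<Rightarrow> real)"
  by (rule continuous_on_compose2[OF that]) (auto intro!: continuous_intros)

text \<open>An orthogonal map takes \<open>a\<close> to \<open>b\<close>.\<close>

lemma sphere_integral_ridge_norm:
  fixes a b :: "real^'n::{finite,wellorder}" and h :: "real \<Rightarrow> real"
  assumes "norm a = norm b" "continuous_on UNIV h"
  shows "(\<integral>s. h (a \<bullet> s) \<partial>sphere_measure) = (\<integral>s. h (b \<bullet> s) \<partial>sphere_measure)"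
proof -
  obtain T where T: "orthogonal_transformation T" "T a = b"
    using orthogonal_transformation_exists[OF assms(1)] by metis
  have "(\<integral>s. h (b \<bullet> s) \<partial>sphere_measure) = (\<integral>s. h (b \<bullet> T s) \<partial>sphere_measure)"
    by (rule sphere_integral_orthogonal[OF T(1), symmetric]) (intro continuous_intros assms)
  moreover have "b \<bullet> T s = a \<bullet> s" for s
    using T by (metis orthogonal_transformation_def)
  ultimately show ?thesis by simp
qed

text \<open>The reflection in the hyperplane orthogonal to \<open>b\<close> fixes \<open>a\<close> and reverses the sign of the integrand.\<close>

lemma sphere_integral_ridge_odd:
  fixes a b :: "real^'n::{finite,wellorder}" and h :: "real \<Rightarrow> real"
  assumes ab: "a \<bullet> b = 0" and h: "continuous_on UNIV h"
  shows "(\<integral>s. h (a \<bullet> s) * (b \<bullet> s) \<partial>sphere_measure) = 0"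
proof (cases "b = 0")
  case False
  define T where "T x = x - (2 * (b \<bullet> x) / (b \<bullet> b)) *\<^sub>R b" for x
  have "linear T"
    by (auto simp: T_def linear_iff inner_add_right algebra_simps add_divide_distrib)
  moreover have "T v \<bullet> T w = v \<bullet> w" for v w
    using False by (simp add: T_def inner_diff_left inner_diff_right inner_commute[of v b])
  ultimately have T: "orthogonal_transformation T"
    by (simp add: orthogonal_transformation_def)
  have Tb: "b \<bullet> T s = - (b \<bullet> s)" and Ta: "a \<bullet> T s = a \<bullet> s" for s
    using False ab by (simp_all add: T_def inner_diff_right)
  have "(\<integral>s. h (a \<bullet> s) * (b \<bullet> s) \<partial>sphere_measure) = (\<integral>s. h (a \<bullet> T s) * (b \<bullet> T s) \<partial>sphere_measure)"
    by (rule sphere_integral_orthogonal[OF T, symmetric]) (intro continuous_intros h)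
  then show ?thesis by (simp add: Ta Tb)
qed simp

text \<open>The form is a multiple of the scalar product by the two preceding symmetries, and its trace is the
  integral of \<open>\<bar>s\<bar>\<^sup>2 = 1\<close>.\<close>

lemma sphere_second_moment:
  fixes b c :: "real^'n::{finite,wellorder}"
  shows "(\<integral>s. (b \<bullet> s) * (c \<bullet> s) \<partial>sphere_measure) = (b \<bullet> c) / real CARD('n)"
proof (cases "b = 0")
  case False
  define m where "m = (\<integral>s. (axis undefined 1 \<bullet> s)\<^sup>2 \<partial>(sphere_measure :: (real^'n::_) measure))"
  have sq: "(\<integral>s. (a \<bullet> s)\<^sup>2 \<partial>sphere_measure) = (a \<bullet> a) * m" for a :: "real^'n::_"
  proof -
    have "(\<integral>s. (a \<bullet> s)\<^sup>2 \<partial>sphere_measure) = (\<integral>s. ((norm a *\<^sub>R axis undefined 1) \<bullet> s)\<^sup>2 \<partial>(sphere_measure :: (real^'n::_) measure))"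
      by (rule sphere_integral_ridge_norm) (auto simp: norm_axis_1 intro!: continuous_intros)
    then show ?thesis by (simp add: m_def power_mult_distrib dot_square_norm)
  qed
  have "real CARD('n) * m = (\<Sum>i\<in>UNIV. (\<integral>s. (axis i 1 \<bullet> s)\<^sup>2 \<partial>(sphere_measure :: (real^'n::_) measure)))"
    by (simp add: sq inner_axis_axis)
  also have "\<dots> = (\<integral>s. (\<Sum>i\<in>UNIV. (axis i 1 \<bullet> s)\<^sup>2) \<partial>(sphere_measure :: (real^'n::_) measure))"
    by (rule Bochner_Integration.integral_sum[symmetric])
      (intro integrable_continuous_sphere continuous_intros)
  also have "\<dots> = (\<integral>s. 1 \<partial>(sphere_measure :: (real^'n::_) measure))"
  proof (rule Bochner_Integration.integral_cong)
    fix s :: "real^'n::_" assume "s \<in> space sphere_measure"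
    then have "s \<bullet> s = 1" by (simp add: space_sphere_measure dot_square_norm)
    moreover have "axis i 1 \<bullet> s = s $ i" for i
      by (simp add: inner_commute[of _ s] cart_eq_inner_axis)
    ultimately show "(\<Sum>i\<in>UNIV. (axis i 1 \<bullet> s)\<^sup>2) = 1"
      by (simp add: inner_vec_def[of s s] power2_eq_square)
  qed simp
  finally have m: "real CARD('n) * m = 1" by (simp add: sphere.prob_space)
  define t where "t = (b \<bullet> c) / (b \<bullet> b)"
  have "b \<bullet> (c - t *\<^sub>R b) = 0" using False by (simp add: t_def inner_diff_right)
  from sphere_integral_ridge_odd[OF this, of "\<lambda>x. x"]
  have odd: "(\<integral>s. (b \<bullet> s) * ((c - t *\<^sub>R b) \<bullet> s) \<partial>sphere_measure) = 0" by simp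
  have "(\<integral>s. (b \<bullet> s) * (c \<bullet> s) \<partial>sphere_measure) =
      (\<integral>s. t * (b \<bullet> s)\<^sup>2 + (b \<bullet> s) * ((c - t *\<^sub>R b) \<bullet> s) \<partial>sphere_measure)"
    by (simp add: inner_diff_left algebra_simps power2_eq_square)
  also have "\<dots> = t * (\<integral>s. (b \<bullet> s)\<^sup>2 \<partial>sphere_measure) + 0"
    unfolding odd[symmetric]
    by (subst Bochner_Integration.integral_add) (auto intro!: integrable_continuous_sphere continuous_intros)
  also have "\<dots> = (b \<bullet> c) * m" using False by (simp add: sq t_def)
  finally show ?thesis using m by (simp add: field_simps)
qed simp

text \<open>The Laplace transform of the measure is a function of the length only; its gradient at \<open>a\<close> is
  therefore \<open>\<kappa> (a \<bullet> a) a\<close>, and its Hessian follows by differentiating once more.\<close>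

lemma sphere_exponential_moments:
  obtains \<kappa> \<kappa>' :: "real \<Rightarrow> real" where
    "\<And>a b :: real^'n::{finite,wellorder}. a \<noteq> 0 \<Longrightarrow>
       (\<integral>s. exp (a \<bullet> s) * (b \<bullet> s) \<partial>sphere_measure) = \<kappa> (a \<bullet> a) * (a \<bullet> b)"
    "\<And>a b c :: real^'n::_. a \<noteq> 0 \<Longrightarrow>
       (\<integral>s. exp (a \<bullet> s) * (b \<bullet> s) * (c \<bullet> s) \<partial>sphere_measure) =
         \<kappa> (a \<bullet> a) * (b \<bullet> c) + 2 * \<kappa>' (a \<bullet> a) * (a \<bullet> b) * (a \<bullet> c)"
    "\<And>r. 0 < r \<Longrightarrow> (\<kappa> has_real_derivative \<kappa>' r) (at r)"
proof -
  define one :: "'n linf" where "one = linf_class (\<lambda>_. 1)"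
  have one: "pairing f one = (\<integral>s. f s \<partial>sphere_measure)" if "continuous_on (sphere 0 1) f" for f
  proof -
    note [measurable] = measurable_sphere_continuous[OF that]
    have "AE s in sphere_measure. linf_rep one s = 1"
      unfolding one_def by (rule linf_rep_class[OF linf_classI[of _ 1]]) auto
    then show ?thesis unfolding pairing_def
      by (intro integral_cong_AE) (auto elim!: eventually_mono)
  qed
  have inner_le: "\<bar>a \<bullet> s\<bar> \<le> norm a" if "s \<in> sphere 0 1" for a s :: "real^'n::_"
    using Cauchy_Schwarz_ineq2[of a s] that by simp
  have deriv: "((\<lambda>t. (\<integral>s. exp ((a + t *\<^sub>R c) \<bullet> s) * (b \<bullet> s) \<partial>sphere_measure)) has_real_derivative
      (\<integral>s. exp (a \<bullet> s) * (b \<bullet> s) * (c \<bullet> s) \<partial>sphere_measure)) (at 0)" for a b c :: "real^'n::_"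
  proof -
    define f where "f t s = exp ((a + t *\<^sub>R c) \<bullet> s) * (b \<bullet> s)" for t s
    define f' where "f' t s = exp ((a + t *\<^sub>R c) \<bullet> s) * (b \<bullet> s) * (c \<bullet> s)" for t s
    have cont: "continuous_on (sphere 0 1) (f t)" "continuous_on (sphere 0 1) (f' t)" for t
      unfolding f_def f'_def by (intro continuous_intros)+
    have "((\<lambda>t. pairing (f t) one) has_real_derivative pairing (f' 0) one + pairing (f 0) 0) (at 0)"
    proof (rule has_derivative_pairing_bounded[of 1 f f' "exp (norm a + norm c) * norm b * norm c" "\<lambda>_. one"])
      fix t :: real and s :: "real^'n::_" assume t: "\<bar>t\<bar> < 1" and s: "s \<in> sphere 0 1"
      show "((\<lambda>t. f t s) has_real_derivative f' t s) (at t)"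
        unfolding f_def f'_def by (auto intro!: derivative_eq_intros simp: inner_add_left)
      have "\<bar>t\<bar> * norm c \<le> 1 * norm c" using t by (intro mult_right_mono) auto
      then have "norm (a + t *\<^sub>R c) \<le> norm a + norm c"
        using norm_triangle_ineq[of a "t *\<^sub>R c"] by simp
      with inner_le[OF s, of "a + t *\<^sub>R c"] have "(a + t *\<^sub>R c) \<bullet> s \<le> norm a + norm c" by linarith
      then show "\<bar>f' t s\<bar> \<le> exp (norm a + norm c) * norm b * norm c"
        unfolding f'_def abs_mult by (intro mult_mono inner_le s) auto
    qed (use cont in auto)
    moreover have "pairing (f 0) 0 = 0"
      by (rule linear_0[OF bounded_linear.linear[OF bounded_linear_pairing[OF cont(1)]]])
    ultimately show ?thesis
      unfolding one[OF cont(1)] one[OF cont(2)] by (simp add: f_def[abs_def] f'_def[abs_def])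
  qed
  define e :: "real^'n::_" where "e = axis undefined 1"
  have e: "norm e = 1" "e \<bullet> e = 1" by (simp_all add: e_def norm_axis_1 inner_axis_axis)
  define N where "N t = (\<integral>s. exp ((t *\<^sub>R e) \<bullet> s) * (e \<bullet> s) \<partial>sphere_measure)" for t
  define N' where "N' t = (\<integral>s. exp ((t *\<^sub>R e) \<bullet> s) * (e \<bullet> s) * (e \<bullet> s) \<partial>sphere_measure)" for t
  have N': "(N has_real_derivative N' t) (at t)" for t
  proof -
    have "((\<lambda>h. N (t + h)) has_real_derivative N' t) (at 0)"
      using deriv[of "t *\<^sub>R e" e e] by (simp add: N_def N'_def scaleR_add_left)
    then show ?thesis by (simp add: DERIV_def)
  qed
  define \<kappa> where "\<kappa> r = N (sqrt r) / sqrt r" for r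
  define \<kappa>' where "\<kappa>' r = (N' (sqrt r) * (inverse (sqrt r) / 2) * sqrt r - N (sqrt r) * (inverse (sqrt r) / 2)) / (sqrt r * sqrt r)" for r
  have \<kappa>': "(\<kappa> has_real_derivative \<kappa>' r) (at r)" if "0 < r" for r
    unfolding \<kappa>_def \<kappa>'_def using that
    by (intro DERIV_divide DERIV_chain2[OF N'] DERIV_real_sqrt) auto
  have \<kappa>: "(\<integral>s. exp (a \<bullet> s) * (b \<bullet> s) \<partial>sphere_measure) = \<kappa> (a \<bullet> a) * (a \<bullet> b)"
    if "a \<noteq> 0" for a b :: "real^'n::_"
  proof -
    define t where "t = (a \<bullet> b) / (a \<bullet> a)"
    have pos: "0 < a \<bullet> a" using that by simp
    have "a \<bullet> (b - t *\<^sub>R a) = 0" using that by (simp add: t_def inner_diff_right)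
    from sphere_integral_ridge_odd[OF this, of exp]
    have odd: "(\<integral>s. exp (a \<bullet> s) * ((b - t *\<^sub>R a) \<bullet> s) \<partial>sphere_measure) = 0"
      by (simp add: continuous_on_exp[OF continuous_on_id])
    have "(\<integral>s. exp (a \<bullet> s) * (b \<bullet> s) \<partial>sphere_measure) =
        (\<integral>s. t * (exp (a \<bullet> s) * (a \<bullet> s)) + exp (a \<bullet> s) * ((b - t *\<^sub>R a) \<bullet> s) \<partial>sphere_measure)"
      by (simp add: inner_diff_left algebra_simps)
    also have "\<dots> = t * (\<integral>s. exp (a \<bullet> s) * (a \<bullet> s) \<partial>sphere_measure) + 0"
      unfolding odd[symmetric]
      by (subst Bochner_Integration.integral_add) (auto intro!: integrable_continuous_sphere continuous_intros)
    also have "(\<integral>s. exp (a \<bullet> s) * (a \<bullet> s) \<partial>sphere_measure) =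
        (\<integral>s. exp ((norm a *\<^sub>R e) \<bullet> s) * ((norm a *\<^sub>R e) \<bullet> s) \<partial>sphere_measure)"
      by (rule sphere_integral_ridge_norm[of _ _ "\<lambda>x. exp x * x"]) (auto simp: e intro!: continuous_intros)
    also have "\<dots> = sqrt (a \<bullet> a) * N (sqrt (a \<bullet> a))"
      by (simp add: N_def norm_eq_sqrt_inner mult.left_commute[of "exp _"])
    also have "t * (sqrt (a \<bullet> a) * N (sqrt (a \<bullet> a))) + 0 = \<kappa> (a \<bullet> a) * (a \<bullet> b)"
    proof -
      have "p / r * (x * y) + 0 = y / x * p" if "0 < x" "r = x * x" for x r p y :: real
        using that by (simp add: field_simps)
      then show ?thesis unfolding t_def \<kappa>_def by (rule; use pos in simp)
    qed
    finally show ?thesis .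
  qed
  have "(\<integral>s. exp (a \<bullet> s) * (b \<bullet> s) * (c \<bullet> s) \<partial>sphere_measure) =
         \<kappa> (a \<bullet> a) * (b \<bullet> c) + 2 * \<kappa>' (a \<bullet> a) * (a \<bullet> b) * (a \<bullet> c)" if "a \<noteq> 0" for a b c :: "real^'n::_"
  proof -
    have pos: "0 < a \<bullet> a" using that by simp
    have "((\<lambda>t. \<kappa> ((a + t *\<^sub>R c) \<bullet> (a + t *\<^sub>R c)) * ((a + t *\<^sub>R c) \<bullet> b)) has_real_derivative
        (\<kappa>' (a \<bullet> a) * (2 * (a \<bullet> c))) * (a \<bullet> b) + \<kappa> (a \<bullet> a) * (c \<bullet> b)) (at 0)"
      using \<kappa>'[OF pos] by (auto intro!: derivative_eq_intros DERIV_chain2[of \<kappa>] simp: inner_commute algebra_simps)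
    moreover have "\<forall>\<^sub>F t in nhds 0. a + t *\<^sub>R c \<noteq> 0"
    proof -
      have "((\<lambda>t. a + t *\<^sub>R c) \<longlongrightarrow> a + 0 *\<^sub>R c) (nhds 0)" by (intro tendsto_intros) (simp add: filterlim_ident)
      then show ?thesis using that by (intro tendsto_imp_eventually_ne) auto
    qed
    then have "\<forall>\<^sub>F t in nhds 0. (\<integral>s. exp ((a + t *\<^sub>R c) \<bullet> s) * (b \<bullet> s) \<partial>sphere_measure) =
       \<kappa> ((a + t *\<^sub>R c) \<bullet> (a + t *\<^sub>R c)) * ((a + t *\<^sub>R c) \<bullet> b)"
      by eventually_elim (rule \<kappa>)
    ultimately have "((\<lambda>t. (\<integral>s. exp ((a + t *\<^sub>R c) \<bullet> s) * (b \<bullet> s) \<partial>sphere_measure)) has_real_derivative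
        (\<kappa>' (a \<bullet> a) * (2 * (a \<bullet> c))) * (a \<bullet> b) + \<kappa> (a \<bullet> a) * (c \<bullet> b)) (at 0)"
      by (subst DERIV_cong_ev[OF refl _ refl])
    from DERIV_unique[OF deriv this] show ?thesis by (simp add: inner_commute algebra_simps)
  qed
  note hessian = this
  show thesis by (rule that[OF \<kappa> hessian \<kappa>'])
qed

section \<open>Exponentials separate essentially bounded functions\<close>

text \<open>Closed sets have indicators that are limits of continuous functions, and they generate the
  Borel sets.\<close>

lemma linf_zero_if_orthogonal_to_continuous:
  fixes X :: "'n::finite linf"
  assumes X: "\<And>f. continuous_on UNIV f \<Longrightarrow> pairing f X = 0"
  shows "X = 0"
proof -
  let ?\<sigma> = "sphere_measure :: (real^'n) measure"
  let ?I = "\<lambda>B. (\<integral>s. indicator B s * linf_rep X s \<partial>?\<sigma>)"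
  have sp: "sphere 0 1 \<in> sets (borel :: (real^'n) measure)" by simp
  have ss: "sets ?\<sigma> = sets (restrict_space borel (sphere 0 1))" by (rule sets_sphere_measure)
  have meas: "(\<lambda>s. indicator B s :: real) \<in> borel_measurable ?\<sigma>" if "B \<in> sets borel" for B
    unfolding measurable_cong_sets[OF ss refl]
    by (rule measurable_restrict_space1) (use that in measurable)
  have int: "integrable ?\<sigma> (\<lambda>s. indicator B s * linf_rep X s)" if "B \<in> sets borel" for B
  proof (rule sphere.integrable_const_bound[of _ "norm X"])
    show "AE s in ?\<sigma>. norm (indicator B s * linf_rep X s) \<le> norm X"
      using linf_rep_bound[of X] by eventually_elim (auto simp: indicator_def)
  qed (use meas[OF that] in measurable)
  have closed: "?I F = 0" if "closed F" for F
  proof (cases "F = {}")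
    case False
    define h where "h m s = max 0 (1 - real m * infdist s F)" for m and s :: "real^'n"
    have hc: "continuous_on S (h m)" for m S
      unfolding h_def by (intro continuous_intros)
    have "(\<lambda>m. pairing (h m) X) \<longlonglongrightarrow> ?I F"
      unfolding pairing_def
    proof (rule integral_dominated_convergence[where w = "\<lambda>_. norm X"])
      show "(\<lambda>s. indicator F s * linf_rep X s) \<in> borel_measurable ?\<sigma>"
        using int[of F] that by auto
      show "(\<lambda>s. h m s * linf_rep X s) \<in> borel_measurable ?\<sigma>" for m
        using integrable_pairing[OF hc] by auto
      show "AE s in ?\<sigma>. norm (h m s * linf_rep X s) \<le> norm X" for m
        using linf_rep_bound[of X]
      proof eventually_elim
        case (elim s)
        have "\<bar>h m s\<bar> \<le> 1" by (auto simp: h_def infdist_nonneg)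
        then show ?case using elim mult_mono[of "\<bar>h m s\<bar>" 1 "\<bar>linf_rep X s\<bar>" "norm X"]
          by (simp add: abs_mult)
      qed
      show "AE s in ?\<sigma>. (\<lambda>m. h m s * linf_rep X s) \<longlonglongrightarrow> indicator F s * linf_rep X s"
      proof (rule AE_I2, rule tendsto_mult_right)
        fix s :: "real^'n"
        show "(\<lambda>m. h m s) \<longlonglongrightarrow> indicator F s"
        proof (cases "s \<in> F")
          case True
          then show ?thesis by (simp add: h_def)
        next
          case nF: False
          then have pos: "0 < infdist s F"
            using in_closed_iff_infdist_zero[OF that False, of s] infdist_nonneg[of s F] by linarith
          obtain N :: nat where N: "1 < real N * infdist s F"
            using reals_Archimedean3[OF pos] by blast
          have "\<forall>\<^sub>F m in sequentially. h m s = 0"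
            unfolding eventually_sequentially
          proof (intro exI[of _ N] allI impI)
            fix m assume "N \<le> m"
            then have "real N * infdist s F \<le> real m * infdist s F"
              using pos by (intro mult_right_mono) auto
            then show "h m s = 0" using N by (simp add: h_def)
          qed
          then show ?thesis using nF by (simp add: tendsto_eventually)
        qed
      qed
    qed simp
    moreover have "pairing (h m) X = 0" for m by (rule X[OF hc])
    ultimately show ?thesis using LIMSEQ_unique[OF _ tendsto_const] by fastforce
  qed simp
  have total: "?I UNIV = 0" using closed[OF closed_UNIV] .
  have borel: "B \<in> sigma_sets UNIV (Collect closed) \<longleftrightarrow> B \<in> sets (borel :: (real^'n) measure)" for B
    unfolding borel_eq_closed by simp
  have all: "?I B = 0" if "B \<in> sigma_sets UNIV (Collect closed)" for B
  proof -
    have gen: "Int_stable (Collect closed :: (real^'n) set set)" "Collect closed \<subseteq> Pow (UNIV :: (real^'n) set)"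
      by (auto intro!: Int_stableI)
    from gen that show ?thesis
    proof (induction rule: sigma_sets_induct_disjoint)
      case (basic A)
      then show ?case using closed by simp
    next
      case empty
      then show ?case by simp
    next
      case (compl A)
      then have "A \<in> sets borel" by (simp add: borel)
      have "?I (UNIV - A) = (\<integral>s. indicator UNIV s * linf_rep X s - indicator A s * linf_rep X s \<partial>?\<sigma>)"
        by (rule Bochner_Integration.integral_cong) (auto simp: indicator_def)
      also have "\<dots> = ?I UNIV - ?I A"
        by (rule Bochner_Integration.integral_diff) (use \<open>A \<in> sets borel\<close> int in auto)
      finally show ?case using total compl by simp
    next
      case (union A)
      have A: "A i \<in> sets borel" for i using union(2) by (auto simp: borel[symmetric])
      have "(\<lambda>n. (\<integral>s. indicator (\<Union>i<n. A i) s * linf_rep X s \<partial>?\<sigma>)) \<longlonglongrightarrow> ?I (\<Union>i. A i)"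
      proof (rule integral_dominated_convergence[where w = "\<lambda>_. norm X"])
        show "(\<lambda>s. indicator (\<Union>i. A i) s * linf_rep X s) \<in> borel_measurable ?\<sigma>"
          using int[of "\<Union>i. A i"] A by auto
        show "(\<lambda>s. indicator (\<Union>i<n. A i) s * linf_rep X s) \<in> borel_measurable ?\<sigma>" for n
          using int[of "\<Union>i<n. A i"] A by auto
        show "AE s in ?\<sigma>. norm (indicator (\<Union>i<n. A i) s * linf_rep X s) \<le> norm X" for n
          using linf_rep_bound[of X] by eventually_elim (auto simp: indicator_def)
        show "AE s in ?\<sigma>. (\<lambda>n. indicator (\<Union>i<n. A i) s * linf_rep X s)
            \<longlonglongrightarrow> indicator (\<Union>i. A i) s * linf_rep X s"
          by (intro AE_I2 tendsto_mult_right LIMSEQ_indicator_UN)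
      qed simp
      moreover have "(\<integral>s. indicator (\<Union>i<n. A i) s * linf_rep X s \<partial>?\<sigma>) = 0" for n
      proof (induction n)
        case (Suc n)
        have "(\<integral>s. indicator (\<Union>i<Suc n. A i) s * linf_rep X s \<partial>?\<sigma>) =
            (\<integral>s. indicator (A n) s * linf_rep X s + indicator (\<Union>i<n. A i) s * linf_rep X s \<partial>?\<sigma>)"
        proof (rule Bochner_Integration.integral_cong)
          fix s
          have "s \<in> A n \<Longrightarrow> s \<notin> (\<Union>i<n. A i)"
            using union(1) unfolding disjoint_family_on_def by (auto; metis IntI empty_iff less_irrefl UNIV_I)
          then show "indicator (\<Union>i<Suc n. A i) s * linf_rep X s =
              indicator (A n) s * linf_rep X s + indicator (\<Union>i<n. A i) s * linf_rep X s"
            by (auto simp: indicator_def lessThan_Suc)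
        qed simp
        also have "\<dots> = ?I (A n) + ?I (\<Union>i<n. A i)"
          by (rule Bochner_Integration.integral_add) (use A int in auto)
        finally show ?case using Suc union(3) by simp
      qed simp
      ultimately show ?case using LIMSEQ_unique[OF _ tendsto_const] by fastforce
    qed
  qed
  have "AE s in ?\<sigma>. linf_rep X s = 0"
  proof (rule sphere.density_zero)
    fix B assume "B \<in> sets ?\<sigma>"
    then have "B \<in> sets borel"
      unfolding ss using sp by (auto simp: sets_restrict_space)
    then show "set_lebesgue_integral ?\<sigma> B (linf_rep X) = 0"
      using all borel by (simp add: set_lebesgue_integral_def)
  qed simp
  moreover have "AE s in ?\<sigma>. linf_rep 0 s = 0"
    using linf_rep_scaleR[of 0 X] by simp
  ultimately show ?thesis
    by (intro linf_eqI) (auto elim!: eventually_elim2)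
qed

inductive_set exponential_sums :: "('s \<Rightarrow> 'a::real_vector \<Rightarrow> real) \<Rightarrow> ('s \<Rightarrow> real) set" for p where
  exponential: "(\<lambda>s. c * exp (p s a)) \<in> exponential_sums p"
| sum: "f \<in> exponential_sums p \<Longrightarrow> h \<in> exponential_sums p \<Longrightarrow> (\<lambda>s. f s + h s) \<in> exponential_sums p"

text \<open>Since \<open>exp (p s a) * exp (p s b) = exp (p s (a + b))\<close>, the exponentials span an algebra, to which
  the Stone-Weierstrass theorem applies.\<close>

lemma linf_zero_if_orthogonal_to_exponentials:
  fixes p :: "real^'n::finite \<Rightarrow> 'a::real_vector \<Rightarrow> real" and X :: "'n linf"
  assumes cont: "\<And>a. continuous_on (sphere 0 1) (\<lambda>s. p s a)"
    and lin: "\<And>s. s \<in> sphere 0 1 \<Longrightarrow> linear (p s)"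
    and sep: "\<And>s s'. s \<in> sphere 0 1 \<Longrightarrow> s' \<in> sphere 0 1 \<Longrightarrow> s \<noteq> s' \<Longrightarrow> \<exists>a. p s a \<noteq> p s' a"
    and X: "\<And>a. pairing (\<lambda>s. exp (p s a)) X = 0"
  shows "X = 0"
proof (rule linf_zero_if_orthogonal_to_continuous)
  fix f :: "real^'n \<Rightarrow> real" assume "continuous_on UNIV f"
  then have f: "continuous_on (sphere 0 1) f" by (rule continuous_on_subset) simp
  let ?R = "{f. \<exists>h\<in>exponential_sums p. \<forall>s\<in>sphere 0 1. f s = h s}"
  have exp_cont: "continuous_on (sphere 0 1) h" if "h \<in> exponential_sums p" for h
    using that by induction (intro continuous_intros cont)+
  have cmult: "\<exists>k\<in>exponential_sums p. \<forall>s\<in>sphere 0 1. c * exp (p s a) * h s = k s"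
    if "h \<in> exponential_sums p" for h c a
    using that
  proof induction
    case (exponential d b)
    show ?case
      by (rule bexI[OF _ exponential_sums.exponential[of "c * d" p "a + b"]])
        (auto simp: linear_add[OF lin] exp_add)
  next
    case (sum f h)
    then obtain k l where "k \<in> exponential_sums p" "\<forall>s\<in>sphere 0 1. c * exp (p s a) * f s = k s"
      "l \<in> exponential_sums p" "\<forall>s\<in>sphere 0 1. c * exp (p s a) * h s = l s" by blast
    then show ?case
      by (intro bexI[OF _ exponential_sums.sum[of k p l]]) (auto simp: distrib_left)
  qed
  have mult: "\<exists>l\<in>exponential_sums p. \<forall>s\<in>sphere 0 1. h s * k s = l s"
    if "h \<in> exponential_sums p" "k \<in> exponential_sums p" for h k
    using that(1)
  proof induction
    case (exponential c a)
    show ?case by (rule cmult[OF that(2)])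
  next
    case (sum f h)
    then obtain l m where "l \<in> exponential_sums p" "\<forall>s\<in>sphere 0 1. f s * k s = l s"
      "m \<in> exponential_sums p" "\<forall>s\<in>sphere 0 1. h s * k s = m s" by blast
    then show ?case
      by (intro bexI[OF _ exponential_sums.sum[of l p m]]) (auto simp: distrib_right)
  qed
  interpret function_ring_on ?R "sphere (0::real^'n) 1"
  proof
    show "continuous_on (sphere 0 1) f" if fR: "f \<in> ?R" for f
    proof -
      obtain h where h: "h \<in> exponential_sums p" "\<And>s. s \<in> sphere 0 1 \<Longrightarrow> f s = h s" using fR by blast
      show ?thesis by (rule continuous_on_eq[OF exp_cont[OF h(1)]]) (simp add: h(2))
    qed
    show "(\<lambda>x. f x + g x) \<in> ?R" if fg: "f \<in> ?R" "g \<in> ?R" for f g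
    proof -
      obtain h k where "h \<in> exponential_sums p" "\<forall>s\<in>sphere 0 1. f s = h s"
        "k \<in> exponential_sums p" "\<forall>s\<in>sphere 0 1. g s = k s" using fg by blast
      then show ?thesis by (auto intro!: bexI[OF _ exponential_sums.sum[of h p k]])
    qed
    show "(\<lambda>x. f x * g x) \<in> ?R" if fg: "f \<in> ?R" "g \<in> ?R" for f g
    proof -
      obtain h k where "h \<in> exponential_sums p" "\<forall>s\<in>sphere 0 1. f s = h s"
        "k \<in> exponential_sums p" "\<forall>s\<in>sphere 0 1. g s = k s" using fg by blast
      then show ?thesis using mult[of h k] by auto
    qed
    show "(\<lambda>_. c) \<in> ?R" for c
      by (auto intro!: bexI[OF _ exponential_sums.exponential[of c p 0]] simp: linear_0[OF lin])
    show "\<exists>f\<in>?R. f s \<noteq> f s'" if ss: "s \<in> sphere 0 1" "s' \<in> sphere 0 1" "s \<noteq> s'" for s s'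
    proof -
      obtain a where "p s a \<noteq> p s' a" using sep[OF ss] by blast
      moreover have "(\<lambda>s. 1 * exp (p s a)) \<in> ?R" 
        by (intro CollectI bexI[OF _ exponential_sums.exponential[of 1 p a]]) simp
      ultimately show ?thesis by (intro bexI[of _ "\<lambda>s. 1 * exp (p s a)"]) simp_all
    qed
  qed simp
  have zero: "pairing h X = 0" if "h \<in> exponential_sums p" for h
    using that
  proof induction
    case (exponential c a)
    then show ?case by (simp add: pairing_cmult_left X)
  next
    case (sum f h)
    then show ?case by (simp add: pairing_add_left exp_cont)
  qed
  have "\<bar>pairing f X\<bar> \<le> e * norm X" if "e > 0" for e
  proof -
    obtain g where g: "g \<in> ?R" "\<And>s. s \<in> sphere 0 1 \<Longrightarrow> \<bar>f s - g s\<bar> < e"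
      using Stone_Weierstrass_basic[OF f \<open>e > 0\<close>] by blast
    obtain h where h: "h \<in> exponential_sums p" "\<And>s. s \<in> sphere 0 1 \<Longrightarrow> g s = h s" using g(1) by blast
    have "pairing f X = pairing (\<lambda>s. f s - h s) X"
      using pairing_diff_left[OF f exp_cont[OF h(1)]] zero[OF h(1)] by simp
    also have "\<bar>\<dots>\<bar> \<le> e * norm X"
    proof (rule pairing_bound)
      show "\<bar>f s - h s\<bar> \<le> e" if "s \<in> sphere 0 1" for s using g(2)[OF that] h(2)[OF that] by simp
    qed (intro continuous_intros f exp_cont h(1))
    finally show ?thesis .
  qed
  note small = this
  show "pairing f X = 0"
  proof (rule ccontr)
    assume ne: "pairing f X \<noteq> 0"
    have m: "0 < 2 * (norm X + 1)" "norm X < 2 * (norm X + 1)"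
      by (smt (verit) norm_ge_zero)+
    have "\<bar>pairing f X\<bar> * norm X < \<bar>pairing f X\<bar> * (2 * (norm X + 1))"
      using ne m by (intro mult_strict_left_mono) auto
    then have "\<bar>pairing f X\<bar> / (2 * (norm X + 1)) * norm X < \<bar>pairing f X\<bar>"
      using m by (simp add: pos_divide_less_eq)
    moreover have "0 < \<bar>pairing f X\<bar> / (2 * (norm X + 1))" using ne m by simp
    ultimately show False using small by fastforce
  qed
qed

section \<open>Orthonormal frames of positive definite forms\<close>

locale positive_form =
  fixes B :: "real^'n::finite \<Rightarrow> real^'n \<Rightarrow> real"
  assumes bilinear_B: "bilinear B" and sym_B: "B a b = B b a" and pos_B: "a \<noteq> 0 \<Longrightarrow> 0 < B a a"
begin

lemmas B_simps = bilinear_ladd[OF bilinear_B] bilinear_radd[OF bilinear_B]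
  bilinear_lmul[OF bilinear_B] bilinear_rmul[OF bilinear_B]
  bilinear_lsub[OF bilinear_B] bilinear_rsub[OF bilinear_B]
  bilinear_lzero[OF bilinear_B] bilinear_rzero[OF bilinear_B]

lemma linear_B: "linear (B a)" "linear (\<lambda>a. B a b)"
  using bilinear_B by (auto simp: bilinear_def)

lemma B_sum_left: "B (\<Sum>i\<in>I. f i) b = (\<Sum>i\<in>I. B (f i) b)"
  by (rule linear_sum[OF linear_B(2)])

lemma B_sum_right: "B a (\<Sum>i\<in>I. f i) = (\<Sum>i\<in>I. B a (f i))"
  by (rule linear_sum[OF linear_B(1)])

text \<open>The vector \<open>b - B e b *\<^sub>R e\<close> has nonnegative square.\<close>

lemma Cauchy_Schwarz_unit:
  assumes "B e e = 1" shows "(B e b)\<^sup>2 \<le> B b b"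
proof -
  have "0 \<le> B (b - B e b *\<^sub>R e) (b - B e b *\<^sub>R e)"
    using pos_B bilinear_lzero[OF bilinear_B, of 0] by (metis less_eq_real_def)
  also have "\<dots> = B b b - (B e b)\<^sup>2"
    by (simp add: B_simps assms sym_B[of b e] power2_eq_square algebra_simps)
  finally show ?thesis by simp
qed

text \<open>The Gram-Schmidt process, with the index type enumerated by induction on its subsets.\<close>

lemma orthonormal_frame_exists:
  obtains v :: "'n \<Rightarrow> real^'n" where "\<And>i j. B (v i) (v j) = (if i = j then 1 else 0)"
proof -
  have "\<exists>v :: 'n \<Rightarrow> real^'n. \<forall>i\<in>I. \<forall>j\<in>I. B (v i) (v j) = (if i = j then 1 else 0)" for I :: "'n set"
    using finite[of I]
  proof induction
    case (insert k I)
    then obtain v where v: "\<forall>i\<in>I. \<forall>j\<in>I. B (v i) (v j) = (if i = j then 1 else 0)" by blast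
    then have vv: "B (v i) (v j) = (if i = j then 1 else 0)" if "i \<in> I" "j \<in> I" for i j
      using that by blast
    have "card (v ` I) < CARD('n)"
      using card_image_le[OF finite[of I], of v] insert(2)
        psubset_card_mono[of UNIV I] by fastforce
    moreover have "dim (v ` I) \<le> card (v ` I)" by (rule dim_le_card) (auto simp: span_base)
    ultimately have "span (v ` I) \<noteq> UNIV"
      using dim_span[of "v ` I"] by (metis DIM_cart DIM_real dim_UNIV leD mult_1_right order_trans)
    then obtain y where y: "y \<notin> span (v ` I)" by blast
    define z where "z = y - (\<Sum>i\<in>I. B y (v i) *\<^sub>R v i)"
    have "(\<Sum>i\<in>I. B y (v i) *\<^sub>R v i) \<in> span (v ` I)"
      by (intro span_sum span_scale span_base) auto
    then have "z \<noteq> 0" using y by (auto simp: z_def)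
    then have pos: "0 < B z z" by (rule pos_B)
    have zv: "B z (v j) = 0" if "j \<in> I" for j
    proof -
      have "(\<Sum>i\<in>I. B y (v i) * B (v i) (v j)) = (\<Sum>i\<in>I. if i = j then B y (v i) else 0)"
        by (rule sum.cong) (simp_all add: vv that)
      then show ?thesis using that insert(1) by (simp add: z_def B_simps B_sum_left)
    qed
    define u where "u = (1 / sqrt (B z z)) *\<^sub>R z"
    have uu: "B u u = 1" using pos by (simp add: u_def B_simps)
    have uv: "B u (v j) = 0" "B (v j) u = 0" if "j \<in> I" for j
      using zv[OF that] sym_B[of "v j"] by (simp_all add: u_def B_simps)
    show ?case
      by (rule exI[of _ "v(k := u)"]) (use insert(2) v uu uv in auto)
  qed simp
  from this[of UNIV] show thesis using that by auto
qed

definition frame :: "('n \<Rightarrow> real^'n) \<Rightarrow> bool" where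
  "frame v \<longleftrightarrow> (\<forall>i j. B (v i) (v j) = (if i = j then 1 else 0))"

lemma frame_expansion:
  assumes "frame v"
  shows "a = (\<Sum>i\<in>UNIV. B a (v i) *\<^sub>R v i)"
proof -
  define J where "J x = (\<Sum>i\<in>UNIV. (x $ i) *\<^sub>R v i)" for x :: "real^'n"
  have lin: "linear J"
    by (auto simp: J_def linear_iff scaleR_left_distrib sum.distrib scaleR_sum_right)
  have vv: "B (v i) (v j) = (if i = j then 1 else 0)" for i j
    using assms unfolding frame_def by blast
  have co: "B (J x) (v j) = x $ j" for x j
    by (simp add: J_def vv B_sum_left B_simps if_distrib cong: if_cong)
  have "inj J"
    by (rule injI) (metis co vec_eq_iff)
  then obtain x where "a = J x"
    using linear_injective_imp_surjective[OF lin] by (metis surjD)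
  then show ?thesis using co by (simp add: J_def)
qed

lemma frame_Parseval:
  assumes "frame v"
  shows "B a b = (\<Sum>i\<in>UNIV. B a (v i) * B b (v i))"
proof -
  have "B a b = B (\<Sum>i\<in>UNIV. B a (v i) *\<^sub>R v i) b"
    by (rule arg_cong[where f = "\<lambda>x. B x b"], rule frame_expansion[OF assms])
  also have "\<dots> = (\<Sum>i\<in>UNIV. B a (v i) * B (v i) b)"
    by (simp add: B_sum_left B_simps)
  finally show ?thesis by (simp only: sym_B[of b])
qed

text \<open>By polarization, a linear map that preserves lengths preserves scalar products.\<close>

lemma isometry_frame:
  fixes J :: "real^'n \<Rightarrow> real^'n"
  assumes "linear J" "\<And>a. B (J a) (J a) = (norm a)\<^sup>2"
  shows "B (J a) (J b) = a \<bullet> b" "frame (\<lambda>i. J (axis i 1))" "surj J"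
proof -
  show *: "B (J a) (J b) = a \<bullet> b" for a b
  proof -
    have "B (J (a + b)) (J (a + b)) = B (J a) (J a) + 2 * B (J a) (J b) + B (J b) (J b)"
      using sym_B[of "J b" "J a"] by (simp add: linear_add[OF assms(1)] B_simps)
    then show ?thesis
      by (simp add: assms(2) power2_norm_eq_inner inner_add_left inner_add_right inner_commute)
  qed
  then show "frame (\<lambda>i. J (axis i 1))" by (simp add: frame_def inner_axis_axis inner_real_def)
  have "inj J"
    unfolding linear_injective_0[OF assms(1)] using assms(2) by (metis norm_eq_zero power_eq_0_iff bilinear_lzero[OF bilinear_B])
  then show "surj J" by (rule linear_injective_imp_surjective[OF assms(1)]) simp
qed

lemma isometry_exists:
  obtains J :: "real^'n \<Rightarrow> real^'n" where "linear J" "\<And>a. B (J a) (J a) = (norm a)\<^sup>2"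
proof -
  obtain v :: "'n \<Rightarrow> real^'n" where v: "\<And>i j. B (v i) (v j) = (if i = j then 1 else 0)"
    using orthonormal_frame_exists by metis
  define J where "J x = (\<Sum>i\<in>UNIV. (x $ i) *\<^sub>R v i)" for x :: "real^'n"
  show thesis
  proof (rule that[of J])
    show "linear J"
      by (auto simp: J_def linear_iff scaleR_left_distrib sum.distrib scaleR_sum_right)
    show "B (J a) (J a) = (norm a)\<^sup>2" for a
      by (simp add: J_def B_sum_left B_sum_right B_simps v power2_norm_eq_inner inner_vec_def
          if_distrib cong: if_cong)
  qed
qed

end

section \<open>Families of eikonal functions with a spherical density\<close>

text \<open>The situation in a chart: \<open>\<gamma>\<close> is the metric, \<open>w u s\<close> is the gradient at \<open>u\<close> of the function with
  parameter \<open>s\<close>, and \<open>R u\<close> is the density that \<open>w u\<close> transports to the uniform measure of the unit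
  sphere of \<open>\<gamma> u\<close>; the latter is the image of the standard sphere under a linear isometry \<open>J\<close>.\<close>

locale eikonal_family = smooth_family \<Omega> "sphere 0 1" f
  for \<Omega> :: "(real^'n::{finite,wellorder}) set" and f :: "real^'n::_ \<Rightarrow> real^'n::_ \<Rightarrow> real" +
  fixes \<gamma> :: "real^'n::_ \<Rightarrow> real^'n::_ \<Rightarrow> real^'n::_ \<Rightarrow> real"
    and w :: "real^'n::_ \<Rightarrow> real^'n::_ \<Rightarrow> real^'n::_"
    and R :: "real^'n::_ \<Rightarrow> 'n linf"
  assumes positive_\<gamma>: "u \<in> \<Omega> \<Longrightarrow> positive_form (\<gamma> u)"
    and differentiable_\<gamma>: "u \<in> \<Omega> \<Longrightarrow> (\<lambda>u. \<gamma> u a b) differentiable (at u)"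
    and gradient: "u \<in> \<Omega> \<Longrightarrow> s \<in> sphere 0 1 \<Longrightarrow> \<gamma> u (w u s) b = partial1 f u s b"
    and eikonal: "u \<in> \<Omega> \<Longrightarrow> s \<in> sphere 0 1 \<Longrightarrow> \<gamma> u (w u s) (w u s) = 1"
    and inj_gradient: "u \<in> \<Omega> \<Longrightarrow> inj_on (w u) (sphere 0 1)"
    and spherical: "u \<in> \<Omega> \<Longrightarrow> \<exists>J :: real^'n::_ \<Rightarrow> real^'n::_. linear J \<and> (\<forall>a. \<gamma> u (J a) (J a) = (norm a)\<^sup>2) \<and>
       (\<forall>h. continuous_on UNIV h \<longrightarrow>
          pairing (\<lambda>s. h (w u s)) (R u) = (\<integral>\<theta>. h (J \<theta>) \<partial>sphere_measure))"
begin

lemma continuous_on_partial [continuous_intros]: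
  assumes "u \<in> \<Omega>"
  shows "continuous_on (sphere 0 1) (\<lambda>s. partial1 f u s b)"
    "continuous_on (sphere 0 1) (\<lambda>s. partial2 f u s a b)"
  using continuous_partial[OF assms] by (auto simp: continuous_on_eq_continuous_within)

text \<open>A function of the three numbers \<open>df (a)\<close>, \<open>df (b)\<close>, \<open>df (c)\<close> is integrated by means of the isometry,
  which replaces \<open>a\<close>, \<open>b\<close>, \<open>c\<close> by vectors with the same mutual products in Euclidean space.\<close>

lemma pairing_gradient:
  assumes u: "u \<in> \<Omega>" and h: "continuous_on UNIV (\<lambda>v. h (\<gamma> u v a) (\<gamma> u v b) (\<gamma> u v c))"
  obtains a' b' c' :: "real^'n::_" where "\<gamma> u a b = a' \<bullet> b'" "\<gamma> u a a = a' \<bullet> a'" "\<gamma> u b c = b' \<bullet> c'" "\<gamma> u a c = a' \<bullet> c'"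
    "a \<noteq> 0 \<longrightarrow> a' \<noteq> 0"
    "pairing (\<lambda>s. h (partial1 f u s a) (partial1 f u s b) (partial1 f u s c)) (R u) =
      (\<integral>s. h (a' \<bullet> s) (b' \<bullet> s) (c' \<bullet> s) \<partial>sphere_measure)"
proof -
  interpret \<gamma>: positive_form "\<gamma> u" by (rule positive_\<gamma>[OF u])
  obtain J :: "real^'n::_ \<Rightarrow> real^'n::_" where J: "linear J" "\<And>a. \<gamma> u (J a) (J a) = (norm a)\<^sup>2"
    and int: "\<And>h. continuous_on UNIV h \<Longrightarrow>
      pairing (\<lambda>s. h (w u s)) (R u) = (\<integral>\<theta>. h (J \<theta>) \<partial>sphere_measure)"
  proof -
    from spherical[OF u] obtain J :: "real^'n::_ \<Rightarrow> real^'n::_" where "linear J" "\<forall>a. \<gamma> u (J a) (J a) = (norm a)\<^sup>2"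
      "\<forall>h. continuous_on UNIV h \<longrightarrow> pairing (\<lambda>s. h (w u s)) (R u) = (\<integral>\<theta>. h (J \<theta>) \<partial>sphere_measure)"
      by (elim exE conjE) (rule that)
    then show thesis by (intro that[of J]) simp_all
  qed
  note iso = \<gamma>.isometry_frame[OF J]
  obtain a' b' c' where abc: "a = J a'" "b = J b'" "c = J c'" using iso(3) by (metis surjD)
  show thesis
  proof (rule that[of a' b' c'])
    show "a \<noteq> 0 \<longrightarrow> a' \<noteq> 0" using abc linear_0[OF J(1)] by auto
    have "pairing (\<lambda>s. h (partial1 f u s a) (partial1 f u s b) (partial1 f u s c)) (R u) =
      pairing (\<lambda>s. h (\<gamma> u (w u s) a) (\<gamma> u (w u s) b) (\<gamma> u (w u s) c)) (R u)"
      by (rule pairing_cong) (simp add: gradient[OF u])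
    also have "\<dots> = (\<integral>s. h (\<gamma> u (J s) a) (\<gamma> u (J s) b) (\<gamma> u (J s) c) \<partial>sphere_measure)"
      by (rule int[OF h])
    finally show "pairing (\<lambda>s. h (partial1 f u s a) (partial1 f u s b) (partial1 f u s c)) (R u) =
      (\<integral>s. h (a' \<bullet> s) (b' \<bullet> s) (c' \<bullet> s) \<partial>sphere_measure)"
      by (simp add: abc iso(1) inner_commute)
  qed (simp_all add: abc iso(1))
qed

lemma pairing_partial_partial:
  assumes u: "u \<in> \<Omega>"
  shows "pairing (\<lambda>s. partial1 f u s b * partial1 f u s c) (R u) = \<gamma> u b c / real CARD('n)"
proof -
  interpret \<gamma>: positive_form "\<gamma> u" by (rule positive_\<gamma>[OF u])
  have cont: "continuous_on UNIV (\<lambda>v. \<gamma> u v b * \<gamma> u v c)"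
    by (intro continuous_intros linear_continuous_on \<gamma>.linear_B(2)[unfolded linear_conv_bounded_linear])
  obtain a' b' c' :: "real^'n::_" where *: "\<gamma> u b b = a' \<bullet> b'" "\<gamma> u b b = a' \<bullet> a'" "\<gamma> u b c = b' \<bullet> c'" "\<gamma> u b c = a' \<bullet> c'"
    "b \<noteq> 0 \<longrightarrow> a' \<noteq> 0"
    "pairing (\<lambda>s. partial1 f u s b * partial1 f u s c) (R u) = (\<integral>s. (b' \<bullet> s) * (c' \<bullet> s) \<partial>sphere_measure)"
    by (rule pairing_gradient[OF u, where a = b and h = "\<lambda>_ b c. b * c", OF cont])
  show ?thesis using *(3,6) by (simp add: sphere_second_moment)
qed

lemma pairing_exp:
  assumes u: "u \<in> \<Omega>" and a: "a \<noteq> 0"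
    and \<kappa>: "\<And>a b :: real^'n::_. a \<noteq> 0 \<Longrightarrow>
       (\<integral>s. exp (a \<bullet> s) * (b \<bullet> s) \<partial>sphere_measure) = \<kappa> (a \<bullet> a) * (a \<bullet> b)"
  shows "pairing (\<lambda>s. exp (partial1 f u s a) * partial1 f u s b) (R u) = \<kappa> (\<gamma> u a a) * \<gamma> u a b"
proof -
  interpret \<gamma>: positive_form "\<gamma> u" by (rule positive_\<gamma>[OF u])
  have cont: "continuous_on UNIV (\<lambda>v. exp (\<gamma> u v a) * \<gamma> u v b)"
    by (intro continuous_intros linear_continuous_on \<gamma>.linear_B(2)[unfolded linear_conv_bounded_linear])
  obtain a' b' c' :: "real^'n::_" where *: "\<gamma> u a b = a' \<bullet> b'" "\<gamma> u a a = a' \<bullet> a'" "\<gamma> u b c = b' \<bullet> c'" "\<gamma> u a c = a' \<bullet> c'"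
    "a \<noteq> 0 \<longrightarrow> a' \<noteq> 0"
    "pairing (\<lambda>s. exp (partial1 f u s a) * partial1 f u s b) (R u) = (\<integral>s. exp (a' \<bullet> s) * (b' \<bullet> s) \<partial>sphere_measure)"
    by (rule pairing_gradient[OF u, where h = "\<lambda>a b _. exp a * b", OF cont])
  show ?thesis using *(1,2,5,6) a by (simp add: \<kappa>)
qed

lemma pairing_exp2:
  assumes u: "u \<in> \<Omega>" and a: "a \<noteq> 0"
    and \<kappa>': "\<And>a b c :: real^'n::_. a \<noteq> 0 \<Longrightarrow>
       (\<integral>s. exp (a \<bullet> s) * (b \<bullet> s) * (c \<bullet> s) \<partial>sphere_measure) =
         \<kappa> (a \<bullet> a) * (b \<bullet> c) + 2 * \<kappa>' (a \<bullet> a) * (a \<bullet> b) * (a \<bullet> c)"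
  shows "pairing (\<lambda>s. exp (partial1 f u s a) * partial1 f u s b * partial1 f u s c) (R u) =
    \<kappa> (\<gamma> u a a) * \<gamma> u b c + 2 * \<kappa>' (\<gamma> u a a) * \<gamma> u a b * \<gamma> u a c"
proof -
  interpret \<gamma>: positive_form "\<gamma> u" by (rule positive_\<gamma>[OF u])
  have cont: "continuous_on UNIV (\<lambda>v. exp (\<gamma> u v a) * \<gamma> u v b * \<gamma> u v c)"
    by (intro continuous_intros linear_continuous_on \<gamma>.linear_B(2)[unfolded linear_conv_bounded_linear])
  obtain a' b' c' :: "real^'n::_" where *: "\<gamma> u a b = a' \<bullet> b'" "\<gamma> u a a = a' \<bullet> a'" "\<gamma> u b c = b' \<bullet> c'" "\<gamma> u a c = a' \<bullet> c'"
    "a \<noteq> 0 \<longrightarrow> a' \<noteq> 0"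
    "pairing (\<lambda>s. exp (partial1 f u s a) * partial1 f u s b * partial1 f u s c) (R u) = (\<integral>s. exp (a' \<bullet> s) * (b' \<bullet> s) * (c' \<bullet> s) \<partial>sphere_measure)"
    by (rule pairing_gradient[OF u, where h = "\<lambda>a b c. exp a * b * c", OF cont])
  show ?thesis using * a by (simp add: \<kappa>')
qed

abbreviation d\<gamma> where "d\<gamma> u a b c \<equiv> deriv_at (\<lambda>u. \<gamma> u b c) u a"

lemma has_derivative_\<gamma>: "u \<in> \<Omega> \<Longrightarrow> ((\<lambda>u. \<gamma> u b c) has_derivative (\<lambda>a. d\<gamma> u a b c)) (at u)"
  using differentiable_\<gamma> frechet_derivative_works by blast

lemma linear_d\<gamma>:
  assumes "u \<in> \<Omega>"
  shows "linear (\<lambda>a. d\<gamma> u a b c)" "linear (\<lambda>b. d\<gamma> u a b c)" "linear (\<lambda>c. d\<gamma> u a b c)"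
proof -
  show "linear (\<lambda>a. d\<gamma> u a b c)"
    using has_derivative_\<gamma>[OF assms] by (rule has_derivative_linear)
  have uniq: "d\<gamma> u a b c = D a" if "((\<lambda>u. \<gamma> u b c) has_derivative D) (at u)" for a b c D
    using frechet_derivative_at[OF that] by simp
  have tr: "(h has_derivative D) (at u)" if "(g has_derivative D) (at u)" "\<And>u. u \<in> \<Omega> \<Longrightarrow> g u = h u" for g h :: "_ \<Rightarrow> real" and D
    by (rule has_derivative_transform_within_open[OF that(1) open_\<Omega> assms that(2)])
  show "linear (\<lambda>b. d\<gamma> u a b c)"
  proof (rule linearI)
    fix b b' and r :: real
    show "d\<gamma> u a (b + b') c = d\<gamma> u a b c + d\<gamma> u a b' c"
      by (rule uniq, rule tr, rule has_derivative_add[OF has_derivative_\<gamma>[OF assms, of b c] has_derivative_\<gamma>[OF assms, of b' c]])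
        (simp add: positive_form.B_simps[OF positive_\<gamma>])
    show "d\<gamma> u a (r *\<^sub>R b) c = r *\<^sub>R d\<gamma> u a b c"
      by (rule uniq, rule tr, rule has_derivative_scaleR_right[OF has_derivative_\<gamma>[OF assms, of b c], of r])
        (simp add: positive_form.B_simps[OF positive_\<gamma>])
  qed
  show "linear (\<lambda>c. d\<gamma> u a b c)"
  proof (rule linearI)
    fix c c' and r :: real
    show "d\<gamma> u a b (c + c') = d\<gamma> u a b c + d\<gamma> u a b c'"
      by (rule uniq, rule tr, rule has_derivative_add[OF has_derivative_\<gamma>[OF assms, of b c] has_derivative_\<gamma>[OF assms, of b c']])
        (simp add: positive_form.B_simps[OF positive_\<gamma>])
    show "d\<gamma> u a b (r *\<^sub>R c) = r *\<^sub>R d\<gamma> u a b c"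
      by (rule uniq, rule tr, rule has_derivative_scaleR_right[OF has_derivative_\<gamma>[OF assms, of b c], of r])
        (simp add: positive_form.B_simps[OF positive_\<gamma>])
  qed
qed

text \<open>The gradient lines are geodesics.  Freezing \<open>v = w u s\<close>, the eikonal equation says that
  \<open>\<gamma> u' v v - (partial1 f u' s v)\<^sup>2\<close> is nonnegative and vanishes at \<open>u' = u\<close>; hence its derivative there
  is zero.\<close>

lemma hessian_gradient:
  assumes u: "u \<in> \<Omega>" and s: "s \<in> sphere 0 1"
  shows "partial2 f u s a (w u s) = d\<gamma> u a (w u s) (w u s) / 2"
proof -
  define v where "v = w u s"
  have one: "partial1 f u s v = 1" using gradient[OF u s] eikonal[OF u s] by (simp add: v_def)
  have "((\<lambda>u. \<gamma> u v v - (partial1 f u s v)\<^sup>2) has_derivative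
      (\<lambda>a. d\<gamma> u a v v - 2 * partial2 f u s a v)) (at u)"
    by (rule has_derivative_eq_rhs,
        rule has_derivative_diff[OF has_derivative_\<gamma>[OF u] has_derivative_power[OF has_derivative_family(2)[OF u s]]])
      (simp add: one fun_eq_iff)
  then have "(\<lambda>a. d\<gamma> u a v v - 2 * partial2 f u s a v) = (\<lambda>_. 0)"
  proof (rule differential_zero_maxmin[OF u open_\<Omega>], intro disjI2 ballI)
    fix u' assume u': "u' \<in> \<Omega>"
    interpret positive_form "\<gamma> u'" by (rule positive_\<gamma>[OF u'])
    have "\<gamma> u v v = 1" using eikonal[OF u s] by (simp add: v_def)
    moreover have "(partial1 f u' s v)\<^sup>2 \<le> \<gamma> u' v v"
      using Cauchy_Schwarz_unit[OF eikonal[OF u' s]] gradient[OF u' s] by simp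
    ultimately show "\<gamma> u v v - (partial1 f u s v)\<^sup>2 \<le> \<gamma> u' v v - (partial1 f u' s v)\<^sup>2"
      using one by simp
  qed
  from fun_cong[OF this, of a] show ?thesis by (simp add: v_def)
qed

end

context eikonal_family
begin

lemma partial_along_line:
  assumes "u + t *\<^sub>R v \<in> \<Omega>" "s \<in> sphere 0 1"
  shows "((\<lambda>t. partial1 f (u + t *\<^sub>R v) s b) has_real_derivative partial2 f (u + t *\<^sub>R v) s v b) (at t)"
proof -
  have "((\<lambda>t. partial1 f (u + t *\<^sub>R v) s b) has_derivative (\<lambda>h. partial2 f (u + t *\<^sub>R v) s (h *\<^sub>R v) b)) (at t)"
    by (rule has_derivative_compose[of "\<lambda>t. u + t *\<^sub>R v" "\<lambda>h. h *\<^sub>R v", OF _ has_derivative_family(2)[OF assms]])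
      (auto intro!: derivative_eq_intros)
  then show ?thesis
    by (simp add: has_field_derivative_def linear_cmul[OF linear_partial(3)[OF assms]] mult.commute[of _ "partial2 f _ _ _ _"])
qed

text \<open>The derivative of \<open>pairing_exp\<close> with \<open>b = v\<close> along the line through \<open>u\<close> in the direction \<open>v\<close>.\<close>

lemma differentiated_moment:
  assumes u: "u \<in> \<Omega>" and R': "(R has_derivative R') (at u)" and a: "a \<noteq> 0"
    and \<kappa>: "\<And>a b :: real^'n::_. a \<noteq> 0 \<Longrightarrow>
       (\<integral>s. exp (a \<bullet> s) * (b \<bullet> s) \<partial>sphere_measure) = \<kappa> (a \<bullet> a) * (a \<bullet> b)"
    and \<kappa>': "\<And>r. 0 < r \<Longrightarrow> (\<kappa> has_real_derivative \<kappa>' r) (at r)"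
  shows "pairing (\<lambda>s. exp (partial1 f u s a) * partial2 f u s v a * partial1 f u s v) (R u)
      + pairing (\<lambda>s. exp (partial1 f u s a) * partial2 f u s v v) (R u)
      + pairing (\<lambda>s. exp (partial1 f u s a) * partial1 f u s v) (R' v)
    = \<kappa>' (\<gamma> u a a) * d\<gamma> u v a a * \<gamma> u a v + \<kappa> (\<gamma> u a a) * d\<gamma> u v a v"
proof -
  obtain r C where rC: "r > 0" "C \<ge> 0" "ball u r \<subseteq> \<Omega>"
    and P: "\<And>u' s b. u' \<in> ball u r \<Longrightarrow> s \<in> sphere 0 1 \<Longrightarrow> \<bar>partial1 f u' s b\<bar> \<le> C * norm b"
    and Q: "\<And>u' s a b. u' \<in> ball u r \<Longrightarrow> s \<in> sphere 0 1 \<Longrightarrow> \<bar>partial2 f u' s a b\<bar> \<le> C * norm a * norm b"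
    using partials_uniformly_bounded[OF u] by blast
  define d where "d = r / (norm v + 1)"
  have pos: "norm v + 1 > 0" by (simp add: add_nonneg_pos)
  have d: "d > 0" using rC(1) pos by (simp add: d_def)
  have line: "u + t *\<^sub>R v \<in> ball u r" if "\<bar>t\<bar> < d" for t
  proof -
    have "\<bar>t\<bar> * (norm v + 1) < r" using that pos by (simp add: d_def pos_less_divide_eq)
    moreover have "\<bar>t\<bar> * norm v \<le> \<bar>t\<bar> * (norm v + 1)" by (simp add: distrib_left)
    ultimately show ?thesis by (simp add: dist_norm)
  qed
  define F where "F t s = exp (partial1 f (u + t *\<^sub>R v) s a) * partial1 f (u + t *\<^sub>R v) s v" for t s
  define F' where "F' t s = exp (partial1 f (u + t *\<^sub>R v) s a) * partial2 f (u + t *\<^sub>R v) s v a * partial1 f (u + t *\<^sub>R v) s v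
     + exp (partial1 f (u + t *\<^sub>R v) s a) * partial2 f (u + t *\<^sub>R v) s v v" for t s
  have lhs: "((\<lambda>t. pairing (F t) (R (u + t *\<^sub>R v))) has_real_derivative
      pairing (F' 0) (R (u + 0 *\<^sub>R v)) + pairing (F 0) (R' v)) (at 0)"
  proof (rule has_derivative_pairing_bounded[OF d])
    fix t assume t: "\<bar>t\<bar> < d"
    have \<Omega>: "u + t *\<^sub>R v \<in> \<Omega>" using line[OF t] rC(3) by blast
    show "continuous_on (sphere 0 1) (F t)"
      unfolding F_def by (intro continuous_intros \<Omega>)
    fix s :: "real^'n::_" assume s: "s \<in> sphere 0 1"
    show "((\<lambda>t. F t s) has_real_derivative F' t s) (at t)"
      unfolding F_def F'_def
      by (rule derivative_eq_intros partial_along_line[OF \<Omega> s] refl)+ (simp add: algebra_simps)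
    have "\<bar>F' t s\<bar> \<le> exp (C * norm a) * (C * norm v * norm a) * (C * norm v) + exp (C * norm a) * (C * norm v * norm v)"
      unfolding F'_def
    proof (rule order_trans[OF abs_triangle_ineq add_mono])
      have e: "\<bar>exp (partial1 f (u + t *\<^sub>R v) s a)\<bar> \<le> exp (C * norm a)"
        using P[OF line[OF t] s, of a] by simp
      show "\<bar>exp (partial1 f (u + t *\<^sub>R v) s a) * partial2 f (u + t *\<^sub>R v) s v a * partial1 f (u + t *\<^sub>R v) s v\<bar>
        \<le> exp (C * norm a) * (C * norm v * norm a) * (C * norm v)"
        unfolding abs_mult using rC(2) by (intro mult_mono e P[OF line[OF t] s] Q[OF line[OF t] s]) auto
      show "\<bar>exp (partial1 f (u + t *\<^sub>R v) s a) * partial2 f (u + t *\<^sub>R v) s v v\<bar>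
        \<le> exp (C * norm a) * (C * norm v * norm v)"
        unfolding abs_mult using rC(2) by (intro mult_mono e Q[OF line[OF t] s]) auto
    qed
    then show "\<bar>F' t s\<bar> \<le> exp (C * norm a) * (C * norm v * norm a) * (C * norm v) + exp (C * norm a) * (C * norm v * norm v)" .
  next
    show "continuous_on (sphere 0 1) (F' 0)"
      unfolding F'_def using u by (intro continuous_intros) simp_all
    have "((\<lambda>t. R (u + t *\<^sub>R v)) has_derivative (\<lambda>h. R' (h *\<^sub>R v))) (at 0)"
      by (rule has_derivative_compose[of "\<lambda>t. u + t *\<^sub>R v" "\<lambda>h. h *\<^sub>R v" _ _ R])
        (use R' in \<open>auto intro!: derivative_eq_intros\<close>)
    then show "((\<lambda>t. R (u + t *\<^sub>R v)) has_vector_derivative R' v) (at 0)"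
      using linear_cmul[OF has_derivative_linear[OF R']] by (simp add: has_vector_derivative_def)
  qed
  have rhs: "((\<lambda>t. \<kappa> (\<gamma> (u + t *\<^sub>R v) a a) * \<gamma> (u + t *\<^sub>R v) a v) has_real_derivative
     \<kappa>' (\<gamma> u a a) * d\<gamma> u v a a * \<gamma> u a v + \<kappa> (\<gamma> u a a) * d\<gamma> u v a v) (at 0)"
  proof -
    have \<gamma>': "((\<lambda>t. \<gamma> (u + t *\<^sub>R v) b c) has_real_derivative d\<gamma> u v b c) (at 0)" for b c
    proof -
      have "((\<lambda>t. \<gamma> (u + t *\<^sub>R v) b c) has_derivative (\<lambda>h. d\<gamma> u (h *\<^sub>R v) b c)) (at 0)"
        by (rule has_derivative_compose[of "\<lambda>t. u + t *\<^sub>R v" "\<lambda>h. h *\<^sub>R v" _ _ "\<lambda>u. \<gamma> u b c"])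
          (use has_derivative_\<gamma>[OF u] in \<open>auto intro!: derivative_eq_intros\<close>)
      then show ?thesis
        by (simp add: has_field_derivative_def linear_cmul[OF linear_d\<gamma>(1)[OF u]] mult.commute[of _ "d\<gamma> _ _ _ _"])
    qed
    have "0 < \<gamma> (u + 0 *\<^sub>R v) a a"
      using positive_form.pos_B[OF positive_\<gamma>[OF u] a] by simp
    from DERIV_mult[OF DERIV_chain2[OF \<kappa>'[OF this] \<gamma>'] \<gamma>'] show ?thesis
      by (simp add: mult.commute algebra_simps)
  qed
  have eq: "\<forall>\<^sub>F t in nhds 0. pairing (F t) (R (u + t *\<^sub>R v)) = \<kappa> (\<gamma> (u + t *\<^sub>R v) a a) * \<gamma> (u + t *\<^sub>R v) a v"
  proof -
    have "\<forall>\<^sub>F t in nhds 0. \<bar>t\<bar> < d"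
      using d by (auto simp: eventually_nhds_metric dist_real_def)
    then show ?thesis
    proof eventually_elim
      case (elim t)
      then have "u + t *\<^sub>R v \<in> \<Omega>" using line rC(3) by blast
      from pairing_exp[OF this a \<kappa>] show ?case by (simp add: F_def[abs_def])
    qed
  qed
  have "pairing (F' 0) (R (u + 0 *\<^sub>R v)) + pairing (F 0) (R' v)
      = \<kappa>' (\<gamma> u a a) * d\<gamma> u v a a * \<gamma> u a v + \<kappa> (\<gamma> u a a) * d\<gamma> u v a v"
    by (rule DERIV_unique[OF lhs DERIV_cong_ev[OF refl eq refl, THEN iffD2, OF rhs]])
  moreover have "pairing (F' 0) (R u) = pairing (\<lambda>s. exp (partial1 f u s a) * partial2 f u s v a * partial1 f u s v) (R u)
      + pairing (\<lambda>s. exp (partial1 f u s a) * partial2 f u s v v) (R u)"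
    unfolding F'_def by (subst pairing_add_left[symmetric]) (auto intro!: continuous_intros u)
  ultimately show ?thesis by (simp add: F_def[abs_def])
qed

text \<open>Summation of \<open>differentiated_moment\<close> over a frame.  In its first term the frame adds up to the gradient,
  so \<open>hessian_gradient\<close> applies and leaves a second moment with exponential weight; both terms with
  \<open>\<kappa>'\<close> then equal \<open>\<kappa>' (\<gamma> u a a) * d\<gamma> u a a a\<close> and cancel.\<close>

lemma summed_moment:
  assumes u: "u \<in> \<Omega>" and R': "(R has_derivative R') (at u)" and a: "a \<noteq> 0"
    and v: "positive_form.frame (\<gamma> u) v"
    and \<kappa>: "\<And>a b :: real^'n::_. a \<noteq> 0 \<Longrightarrow>
       (\<integral>s. exp (a \<bullet> s) * (b \<bullet> s) \<partial>sphere_measure) = \<kappa> (a \<bullet> a) * (a \<bullet> b)"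
    and \<kappa>\<kappa>': "\<And>a b c :: real^'n::_. a \<noteq> 0 \<Longrightarrow>
       (\<integral>s. exp (a \<bullet> s) * (b \<bullet> s) * (c \<bullet> s) \<partial>sphere_measure) =
         \<kappa> (a \<bullet> a) * (b \<bullet> c) + 2 * \<kappa>' (a \<bullet> a) * (a \<bullet> b) * (a \<bullet> c)"
    and \<kappa>': "\<And>r. 0 < r \<Longrightarrow> (\<kappa> has_real_derivative \<kappa>' r) (at r)"
  shows "(\<Sum>i\<in>UNIV. pairing (\<lambda>s. exp (partial1 f u s a) * partial2 f u s (v i) (v i)) (R u)
      + pairing (\<lambda>s. exp (partial1 f u s a) * partial1 f u s (v i)) (R' (v i)))
    = \<kappa> (\<gamma> u a a) * (\<Sum>i\<in>UNIV. d\<gamma> u (v i) a (v i) - d\<gamma> u a (v i) (v i) / 2)"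
proof -
  interpret \<gamma>: positive_form "\<gamma> u" by (rule positive_\<gamma>[OF u])
  have vv: "\<gamma> u (v i) (v j) = (if i = j then 1 else 0)" for i j
    using v unfolding \<gamma>.frame_def by blast
  let ?E = "\<lambda>s. exp (partial1 f u s a)"
  let ?P = "partial1 f u" and ?Q = "partial2 f u"
  have wexp: "w u s = (\<Sum>i\<in>UNIV. ?P s (v i) *\<^sub>R v i)" if "s \<in> sphere 0 1" for s
    using \<gamma>.frame_expansion[OF v, of "w u s"] by (simp add: gradient[OF u that])
  \<comment> \<open>the frame sum is a derivative along the gradient, whose lines are geodesics\<close>
  have geo: "(\<Sum>i\<in>UNIV. ?E s * ?Q s (v i) a * ?P s (v i)) =
     (\<Sum>i\<in>UNIV. \<Sum>j\<in>UNIV. (d\<gamma> u a (v i) (v j) / 2) * (?E s * ?P s (v i) * ?P s (v j)))"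
    if s: "s \<in> sphere 0 1" for s
  proof -
    have "(\<Sum>i\<in>UNIV. ?E s * ?Q s (v i) a * ?P s (v i)) = ?E s * ?Q s a (w u s)"
      unfolding wexp[OF s]
      by (simp add: linear_sum[OF linear_partial(2)[OF u s]] linear_cmul[OF linear_partial(2)[OF u s]]
          partial2_commute[OF u s, of "v _" a] sum_distrib_left mult_ac)
    also have "\<dots> = ?E s * (d\<gamma> u a (w u s) (w u s) / 2)"
      by (simp only: hessian_gradient[OF u s])
    also have "d\<gamma> u a (w u s) (w u s) = (\<Sum>i\<in>UNIV. \<Sum>j\<in>UNIV. ?P s (v i) * (?P s (v j) * d\<gamma> u a (v i) (v j)))"
      unfolding wexp[OF s]
      by (simp add: linear_sum[OF linear_d\<gamma>(2)[OF u]] linear_cmul[OF linear_d\<gamma>(2)[OF u]]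
          linear_sum[OF linear_d\<gamma>(3)[OF u]] linear_cmul[OF linear_d\<gamma>(3)[OF u]] sum_distrib_left)
    finally show ?thesis
      by (simp add: sum_distrib_left sum_divide_distrib mult_ac)
  qed
  have aexp: "a = (\<Sum>i\<in>UNIV. \<gamma> u a (v i) *\<^sub>R v i)" by (rule \<gamma>.frame_expansion[OF v])
  have d1: "d\<gamma> u a a a = (\<Sum>i\<in>UNIV. d\<gamma> u (v i) a a * \<gamma> u a (v i))"
  proof -
    have "d\<gamma> u a a a = d\<gamma> u (\<Sum>i\<in>UNIV. \<gamma> u a (v i) *\<^sub>R v i) a a"
      by (rule arg_cong[where f = "\<lambda>b. d\<gamma> u b a a"], rule aexp)
    then show ?thesis
      by (simp add: linear_sum[OF linear_d\<gamma>(1)[OF u]] linear_cmul[OF linear_d\<gamma>(1)[OF u]] mult.commute)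
  qed
  have d2: "d\<gamma> u a a a = (\<Sum>i\<in>UNIV. \<Sum>j\<in>UNIV. d\<gamma> u a (v i) (v j) * (\<gamma> u a (v i) * \<gamma> u a (v j)))"
  proof -
    have "d\<gamma> u a a a = d\<gamma> u a (\<Sum>i\<in>UNIV. \<gamma> u a (v i) *\<^sub>R v i) (\<Sum>i\<in>UNIV. \<gamma> u a (v i) *\<^sub>R v i)"
      by (rule arg_cong[where f = "\<lambda>b. d\<gamma> u a b b"], rule aexp)
    then show ?thesis
      by (simp add: linear_sum[OF linear_d\<gamma>(2)[OF u]] linear_cmul[OF linear_d\<gamma>(2)[OF u]]
          linear_sum[OF linear_d\<gamma>(3)[OF u]] linear_cmul[OF linear_d\<gamma>(3)[OF u]] sum_distrib_left mult_ac)
  qed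
  define K K' where "K = \<kappa> (\<gamma> u a a)" and "K' = \<kappa>' (\<gamma> u a a)"
  have pe2: "pairing (\<lambda>s. ?E s * ?P s b * ?P s c) (R u) = K * \<gamma> u b c + 2 * K' * \<gamma> u a b * \<gamma> u a c" for b c
    unfolding K_def K'_def by (rule pairing_exp2[OF u a]) (rule \<kappa>\<kappa>')
  have dm: "pairing (\<lambda>s. ?E s * ?Q s b a * ?P s b) (R u) + pairing (\<lambda>s. ?E s * ?Q s b b) (R u)
      + pairing (\<lambda>s. ?E s * ?P s b) (R' b) = K' * d\<gamma> u b a a * \<gamma> u a b + K * d\<gamma> u b a b" for b
    unfolding K_def K'_def by (rule differentiated_moment[OF u R' a]) (rule \<kappa> \<kappa>'; assumption)+
  have "(\<Sum>i\<in>UNIV. pairing (\<lambda>s. ?E s * ?Q s (v i) a * ?P s (v i)) (R u)) =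
     pairing (\<lambda>s. \<Sum>i\<in>UNIV. ?E s * ?Q s (v i) a * ?P s (v i)) (R u)"
    by (subst pairing_sum_left) (auto intro!: continuous_intros u)
  also have "\<dots> = pairing (\<lambda>s. \<Sum>i\<in>UNIV. \<Sum>j\<in>UNIV. (d\<gamma> u a (v i) (v j) / 2) * (?E s * ?P s (v i) * ?P s (v j))) (R u)"
    by (rule pairing_cong) (rule geo)
  also have "\<dots> = (\<Sum>i\<in>UNIV. \<Sum>j\<in>UNIV. (d\<gamma> u a (v i) (v j) / 2) * pairing (\<lambda>s. ?E s * ?P s (v i) * ?P s (v j)) (R u))"
    by (subst pairing_sum_left, (intro continuous_intros u)[1], subst pairing_sum_left,
        (intro continuous_intros u)[1], subst pairing_cmult_left, rule refl)
  also have "\<dots> = (\<Sum>i\<in>UNIV. \<Sum>j\<in>UNIV. (d\<gamma> u a (v i) (v j) / 2) *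
      (K * (if i = j then 1 else 0) + 2 * K' * \<gamma> u a (v i) * \<gamma> u a (v j)))"
    unfolding pe2 vv ..
  also have "\<dots> = (\<Sum>i\<in>UNIV. \<Sum>j\<in>UNIV. (if i = j then K * (d\<gamma> u a (v i) (v j) / 2) else 0)
      + K' * (d\<gamma> u a (v i) (v j) * (\<gamma> u a (v i) * \<gamma> u a (v j))))"
    by (intro sum.cong refl) (simp add: algebra_simps)
  also have "\<dots> = (\<Sum>i\<in>UNIV. K * (d\<gamma> u a (v i) (v i) / 2)) + K' * d\<gamma> u a a a"
    unfolding d2 by (simp add: sum.distrib sum_distrib_left)
  finally have quad: "(\<Sum>i\<in>UNIV. pairing (\<lambda>s. ?E s * ?Q s (v i) a * ?P s (v i)) (R u)) =
    (\<Sum>i\<in>UNIV. K * (d\<gamma> u a (v i) (v i) / 2)) + K' * d\<gamma> u a a a" .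
  have "(\<Sum>i\<in>UNIV. pairing (\<lambda>s. ?E s * ?Q s (v i) a * ?P s (v i)) (R u))
      + (\<Sum>i\<in>UNIV. pairing (\<lambda>s. ?E s * ?Q s (v i) (v i)) (R u) + pairing (\<lambda>s. ?E s * ?P s (v i)) (R' (v i)))
    = (\<Sum>i\<in>UNIV. K' * d\<gamma> u (v i) a a * \<gamma> u a (v i) + K * d\<gamma> u (v i) a (v i))"
    unfolding sum.distrib[symmetric]
    unfolding dm[symmetric] by (simp add: add.assoc)
  also have "\<dots> = K' * d\<gamma> u a a a + (\<Sum>i\<in>UNIV. K * d\<gamma> u (v i) a (v i))"
    unfolding d1 by (simp add: sum.distrib sum_distrib_left mult.assoc)
  finally have "(\<Sum>i\<in>UNIV. pairing (\<lambda>s. ?E s * ?Q s (v i) (v i)) (R u) + pairing (\<lambda>s. ?E s * ?P s (v i)) (R' (v i)))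
     = (\<Sum>i\<in>UNIV. K * d\<gamma> u (v i) a (v i)) - (\<Sum>i\<in>UNIV. K * (d\<gamma> u a (v i) (v i) / 2))"
    unfolding quad by linarith
  also have "\<dots> = K * (\<Sum>i\<in>UNIV. d\<gamma> u (v i) a (v i) - d\<gamma> u a (v i) (v i) / 2)"
    by (simp add: sum_subtractf sum_distrib_left right_diff_distrib)
  finally show ?thesis by (simp add: K_def)
qed

text \<open>For a frame \<open>v\<close> at \<open>u\<close> the sum is the divergence of \<open>R grad f\<close> up to the derivative of \<open>f\<close> along the
  contracted Christoffel symbols \<open>\<Gamma>\<close>.  That it equals this derivative means that the weighted gradient
  fields are divergence free for almost every \<open>s\<close>.\<close>

lemma weighted_divergence:
  assumes u: "u \<in> \<Omega>" and R': "(R has_derivative R') (at u)"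
    and v: "positive_form.frame (\<gamma> u) v"
  obtains \<Gamma> where "(\<Sum>i\<in>UNIV. linf_class (\<lambda>s. partial2 f u s (v i) (v i)) * R u
      + linf_class (\<lambda>s. partial1 f u s (v i)) * R' (v i)) = linf_class (\<lambda>s. partial1 f u s \<Gamma>) * R u"
proof -
  interpret \<gamma>: positive_form "\<gamma> u" by (rule positive_\<gamma>[OF u])
  obtain \<kappa> \<kappa>' where \<kappa>: "\<And>a b :: real^'n::_. a \<noteq> 0 \<Longrightarrow>
       (\<integral>s. exp (a \<bullet> s) * (b \<bullet> s) \<partial>sphere_measure) = \<kappa> (a \<bullet> a) * (a \<bullet> b)"
    and \<kappa>\<kappa>': "\<And>a b c :: real^'n::_. a \<noteq> 0 \<Longrightarrow>
       (\<integral>s. exp (a \<bullet> s) * (b \<bullet> s) * (c \<bullet> s) \<partial>sphere_measure) =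
         \<kappa> (a \<bullet> a) * (b \<bullet> c) + 2 * \<kappa>' (a \<bullet> a) * (a \<bullet> b) * (a \<bullet> c)"
    and \<kappa>': "\<And>r. 0 < r \<Longrightarrow> (\<kappa> has_real_derivative \<kappa>' r) (at r)"
    using sphere_exponential_moments[where 'n = 'n] by blast
  define l where "l a = (\<Sum>i\<in>UNIV. d\<gamma> u (v i) a (v i) - d\<gamma> u a (v i) (v i) / 2)" for a
  have l: "linear l"
    unfolding l_def
    by (intro linear_compose_sum ballI linear_compose_sub linear_d\<gamma>[OF u]
        linear_compose_scale_right[of "\<lambda>a. d\<gamma> u a (v _) (v _)" "1/2", simplified])
  define \<Gamma> where "\<Gamma> = (\<Sum>i\<in>UNIV. l (v i) *\<^sub>R v i)"
  have \<gamma>\<Gamma>: "\<gamma> u a \<Gamma> = l a" for a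
  proof -
    have "l a = l (\<Sum>i\<in>UNIV. \<gamma> u a (v i) *\<^sub>R v i)"
      by (rule arg_cong[where f = l], rule \<gamma>.frame_expansion[OF v])
    then show ?thesis
      by (simp add: \<Gamma>_def linear_sum[OF l] linear_cmul[OF l] \<gamma>.B_sum_right \<gamma>.B_simps mult.commute)
  qed
  define X where "X = (\<Sum>i\<in>UNIV. linf_class (\<lambda>s. partial2 f u s (v i) (v i)) * R u
      + linf_class (\<lambda>s. partial1 f u s (v i)) * R' (v i)) - linf_class (\<lambda>s. partial1 f u s \<Gamma>) * R u"
  have ce: "continuous_on (sphere 0 1) (\<lambda>s. exp (partial1 f u s a))" for a
    by (intro continuous_intros u)
  have nz: "pairing (\<lambda>s. exp (partial1 f u s a)) X = 0" if a: "a \<noteq> 0" for a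
  proof -
    have sm: "(\<Sum>i\<in>UNIV. pairing (\<lambda>s. exp (partial1 f u s a) * partial2 f u s (v i) (v i)) (R u)
        + pairing (\<lambda>s. exp (partial1 f u s a) * partial1 f u s (v i)) (R' (v i))) = \<kappa> (\<gamma> u a a) * l a"
      unfolding l_def by (rule summed_moment[OF u R' a v]) (rule \<kappa> \<kappa>\<kappa>' \<kappa>'; assumption)+
    have pe: "pairing (\<lambda>s. exp (partial1 f u s a) * partial1 f u s \<Gamma>) (R u) = \<kappa> (\<gamma> u a a) * l a"
      unfolding \<gamma>\<Gamma>[symmetric] by (rule pairing_exp[OF u a]) (rule \<kappa>)
    interpret bounded_linear "pairing (\<lambda>s. exp (partial1 f u s a))" by (rule bounded_linear_pairing[OF ce])
    show ?thesis
      unfolding X_def using sm pe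
      by (simp add: sum diff add pairing_mult_class[OF ce] continuous_on_partial[OF u])
  qed
  \<comment> \<open>the moment formulas exclude \<open>a = 0\<close>; this case follows by continuity along a ray\<close>
  have z: "pairing (\<lambda>s. exp (partial1 f u s 0)) X = 0"
  proof -
    define a :: "real^'n::_" where "a = axis undefined 1"
    have "a \<noteq> 0" by (simp add: a_def)
    obtain B where B: "\<And>s. s \<in> sphere 0 1 \<Longrightarrow> \<bar>partial1 f u s a\<bar> \<le> B"
      using continuous_sphere_bounded[OF continuous_on_partial(1)[OF u]] by metis
    define F where "F t s = exp (t * partial1 f u s a)" for t s
    define F' where "F' t s = exp (t * partial1 f u s a) * partial1 f u s a" for t s
    have Fe: "pairing (F t) X = pairing (\<lambda>s. exp (partial1 f u s (t *\<^sub>R a))) X" for t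
      by (rule pairing_cong) (simp add: F_def linear_cmul[OF linear_partial(1)[OF u]])
    have "((\<lambda>t. pairing (F t) X) has_real_derivative pairing (F' 0) X + pairing (F 0) 0) (at 0)"
    proof (rule has_derivative_pairing_bounded[of 1 F F' "exp B * B" "\<lambda>_. X"])
      fix t :: real and s :: "real^'n::_" assume t: "\<bar>t\<bar> < 1" and s: "s \<in> sphere 0 1"
      show "((\<lambda>t. F t s) has_real_derivative F' t s) (at t)"
        unfolding F_def F'_def by (auto intro!: derivative_eq_intros)
      have "\<bar>t\<bar> * \<bar>partial1 f u s a\<bar> \<le> 1 * B" using t B[OF s] by (intro mult_mono) auto
      then have "t * partial1 f u s a \<le> B" by (simp add: abs_mult[symmetric])
      then show "\<bar>F' t s\<bar> \<le> exp B * B"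
        unfolding F'_def abs_mult using B[OF s] by (intro mult_mono) auto
    qed (auto simp: F_def F'_def intro!: continuous_intros u)
    then have "isCont (\<lambda>t. pairing (F t) X) 0" by (rule DERIV_isCont)
    then have "((\<lambda>t. pairing (F t) X) \<longlongrightarrow> pairing (F 0) X) (at 0)" by (simp add: isCont_def)
    moreover have "\<forall>\<^sub>F t in at 0. pairing (F t) X = 0"
      unfolding eventually_at_filter Fe using nz \<open>a \<noteq> 0\<close> by (auto intro!: always_eventually)
    then have "((\<lambda>t. pairing (F t) X) \<longlongrightarrow> 0) (at 0)" by (rule tendsto_eventually)
    ultimately have "pairing (F 0) X = 0" by (rule LIM_unique)
    then show ?thesis by (simp add: Fe)
  qed
  have "X = 0"
  proof (rule linf_zero_if_orthogonal_to_exponentials[of "partial1 f u"])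
    show "pairing (\<lambda>s. exp (partial1 f u s a)) X = 0" for a
      using nz z by (cases "a = 0") auto
    show "\<exists>a. partial1 f u s a \<noteq> partial1 f u s' a"
      if s: "s \<in> sphere 0 1" "s' \<in> sphere 0 1" "s \<noteq> s'" for s s'
    proof -
      have "w u s - w u s' \<noteq> 0" using inj_onD[OF inj_gradient[OF u] _ s(1,2)] s(3) by auto
      from \<gamma>.pos_B[OF this] have "\<gamma> u (w u s) (w u s - w u s') \<noteq> \<gamma> u (w u s') (w u s - w u s')"
        by (simp add: \<gamma>.B_simps(5))
      then show ?thesis using gradient[OF u s(1)] gradient[OF u s(2)] by metis
    qed
  qed (use linear_partial(1)[OF u] continuous_on_partial[OF u] in auto)
  then show thesis by (intro that[of \<Gamma>]) (simp add: X_def)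
qed

end

section \<open>Local parametrizations\<close>

text \<open>The minimum of the norm over the unit sphere of the domain is attained and positive.\<close>

lemma linear_injective_bounded_below:
  fixes L :: "'k::euclidean_space \<Rightarrow> 'b::real_normed_vector"
  assumes "linear L" "inj L"
  obtains c where "0 < c" "\<And>a. c * norm a \<le> norm (L a)"
proof -
  have cont: "continuous_on (sphere 0 1) (\<lambda>a. norm (L a))"
    using assms(1) by (intro continuous_on_norm linear_continuous_on) (simp add: linear_conv_bounded_linear)
  have "(SOME i. i \<in> Basis) \<in> sphere (0::'k) 1"
    by (simp add: some_in_eq)
  then obtain m where m: "m \<in> sphere 0 1" "\<And>a. a \<in> sphere 0 1 \<Longrightarrow> norm (L m) \<le> norm (L a)"
    using continuous_attains_inf[OF compact_sphere _ cont] by blast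
  have "L m \<noteq> 0" using m(1) assms(2) linear_injective_0[OF assms(1)] by auto
  show thesis
  proof (rule that[of "norm (L m)"])
    show "norm (L m) * norm a \<le> norm (L a)" for a
    proof (cases "a = 0")
      case False
      have "norm (L m) \<le> norm (L (a /\<^sub>R norm a))" using False by (intro m(2)) simp
      also have "\<dots> = norm (L a) / norm a" by (simp add: linear_cmul[OF assms(1)] divide_inverse mult.commute)
      finally show ?thesis using False by (simp add: pos_le_divide_eq)
    qed simp
  qed (use \<open>L m \<noteq> 0\<close> in simp)
qed

lemma vector_derivative_tendsto_nhds:
  assumes "(f has_vector_derivative f') (at (0::real))"
  shows "(f \<longlongrightarrow> f 0) (nhds 0)"
proof -
  have "isCont f 0" using has_vector_derivative_continuous[OF assms] .
  then show ?thesis by (simp add: isCont_def tendsto_at_iff_tendsto_nhds)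
qed

text \<open>A differentiable curve in the submanifold is differentiable in every local parametrization.  Its
  coordinates are continuous, hence Lipschitz at the base point because the differential of the
  parametrization is bounded below; the difference quotients then accumulate at some vector, and
  injectivity of the differential identifies the limit.\<close>

lemma local_param_lift:
  fixes \<psi> :: "'k::euclidean_space \<Rightarrow> 'n::finite linf" and f :: "real \<Rightarrow> 'n linf"
  assumes lp: "local_param F W \<psi>" and u: "u \<in> W" and f0: "f 0 = \<psi> u"
    and fF: "\<forall>\<^sub>F t in nhds 0. f t \<in> F" and f': "(f has_vector_derivative f') (at 0)"
  obtains \<omega> :: "real \<Rightarrow> 'k" and a where "\<omega> 0 = u" "\<forall>\<^sub>F t in nhds 0. \<omega> t \<in> W \<and> \<psi> (\<omega> t) = f t"
    "(\<omega> has_vector_derivative a) (at 0)" "deriv_at \<psi> u a = f'"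
proof -
  have W: "open W" and smooth: "smooth_on W \<psi>" and inj: "inj (deriv_at \<psi> u)"
    and op: "openin (top_of_set F) (\<psi> ` W)" and hom: "homeomorphism W (\<psi> ` W) \<psi> (inv_into W \<psi>)"
    using lp u unfolding local_param_def by auto
  define L where "L = deriv_at \<psi> u"
  have \<psi>': "(\<psi> has_derivative L) (at u)"
    unfolding L_def by (rule smooth_on_differentiable[OF W smooth u])
  have L: "linear L" using \<psi>' by (rule has_derivative_linear)
  interpret L: bounded_linear L using \<psi>' by (rule has_derivative_bounded_linear)
  obtain c where c: "0 < c" "\<And>a. c * norm a \<le> norm (L a)"
    using linear_injective_bounded_below[OF L] inj unfolding L_def by blast
  obtain S where S: "open S" "\<psi> ` W = S \<inter> F" using op by (auto simp: openin_open)
  have ft: "(f \<longlongrightarrow> f 0) (nhds 0)" by (rule vector_derivative_tendsto_nhds[OF f'])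
  have "f 0 \<in> S" using f0 u S(2) by auto
  then have "\<forall>\<^sub>F t in nhds 0. f t \<in> S" using topological_tendstoD[OF ft S(1)] by simp
  with fF have im: "\<forall>\<^sub>F t in nhds 0. f t \<in> \<psi> ` W"
    by eventually_elim (use S(2) in auto)
  define \<omega> where "\<omega> t = inv_into W \<psi> (f t)" for t
  have \<omega>0: "\<omega> 0 = u" using homeomorphism_apply1[OF hom u] by (simp add: \<omega>_def f0)
  have \<omega>W: "\<forall>\<^sub>F t in nhds 0. \<omega> t \<in> W \<and> \<psi> (\<omega> t) = f t"
    using im by eventually_elim (auto simp: \<omega>_def inv_into_into f_inv_into_f)
  have "(\<omega> \<longlongrightarrow> \<omega> 0) (nhds 0)"
    unfolding \<omega>_def
    by (rule continuous_on_tendsto_compose[OF homeomorphism_cont2[OF hom] ft _ im]) (use f0 u in auto)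
  then have \<omega>t: "(\<omega> \<longlongrightarrow> u) (at 0)" using \<omega>0 tendsto_at_iff_tendsto_nhds[of \<omega> 0] by simp
  have \<omega>W': "\<forall>\<^sub>F t in at 0. \<omega> t \<in> W \<and> \<psi> (\<omega> t) = f t"
    using \<omega>W by (simp add: eventually_nhds_conv_at)
  have near: "\<forall>\<^sub>F t in at 0. norm (f t - f 0 - L (\<omega> t - u)) \<le> e * norm (\<omega> t - u)" if "e > 0" for e
  proof -
    obtain d where "d > 0" and d: "\<And>y. norm (y - u) < d \<Longrightarrow> norm (\<psi> y - \<psi> u - L (y - u)) \<le> e * norm (y - u)"
      using \<psi>' \<open>e > 0\<close> unfolding has_derivative_at_alt by blast
    have "\<forall>\<^sub>F t in at 0. dist (\<omega> t) u < d" by (rule tendstoD[OF \<omega>t \<open>d > 0\<close>])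
    with \<omega>W' show ?thesis
    proof eventually_elim
      case (elim t)
      then show ?case using d[of "\<omega> t"] f0 by (simp add: dist_norm)
    qed
  qed
  define q where "q t = (f t - f 0) /\<^sub>R t" for t
  define z where "z t = (\<omega> t - u) /\<^sub>R t" for t
  have q: "(q \<longlongrightarrow> f') (at 0)"
    unfolding q_def by (rule has_vector_derivative_quotient[THEN iffD1, OF f'])
  have zq: "\<forall>\<^sub>F t in at 0. norm (q t - L (z t)) \<le> e * norm (z t)" if "e > 0" for e
    using near[OF that]
  proof (eventually_elim)
    case (elim t)
    have "q t - L (z t) = (f t - f 0 - L (\<omega> t - u)) /\<^sub>R t"
      by (simp add: q_def z_def L.scaleR L.diff scaleR_diff_right)
    then show ?case
      using elim mult_left_mono[OF elim(1), of "inverse \<bar>t\<bar>"] by (simp add: z_def mult_ac)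
  qed
  have zb: "\<forall>\<^sub>F t in at 0. norm (z t) \<le> 2 / c * norm (q t)"
    using zq[OF half_gt_zero[OF c(1)]]
  proof eventually_elim
    case (elim t)
    have "c * norm (z t) \<le> norm (L (z t))" by (rule c(2))
    also have "\<dots> \<le> norm (q t) + norm (q t - L (z t))"
      using norm_triangle_ineq4[of "q t" "q t - L (z t)"] by simp
    also have "\<dots> \<le> norm (q t) + c * norm (z t) / 2" using elim by simp
    finally show ?case using c(1) by (simp add: field_simps)
  qed
  have Lz: "((\<lambda>t. L (z t)) \<longlongrightarrow> f') (at 0)"
  proof -
    have "((\<lambda>t. q t - L (z t)) \<longlongrightarrow> 0) (at 0)"
    proof (rule tendstoI)
      fix e :: real assume "e > 0"
      define M where "M = norm f' + 1"
      have M: "M > 0" by (simp add: M_def add_nonneg_pos)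
      have "\<forall>\<^sub>F t in at 0. norm (q t) < M"
        using order_tendstoD(2)[OF tendsto_norm[OF q], of M] by (simp add: M_def)
      moreover have "e * c / (4 * M) > 0" using \<open>e > 0\<close> c M by simp
      note zq[OF this]
      ultimately show "\<forall>\<^sub>F t in at 0. dist (q t - L (z t)) 0 < e"
        using zb
      proof eventually_elim
        case (elim t)
        have "norm (q t - L (z t)) \<le> e * c / (4 * M) * (2 / c * norm (q t))"
          by (rule order_trans[OF elim(2) mult_left_mono[OF elim(3)]]) (use \<open>e > 0\<close> c M in simp)
        also have "\<dots> \<le> e * c / (4 * M) * (2 / c * M)"
          using elim(1) \<open>e > 0\<close> c M by (intro mult_left_mono) auto
        also have "\<dots> = e / 2" using c M by simp
        finally show ?case using \<open>e > 0\<close> by simp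
      qed
    qed
    from tendsto_diff[OF q this] show ?thesis by simp
  qed
  \<comment> \<open>bounded difference quotients accumulate, so that the velocity lies in the range of \<open>L\<close>\<close>
  obtain a where a: "L a = f'"
  proof -
    define T where "T n = inverse (real (Suc n))" for n
    have T: "filterlim T (at 0) sequentially"
      unfolding filterlim_at T_def using LIMSEQ_inverse_real_of_nat by simp
    have "\<forall>\<^sub>F t in at 0. norm (z t) \<le> 2 / c * (norm f' + 1)"
      using zb order_tendstoD(2)[OF tendsto_norm[OF q] less_add_one]
    proof eventually_elim
      case (elim t)
      have "2 / c * norm (q t) \<le> 2 / c * (norm f' + 1)"
        using elim c(1) by (intro mult_left_mono) auto
      then show ?case using elim by simp
    qed
    then have "\<forall>\<^sub>F n in sequentially. norm (z (T n)) \<le> 2 / c * (norm f' + 1)"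
      by (rule eventually_compose_filterlim[OF _ T])
    then obtain N where N: "\<And>n. norm (z (T (n + N))) \<le> 2 / c * (norm f' + 1)"
      unfolding eventually_sequentially by (metis le_add2)
    have "bounded (range (\<lambda>n. z (T (n + N))))"
      unfolding bounded_iff using N by blast
    then obtain a r where r: "strict_mono r" "((\<lambda>n. z (T (n + N))) \<circ> r) \<longlonglongrightarrow> a"
      using bounded_imp_convergent_subsequence by blast
    have "filterlim (\<lambda>n. T (r n + N)) (at 0) sequentially"
      by (rule filterlim_compose[OF T]) (rule filterlim_compose[OF filterlim_add_const_nat_at_top filterlim_subseq[OF r(1)]])
    from filterlim_compose[OF Lz this] have "(\<lambda>n. L (z (T (r n + N)))) \<longlonglongrightarrow> f'" .
    moreover have "(\<lambda>n. L (z (T (r n + N)))) \<longlonglongrightarrow> L a"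
      using L.tendsto[OF r(2)] by (simp add: o_def)
    ultimately show thesis using that LIMSEQ_unique by blast
  qed
  have "(z \<longlongrightarrow> a) (at 0)"
  proof -
    have "((\<lambda>t. L (z t) - L a) \<longlongrightarrow> 0) (at 0)" using Lz a by (simp add: Lim_null[symmetric])
    then have "((\<lambda>t. norm (L (z t - a)) / c) \<longlongrightarrow> 0 / c) (at 0)"
      using c(1) by (intro tendsto_divide tendsto_const tendsto_norm_zero) (auto simp: L.diff)
    then have "((\<lambda>t. z t - a) \<longlongrightarrow> 0) (at 0)"
      by (intro Lim_null_comparison[of "\<lambda>t. z t - a" "\<lambda>t. norm (L (z t - a)) / c"])
        (use c in \<open>auto simp: pos_le_divide_eq mult.commute[of _ c]\<close>)
    then show ?thesis by (simp add: Lim_null[symmetric])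
  qed
  then have "(\<omega> has_vector_derivative a) (at 0)"
    unfolding z_def by (intro has_vector_derivative_quotient[THEN iffD2]) (simp add: \<omega>0)
  with \<omega>0 \<omega>W show thesis by (rule that) (use a in \<open>simp add: L_def\<close>)
qed

text \<open>The tangent space may be computed in any parametrization: lift a curve that is a straight line in
  another one.\<close>

lemma submanifold_tangent_param:
  fixes \<psi> :: "'k::euclidean_space \<Rightarrow> 'n::finite linf"
  assumes lp: "local_param F W \<psi>" and u: "u \<in> W"
    and V: "V \<in> submanifold_tangent TYPE('k) F (\<psi> u)"
  obtains b where "deriv_at \<psi> u b = V"
proof -
  obtain W' u' a and \<eta> :: "'k \<Rightarrow> 'n linf" where lp': "local_param F W' \<eta>" and u': "u' \<in> W'"
    and \<eta>: "\<eta> u' = \<psi> u" "V = deriv_at \<eta> u' a"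
    using V unfolding submanifold_tangent_def by blast
  have W': "open W'" and smooth: "smooth_on W' \<eta>" and sub: "\<eta> ` W' \<subseteq> F"
    using lp' unfolding local_param_def by (auto dest: openin_imp_subset)
  have d: "((\<lambda>t. \<eta> (u' + t *\<^sub>R a)) has_derivative (\<lambda>t. deriv_at \<eta> u' (t *\<^sub>R a))) (at 0)"
    by (rule has_derivative_compose[of "\<lambda>t. u' + t *\<^sub>R a" "\<lambda>t. t *\<^sub>R a" _ _ \<eta>])
      (use smooth_on_differentiable[OF W' smooth u'] in \<open>auto intro!: derivative_eq_intros\<close>)
  have d: "((\<lambda>t. \<eta> (u' + t *\<^sub>R a)) has_vector_derivative V) (at 0)"
    using d linear_cmul[OF has_derivative_linear[OF smooth_on_differentiable[OF W' smooth u']]]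
    by (simp add: has_vector_derivative_def \<eta>(2))
  have "((\<lambda>t. u' + t *\<^sub>R a) \<longlongrightarrow> u' + 0 *\<^sub>R a) (nhds 0)"
    by (intro tendsto_intros) (simp add: filterlim_ident)
  from topological_tendstoD[OF this W'] u' have "\<forall>\<^sub>F t in nhds 0. u' + t *\<^sub>R a \<in> W'" by simp
  then have "\<forall>\<^sub>F t in nhds 0. \<eta> (u' + t *\<^sub>R a) \<in> F"
    by eventually_elim (use sub in auto)
  then show thesis
    using local_param_lift[OF lp u _ _ d] \<eta>(1) that by (metis add.right_neutral scaleR_zero_left)
qed

section \<open>The Koszul formula in an integral metric\<close>

lemma has_derivative_along_field:
  fixes \<tau> :: "'k::euclidean_space \<Rightarrow> 'k"
  assumes D: "derivative_family U f D" and x: "x \<in> U" and \<tau>': "(\<tau> has_derivative \<tau>') (at x)"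
  shows "((\<lambda>y. D y [\<tau> y]) has_derivative (\<lambda>h. D x [h, \<tau> x] + D x [\<tau>' h])) (at x)"
proof -
  interpret derivative_family U f D by (rule D)
  have ex: "D y (ws @ [a]) = (\<Sum>e\<in>Basis. (a \<bullet> e) *\<^sub>R D y (ws @ [e]))" if "y \<in> U" for y a ws
  proof -
    have l: "linear (\<lambda>a. D y (ws @ [a]))"
      using D_linear[OF that, of ws "[]"] .
    have "D y (ws @ [a]) = D y (ws @ [(\<Sum>e\<in>Basis. (a \<bullet> e) *\<^sub>R e)])" by (simp add: euclidean_representation)
    then show ?thesis by (simp add: linear_sum[OF l] linear_cmul[OF l])
  qed
  have "((\<lambda>y. \<Sum>e\<in>Basis. (\<tau> y \<bullet> e) *\<^sub>R D y [e]) has_derivative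
      (\<lambda>h. \<Sum>e\<in>Basis. (\<tau> x \<bullet> e) *\<^sub>R D x [h, e] + (\<tau>' h \<bullet> e) *\<^sub>R D x [e])) (at x)"
    by (intro has_derivative_sum has_derivative_scaleR has_derivative_D x \<tau>'
        has_derivative_inner_left)
  also have "(\<lambda>h. \<Sum>e\<in>Basis. (\<tau> x \<bullet> e) *\<^sub>R D x [h, e] + (\<tau>' h \<bullet> e) *\<^sub>R D x [e]) =
      (\<lambda>h. D x [h, \<tau> x] + D x [\<tau>' h])"
  proof
    fix h
    have "D x [h, \<tau> x] = (\<Sum>e\<in>Basis. (\<tau> x \<bullet> e) *\<^sub>R D x [h, e])"
      "D x [\<tau>' h] = (\<Sum>e\<in>Basis. (\<tau>' h \<bullet> e) *\<^sub>R D x [e])"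
      using ex[OF x, of "[h]" "\<tau> x"] ex[OF x, of "[]" "\<tau>' h"] by simp_all
    then show "(\<Sum>e\<in>Basis. (\<tau> x \<bullet> e) *\<^sub>R D x [h, e] + (\<tau>' h \<bullet> e) *\<^sub>R D x [e]) =
        D x [h, \<tau> x] + D x [\<tau>' h]" by (simp only: sum.distrib)
  qed
  finally show ?thesis
  proof (rule has_derivative_transform_within_open[OF _ open_domain x])
    show "(\<Sum>e\<in>Basis. (\<tau> y \<bullet> e) *\<^sub>R D y [e]) = D y [\<tau> y]" if "y \<in> U" for y
      using ex[OF that, of "[]" "\<tau> y"] by simp
  qed
qed

lemma has_derivative_linf_int3:
  assumes "(X has_derivative X') (at x)" "(Y has_derivative Y') (at x)" "(Z has_derivative Z') (at x)"
  shows "((\<lambda>w. linf_int (X w * Y w * Z w)) has_derivative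
    (\<lambda>h. linf_int (X' h * Y x * Z x) + linf_int (X x * Y' h * Z x) + linf_int (X x * Y x * Z' h))) (at x)"
proof -
  interpret I: bounded_linear linf_int by (rule bounded_linear_linf_int)
  from I.has_derivative[OF linf_mult.FDERIV[OF linf_mult.FDERIV[OF assms(1,2)] assms(3)]] show ?thesis
    by (rule has_derivative_eq_rhs) (simp add: fun_eq_iff I.add linf_mult.add_left)
qed

text \<open>Compatibility with the metric is used for \<open>(\<tau>, \<tau>)\<close> in the direction \<open>b\<close> and for \<open>(\<tau>, b)\<close> in the
  direction \<open>\<tau>\<close>, where \<open>b\<close> also stands for the constant field in the parameter domain.  The second
  derivatives of \<open>\<psi>\<close> cancel by symmetry, so the result only involves vectors of the ambient space.\<close>

lemma Koszul_integral_metric: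
  fixes \<psi> :: "'k::euclidean_space \<Rightarrow> 'n::finite linf" and m :: real
  assumes W: "open W" and smooth: "smooth_on W \<psi>" and u: "u \<in> W"
    and G: "\<And>w X Y. w \<in> W \<Longrightarrow> sform_app (G (\<psi> w)) X Y = m * linf_int (X * Y * \<rho> (\<psi> w))"
    and \<rho>': "(\<rho> has_derivative \<rho>') (at (\<psi> u))"
    and lc: "levi_civita W (pullback_metric G \<psi>) nabla" and \<tau>: "smooth_on W \<tau>"
    and X': "((\<lambda>w. deriv_at \<psi> w (\<tau> w)) has_derivative X') (at u)"
    and T: "deriv_at \<psi> u (\<tau> u) = T" and V: "deriv_at \<psi> u b = V"
  shows "sform_app (G (\<psi> u)) (deriv_at \<psi> u (nabla \<tau> u (\<tau> u))) V =
    m * (linf_int (X' (\<tau> u) * V * \<rho> (\<psi> u)) + linf_int (T * V * \<rho>' T) - linf_int (T * T * \<rho>' V) / 2)"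
proof -
  obtain D where D: "derivative_family W \<psi> D"
    by (rule smooth_on_derivative_family[OF W smooth])
  interpret derivative_family W \<psi> D by (rule D)
  interpret I: bounded_linear linf_int by (rule bounded_linear_linf_int)
  define h where "h = pullback_metric G \<psi>"
  have h: "h w a c = m * linf_int (D w [a] * D w [c] * \<rho> (\<psi> w))" if "w \<in> W" for w a c
    using that by (simp add: h_def pullback_metric_def G deriv_at_f)
  define r where "r = \<rho> (\<psi> u)"
  have T': "D u [\<tau> u] = T" and V': "D u [b] = V" using T V by (simp_all add: deriv_at_f[OF u])
  have \<tau>d: "(\<tau> has_derivative deriv_at \<tau> u) (at u)"
    by (rule smooth_on_differentiable[OF W \<tau> u])
  have Xd: "((\<lambda>w. D w [\<tau> w]) has_derivative X') (at u)"
    by (rule has_derivative_transform_within_open[OF X' W u]) (simp add: deriv_at_f)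
  have X'_eq: "X' c = D u [c, \<tau> u] + D u [deriv_at \<tau> u c]" for c
    using has_derivative_unique[OF Xd has_derivative_along_field[OF D u \<tau>d]] by (simp add: fun_eq_iff)
  have rd: "((\<lambda>w. \<rho> (\<psi> w)) has_derivative (\<lambda>c. \<rho>' (D u [c]))) (at u)"
    by (rule has_derivative_compose[OF has_derivative_f[OF u] \<rho>'])
  have d1: "deriv_at (\<lambda>w. h w (\<tau> w) (\<tau> w)) u b =
      m * (2 * linf_int (X' b * T * r) + linf_int (T * T * \<rho>' V))"
  proof -
    have "((\<lambda>w. m * linf_int (D w [\<tau> w] * D w [\<tau> w] * \<rho> (\<psi> w))) has_derivative
      (\<lambda>c. m * (linf_int (X' c * D u [\<tau> u] * \<rho> (\<psi> u)) + linf_int (D u [\<tau> u] * X' c * \<rho> (\<psi> u))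
         + linf_int (D u [\<tau> u] * D u [\<tau> u] * \<rho>' (D u [c]))))) (at u)"
      by (intro has_derivative_mult_right has_derivative_linf_int3 Xd rd)
    then have "((\<lambda>w. h w (\<tau> w) (\<tau> w)) has_derivative
      (\<lambda>c. m * (linf_int (X' c * D u [\<tau> u] * \<rho> (\<psi> u)) + linf_int (D u [\<tau> u] * X' c * \<rho> (\<psi> u))
         + linf_int (D u [\<tau> u] * D u [\<tau> u] * \<rho>' (D u [c]))))) (at u)"
      by (rule has_derivative_transform_within_open[OF _ W u]) (simp add: h)
    from frechet_derivative_at[OF this, symmetric] show ?thesis
      by (simp add: T' V' r_def mult.commute[of T "X' b"])
  qed
  have d2: "deriv_at (\<lambda>w. h w (\<tau> w) b) u (\<tau> u) =
      m * (linf_int (X' (\<tau> u) * V * r) + linf_int (T * D u [\<tau> u, b] * r) + linf_int (T * V * \<rho>' T))"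
  proof -
    have "((\<lambda>w. m * linf_int (D w [\<tau> w] * D w [b] * \<rho> (\<psi> w))) has_derivative
      (\<lambda>c. m * (linf_int (X' c * D u [b] * \<rho> (\<psi> u)) + linf_int (D u [\<tau> u] * D u [c, b] * \<rho> (\<psi> u))
         + linf_int (D u [\<tau> u] * D u [b] * \<rho>' (D u [c]))))) (at u)"
      by (intro has_derivative_mult_right has_derivative_linf_int3 Xd rd has_derivative_D u)
    then have "((\<lambda>w. h w (\<tau> w) b) has_derivative
      (\<lambda>c. m * (linf_int (X' c * D u [b] * \<rho> (\<psi> u)) + linf_int (D u [\<tau> u] * D u [c, b] * \<rho> (\<psi> u))
         + linf_int (D u [\<tau> u] * D u [b] * \<rho>' (D u [c]))))) (at u)"
      by (rule has_derivative_transform_within_open[OF _ W u]) (simp add: h)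
    from frechet_derivative_at[OF this, symmetric] show ?thesis
      by (simp add: T' V' r_def)
  qed
  have torsion: "\<And>X Y. smooth_on W X \<Longrightarrow> smooth_on W Y \<Longrightarrow>
      nabla Y u (X u) - nabla X u (Y u) = deriv_at Y u (X u) - deriv_at X u (Y u)"
    and compat: "\<And>Y Z a. smooth_on W Y \<Longrightarrow> smooth_on W Z \<Longrightarrow>
      deriv_at (\<lambda>w. h w (Y w) (Z w)) u a = h u (nabla Y u a) (Z u) + h u (Y u) (nabla Z u a)"
    using lc u unfolding levi_civita_def h_def by simp_all
  have hsym: "h u a c = h u c a" for a c
    unfolding h[OF u] by (simp only: mult.commute[of "D u [a]" "D u [c]"])
  have lD: "linear (\<lambda>a. D u [a])" using D_linear[OF u, of "[]" "[]"] by simp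
  have hdiff: "h u a (c - e) = h u a c - h u a e" for a c e
    by (simp add: h[OF u] linear_diff[OF lD] linf_mult.diff_left linf_mult.diff_right I.diff right_diff_distrib)
  have e1: "2 * h u (\<tau> u) (nabla \<tau> u b) = m * (2 * linf_int (X' b * T * r) + linf_int (T * T * \<rho>' V))"
    using compat[OF \<tau> \<tau>, of b] d1 hsym[of "nabla \<tau> u b"] by simp
  have "nabla (\<lambda>_. b) u (\<tau> u) - nabla \<tau> u b = - deriv_at \<tau> u b"
    using torsion[OF \<tau> smooth_on_const[of W b]] frechet_derivative_const[of b u] by (simp add: fun_eq_iff)
  then have e2: "nabla (\<lambda>_. b) u (\<tau> u) = nabla \<tau> u b - deriv_at \<tau> u b" by (simp add: algebra_simps)
  have e3: "h u (nabla \<tau> u (\<tau> u)) b + h u (\<tau> u) (nabla (\<lambda>_. b) u (\<tau> u)) =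
      m * (linf_int (X' (\<tau> u) * V * r) + linf_int (T * D u [\<tau> u, b] * r) + linf_int (T * V * \<rho>' T))"
    using compat[OF \<tau> smooth_on_const[of W b], of "\<tau> u"] d2 by simp
  have e4: "h u (\<tau> u) (deriv_at \<tau> u b) = m * linf_int (T * D u [deriv_at \<tau> u b] * r)"
    by (simp add: h[OF u] T' r_def)
  have e5: "linf_int (X' b * T * r) = linf_int (T * D u [\<tau> u, b] * r) + linf_int (T * D u [deriv_at \<tau> u b] * r)"
    unfolding X'_eq D_symmetric[OF u, of b] by (simp add: distrib_right I.add mult.commute[of T "D u _"])
  have "h u (nabla \<tau> u (\<tau> u)) b =
    m * (linf_int (X' (\<tau> u) * V * r) + linf_int (T * V * \<rho>' T) - linf_int (T * T * \<rho>' V) / 2)"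
    using e1 e3 e4 e5 unfolding e2 hdiff by (simp add: algebra_simps)
  then show ?thesis
    by (simp add: h_def pullback_metric_def V r_def)
qed

section \<open>The embedding defined by an eikonal family\<close>

locale eikonal_embedding = eikonal_family \<Omega> f \<gamma> w R
  for \<Omega> :: "(real^'n::{finite,wellorder}) set" and f \<gamma> w R +
  fixes \<Psi> :: "real^'n::_ \<Rightarrow> 'n linf"
  assumes represents: "u \<in> \<Omega> \<Longrightarrow> AE s in sphere_measure. linf_rep (\<Psi> u) s = f u s"
begin

definition d\<Psi> :: "real^'n::_ \<Rightarrow> real^'n::_ \<Rightarrow> 'n linf" where
  "d\<Psi> u b = linf_class (\<lambda>s. partial1 f u s b)"

lemma rep_d\<Psi>: "u \<in> \<Omega> \<Longrightarrow> AE s in sphere_measure. linf_rep (d\<Psi> u b) s = partial1 f u s b"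
  unfolding d\<Psi>_def by (intro linf_class_continuous continuous_on_partial)

lemma linear_d\<Psi>:
  assumes u: "u \<in> \<Omega>" shows "linear (d\<Psi> u)"
proof (rule linearI; rule linf_eqI)
  fix b c :: "real^'n::_" and r :: real
  show "AE s in sphere_measure. linf_rep (d\<Psi> u (b + c)) s = linf_rep (d\<Psi> u b + d\<Psi> u c) s"
    using rep_d\<Psi>[OF u, of "b + c"] rep_d\<Psi>[OF u, of b] rep_d\<Psi>[OF u, of c]
      linf_rep_add[of "d\<Psi> u b" "d\<Psi> u c"] AE_sphere
    by eventually_elim (simp add: linear_add[OF linear_partial(1)[OF u]])
  show "AE s in sphere_measure. linf_rep (d\<Psi> u (r *\<^sub>R b)) s = linf_rep (r *\<^sub>R d\<Psi> u b) s"
    using rep_d\<Psi>[OF u, of "r *\<^sub>R b"] rep_d\<Psi>[OF u, of b] linf_rep_scaleR[of r "d\<Psi> u b"] AE_sphere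
    by eventually_elim (simp add: linear_cmul[OF linear_partial(1)[OF u]])
qed

lemma partial2_bounded:
  assumes "u \<in> \<Omega>"
  obtains r C where "r > 0" "C \<ge> 0" "ball u r \<subseteq> \<Omega>"
    "\<forall>u'\<in>ball u r. \<forall>s\<in>sphere 0 1. \<forall>a b. \<bar>partial2 f u' s a b\<bar> \<le> C * norm a * norm b"
proof (rule partials_uniformly_bounded[OF assms])
  fix r C assume "r > 0" "C \<ge> 0" "ball u r \<subseteq> \<Omega>"
    "\<And>u' s a b. u' \<in> ball u r \<Longrightarrow> s \<in> sphere 0 1 \<Longrightarrow> \<bar>partial2 f u' s a b\<bar> \<le> C * norm a * norm b"
  then show thesis by (intro that[of r C] ballI allI)
qed

lemma partial1_Lipschitz:
  assumes r: "ball u r \<subseteq> \<Omega>" and u': "u' \<in> ball u r" and s: "s \<in> sphere 0 1"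
    and Q: "\<And>u' s a b. u' \<in> ball u r \<Longrightarrow> s \<in> sphere 0 1 \<Longrightarrow> \<bar>partial2 f u' s a b\<bar> \<le> C * norm a * norm b"
  shows "\<bar>partial1 f u' s b - partial1 f u s b\<bar> \<le> C * norm b * norm (u' - u)"
proof -
  have "0 < r" using u' by (metis ball_eq_empty empty_iff not_le)
  have "norm (partial1 f u' s b - partial1 f u s b) \<le> C * norm b * norm (u' - u)"
  proof (rule differentiable_bound[where S = "ball u r" and f' = "\<lambda>x a. partial2 f x s a b"])
    show "((\<lambda>u. partial1 f u s b) has_derivative (\<lambda>a. partial2 f x s a b)) (at x within ball u r)"
      if "x \<in> ball u r" for x
      by (rule has_derivative_at_withinI, rule has_derivative_family(2)) (use that r s in auto)
    show "onorm (\<lambda>a. partial2 f x s a b) \<le> C * norm b" if "x \<in> ball u r" for x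
    proof (rule onorm_le)
      fix a
      show "norm (partial2 f x s a b) \<le> C * norm b * norm a"
        using Q[OF that s, where a = a and b = b] by (simp add: mult_ac)
    qed
  qed (use u' \<open>0 < r\<close> in auto)
  then show ?thesis by simp
qed

text \<open>The Taylor remainders of the functions \<open>f u s\<close> are bounded uniformly in \<open>s\<close>; this makes the
  embedding differentiable in the supremum norm.\<close>

lemma has_derivative_\<Psi>:
  assumes u: "u \<in> \<Omega>" shows "(\<Psi> has_derivative d\<Psi> u) (at u)"
proof -
  obtain r C where rC: "r > 0" "C \<ge> 0" "ball u r \<subseteq> \<Omega>"
    and Q': "\<forall>u'\<in>ball u r. \<forall>s\<in>sphere 0 1. \<forall>a b. \<bar>partial2 f u' s a b\<bar> \<le> C * norm a * norm b"
    by (rule partial2_bounded[OF u])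
  note Q = Q'[rule_format]
  have est: "norm (\<Psi> y - \<Psi> u - d\<Psi> u (y - u)) \<le> C * norm (y - u) * norm (y - u)" if y: "norm (y - u) < r" for y
  proof (rule norm_linf_le)
    have yb: "y \<in> ball u r" using y by (simp add: dist_norm norm_minus_commute)
    have pt: "\<bar>f y s - f u s - partial1 f u s (y - u)\<bar> \<le> C * norm (y - u) * norm (y - u)" if s: "s \<in> sphere 0 1" for s
    proof -
      let ?S = "ball u r \<inter> cball u (norm (y - u))"
      have "norm (f y s - f u s - partial1 f u s (y - u)) \<le> norm (y - u) * (C * norm (y - u))"
      proof (rule differentiable_bound_linearization[where S = ?S and f' = "\<lambda>x. partial1 f x s"])
        show "u + t *\<^sub>R (y - u) \<in> ?S" if "t \<in> {0..1}" for t
        proof -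
          have "t * norm (y - u) \<le> norm (y - u)" using that by (intro mult_left_le_one_le) auto
          then show ?thesis using that y by (auto simp: dist_norm)
        qed
        show "((\<lambda>u. f u s) has_derivative partial1 f x s) (at x within ?S)" if "x \<in> ?S" for x
          by (rule has_derivative_at_withinI, rule has_derivative_family(1)) (use that rC(3) s in auto)
        show "onorm (partial1 f x s - partial1 f u s) \<le> C * norm (y - u)" if "x \<in> ?S" for x
        proof (rule onorm_le)
          fix b
          have "\<bar>partial1 f x s b - partial1 f u s b\<bar> \<le> C * norm b * norm (x - u)"
            by (rule partial1_Lipschitz[OF rC(3) _ s Q]) (use that in auto)
          also have "\<dots> \<le> C * norm b * norm (y - u)"
            using that rC(2) by (intro mult_left_mono) (auto simp: dist_norm norm_minus_commute)
          finally show "norm ((partial1 f x s - partial1 f u s) b) \<le> C * norm (y - u) * norm b"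
            by (simp add: mult_ac)
        qed
      qed (use rC in auto)
      then show ?thesis by (simp add: mult_ac)
    qed
    show "AE s in sphere_measure. \<bar>linf_rep (\<Psi> y - \<Psi> u - d\<Psi> u (y - u)) s\<bar> \<le> C * norm (y - u) * norm (y - u)"
      using represents[OF u] represents[OF subsetD[OF rC(3) yb]] rep_d\<Psi>[OF u, of "y - u"]
        linf_rep_diff[of "\<Psi> y - \<Psi> u" "d\<Psi> u (y - u)"] linf_rep_diff[of "\<Psi> y" "\<Psi> u"] AE_sphere
      by eventually_elim (use pt in simp)
  qed (use rC(2) in simp)
  show ?thesis
    unfolding has_derivative_at_alt
  proof (intro conjI allI impI)
    show "bounded_linear (d\<Psi> u)" using linear_d\<Psi>[OF u] by (simp add: linear_conv_bounded_linear)
    fix e :: real assume e: "0 < e"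
    show "\<exists>d>0. \<forall>y. norm (y - u) < d \<longrightarrow> norm (\<Psi> y - \<Psi> u - d\<Psi> u (y - u)) \<le> e * norm (y - u)"
    proof (intro exI[of _ "min r (e / (C + 1))"] conjI allI impI)
      show "0 < min r (e / (C + 1))" using e rC by simp
      fix y assume y: "norm (y - u) < min r (e / (C + 1))"
      have "C * norm (y - u) \<le> (C + 1) * norm (y - u)" by (intro mult_right_mono) auto
      also have "\<dots> \<le> e" using y rC(2) by (simp add: pos_less_divide_eq mult.commute)
      finally have "C * norm (y - u) * norm (y - u) \<le> e * norm (y - u)" by (intro mult_right_mono) auto
      then show "norm (\<Psi> y - \<Psi> u - d\<Psi> u (y - u)) \<le> e * norm (y - u)"
        using est[of y] y by simp
    qed
  qed
qed

lemma d\<Psi>_Lipschitz: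
  assumes u: "u \<in> \<Omega>"
  obtains r C where "r > 0" "C \<ge> 0" "ball u r \<subseteq> \<Omega>"
    "\<forall>u'\<in>ball u r. \<forall>b. norm (d\<Psi> u' b - d\<Psi> u b) \<le> C * norm b * norm (u' - u)"
proof -
  obtain r C where rC: "r > 0" "C \<ge> 0" "ball u r \<subseteq> \<Omega>"
    and Q': "\<forall>u'\<in>ball u r. \<forall>s\<in>sphere 0 1. \<forall>a b. \<bar>partial2 f u' s a b\<bar> \<le> C * norm a * norm b"
    by (rule partial2_bounded[OF u])
  note Q = Q'[rule_format]
  have "norm (d\<Psi> u' b - d\<Psi> u b) \<le> C * norm b * norm (u' - u)" if u': "u' \<in> ball u r" for u' b
  proof (rule norm_linf_le)
    show "AE s in sphere_measure. \<bar>linf_rep (d\<Psi> u' b - d\<Psi> u b) s\<bar> \<le> C * norm b * norm (u' - u)"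
      using rep_d\<Psi>[OF u, of b] rep_d\<Psi>[OF subsetD[OF rC(3) u'], of b] linf_rep_diff[of "d\<Psi> u' b" "d\<Psi> u b"] AE_sphere
      by eventually_elim (use partial1_Lipschitz[OF rC(3) u' _ Q] in simp)
  qed (use rC(2) in simp)
  with rC show thesis by (intro that) auto
qed

text \<open>The factor \<open>n\<close> compensates for the second moment of the sphere.\<close>

lemma d\<Psi>_isometry:
  assumes u: "u \<in> \<Omega>"
  shows "real CARD('n) * linf_int (d\<Psi> u b * d\<Psi> u c * R u) = \<gamma> u b c"
proof -
  have "linf_int (d\<Psi> u b * d\<Psi> u c * R u) = pairing (\<lambda>s. partial1 f u s b) (d\<Psi> u c * R u)"
    unfolding mult.assoc d\<Psi>_def by (intro linf_int_class continuous_on_partial u)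
  also have "\<dots> = pairing (\<lambda>s. partial1 f u s b * partial1 f u s c) (R u)"
    unfolding d\<Psi>_def by (intro pairing_mult_class continuous_on_partial u)
  finally show ?thesis by (simp add: pairing_partial_partial[OF u])
qed

lemma inj_d\<Psi>:
  assumes u: "u \<in> \<Omega>" shows "inj (d\<Psi> u)"
  unfolding linear_injective_0[OF linear_d\<Psi>[OF u]]
proof (intro allI impI)
  fix b assume "d\<Psi> u b = 0"
  then have "\<gamma> u b b = 0"
    using d\<Psi>_isometry[OF u, of b b] by (simp add: linear_0[OF bounded_linear.linear[OF bounded_linear_linf_int]])
  then show "b = 0" using positive_form.pos_B[OF positive_\<gamma>[OF u], of b] by force
qed

lemma d\<Psi>_bounded_below:
  assumes u: "u \<in> \<Omega>"
  obtains r c where "r > 0" "c > 0" "ball u r \<subseteq> \<Omega>" "\<forall>u'\<in>ball u r. \<forall>b. c * norm b \<le> norm (d\<Psi> u' b)"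
proof -
  obtain c where c: "0 < c" "\<And>b. c * norm b \<le> norm (d\<Psi> u b)"
    using linear_injective_bounded_below[OF linear_d\<Psi>[OF u] inj_d\<Psi>[OF u]] by blast
  obtain r C where rC: "r > 0" "C \<ge> 0" "ball u r \<subseteq> \<Omega>"
    and lip: "\<forall>u'\<in>ball u r. \<forall>b. norm (d\<Psi> u' b - d\<Psi> u b) \<le> C * norm b * norm (u' - u)"
    by (rule d\<Psi>_Lipschitz[OF u])
  define r' where "r' = min r (c / (2 * (C + 1)))"
  have "c / 2 * norm b \<le> norm (d\<Psi> u' b)" if u': "u' \<in> ball u r'" for u' b
  proof -
    have n: "norm (u' - u) < r" "norm (u' - u) < c / (2 * (C + 1))"
      using u' by (auto simp: r'_def dist_norm norm_minus_commute)
    then have "u' \<in> ball u r" by (simp add: dist_norm norm_minus_commute)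
    with lip have "norm (d\<Psi> u' b - d\<Psi> u b) \<le> C * norm b * norm (u' - u)" by blast
    also have "\<dots> \<le> (C + 1) * norm b * (c / (2 * (C + 1)))"
      using n rC(2) by (intro mult_mono) auto
    also have "\<dots> = c / 2 * norm b" using rC(2) by (simp add: field_simps)
    finally have "norm (d\<Psi> u' b - d\<Psi> u b) \<le> c / 2 * norm b" .
    moreover have "norm (d\<Psi> u b) \<le> norm (d\<Psi> u' b) + norm (d\<Psi> u' b - d\<Psi> u b)"
      using norm_triangle_ineq4[of "d\<Psi> u' b" "d\<Psi> u' b - d\<Psi> u b"] by simp
    ultimately show ?thesis using c(2)[of b] by simp
  qed
  moreover have "ball u r' \<subseteq> \<Omega>" using rC(3) by (auto simp: r'_def)
  moreover have "r' > 0" using rC c by (simp add: r'_def)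
  ultimately show thesis using c(1) by (intro that[of r' "c / 2"]) auto
qed

text \<open>The normal component of the acceleration of a tangential field along a coordinate line.  Only
  continuity of the coordinates \<open>\<xi>\<close> of the field is needed: against a vector \<open>Z\<close> that annihilates the
  tangent space at the base point, the variation of \<open>\<xi>\<close> does not contribute to first order.\<close>

lemma normal_acceleration:
  assumes u: "u \<in> \<Omega>" and y': "(y has_vector_derivative y') (at 0)" and y0: "y 0 = d\<Psi> u v"
    and tang: "\<forall>\<^sub>F t in at 0. y t \<in> range (d\<Psi> (u + t *\<^sub>R v))"
    and Z: "\<And>b. linf_int (d\<Psi> u b * Z) = 0"
  shows "linf_int (y' * Z) = linf_int (linf_class (\<lambda>s. partial2 f u s v v) * Z)"
proof -
  interpret I: bounded_linear linf_int by (rule bounded_linear_linf_int)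
  obtain r c where rc: "r > 0" "c > 0" "ball u r \<subseteq> \<Omega>"
    and low: "\<forall>u'\<in>ball u r. \<forall>b. c * norm b \<le> norm (d\<Psi> u' b)"
    by (rule d\<Psi>_bounded_below[OF u])
  obtain r1 C where r1: "r1 > 0" "C \<ge> 0" "ball u r1 \<subseteq> \<Omega>"
    and lip: "\<forall>u'\<in>ball u r1. \<forall>b. norm (d\<Psi> u' b - d\<Psi> u b) \<le> C * norm b * norm (u' - u)"
    by (rule d\<Psi>_Lipschitz[OF u])
  have line: "((\<lambda>t. u + t *\<^sub>R v) \<longlongrightarrow> u) (at 0)"
    by (rule tendsto_eq_intros refl tendsto_ident_at)+ simp
  have near: "\<forall>\<^sub>F t in at 0. u + t *\<^sub>R v \<in> ball u e" if "e > 0" for e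
    using tendstoD[OF line that] by eventually_elim (simp add: dist_commute)
  define \<xi> where "\<xi> t = (SOME b. y t = d\<Psi> (u + t *\<^sub>R v) b)" for t
  have \<xi>: "\<forall>\<^sub>F t in at 0. y t = d\<Psi> (u + t *\<^sub>R v) (\<xi> t)"
    using tang by eventually_elim (auto simp: \<xi>_def intro: someI)
  have yt: "(y \<longlongrightarrow> y 0) (at 0)"
    using has_vector_derivative_continuous[OF y'] by (simp add: isCont_def)
  have "((\<lambda>t. \<xi> t - v) \<longlongrightarrow> 0) (at 0)"
  proof (rule Lim_null_comparison)
    show "\<forall>\<^sub>F t in at 0. norm (\<xi> t - v) \<le> (norm (y t - y 0) + C * norm v * norm (t *\<^sub>R v)) / c"
      using near[OF rc(1)] near[OF r1(1)] \<xi>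
    proof eventually_elim
      case (elim t)
      have \<Omega>: "u + t *\<^sub>R v \<in> \<Omega>" using elim(1) rc(3) by blast
      have "c * norm (\<xi> t - v) \<le> norm (d\<Psi> (u + t *\<^sub>R v) (\<xi> t - v))" using low elim(1) by blast
      also have "d\<Psi> (u + t *\<^sub>R v) (\<xi> t - v) = (y t - y 0) - (d\<Psi> (u + t *\<^sub>R v) v - d\<Psi> u v)"
        using elim(3) by (simp add: linear_diff[OF linear_d\<Psi>[OF \<Omega>]] y0)
      also have "norm \<dots> \<le> norm (y t - y 0) + norm (d\<Psi> (u + t *\<^sub>R v) v - d\<Psi> u v)"
        by (rule norm_triangle_ineq4)
      also have "norm (d\<Psi> (u + t *\<^sub>R v) v - d\<Psi> u v) \<le> C * norm v * norm (u + t *\<^sub>R v - u)"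
        using lip elim(2) by blast
      finally show ?case using rc(2) by (simp add: pos_le_divide_eq mult.commute)
    qed
    have "((\<lambda>t. (norm (y t - y 0) + C * norm v * norm (t *\<^sub>R v)) / c) \<longlongrightarrow>
        (norm (y 0 - y 0) + C * norm v * norm (0 *\<^sub>R v)) / c) (at 0)"
      using rc(2) by (intro tendsto_intros yt) auto
    then show "((\<lambda>t. (norm (y t - y 0) + C * norm v * norm (t *\<^sub>R v)) / c) \<longlongrightarrow> 0) (at 0)" by simp
  qed
  then have \<xi>t: "(\<xi> \<longlongrightarrow> v) (at 0)" by (simp add: Lim_null[symmetric])
  \<comment> \<open>\<open>m b 0 = 0\<close>, so \<open>m b t / t\<close> converges to the derivative of \<open>m b\<close>\<close>
  define m where "m b t = pairing (\<lambda>s. partial1 f (u + t *\<^sub>R v) s b) Z" for b t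
  have m_eq: "linf_int (d\<Psi> (u + t *\<^sub>R v) b * Z) = m b t" if "u + t *\<^sub>R v \<in> \<Omega>" for b t
    unfolding m_def d\<Psi>_def by (intro linf_int_class continuous_on_partial that)
  have m0: "m b 0 = 0" for b using m_eq[of 0 b] Z u by simp
  have m': "((\<lambda>t. m b t / t) \<longlongrightarrow> pairing (\<lambda>s. partial2 f u s v b) Z) (at 0)" for b
  proof -
    obtain r C where rC: "r > 0" "C \<ge> 0" "ball u r \<subseteq> \<Omega>"
      and Q': "\<forall>u'\<in>ball u r. \<forall>s\<in>sphere 0 1. \<forall>a b. \<bar>partial2 f u' s a b\<bar> \<le> C * norm a * norm b"
      by (rule partial2_bounded[OF u])
    note Q = Q'[rule_format]
    obtain d where d: "d > 0" "\<And>t. \<bar>t\<bar> < d \<Longrightarrow> u + t *\<^sub>R v \<in> ball u r"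
    proof -
      have "\<forall>\<^sub>F t in nhds 0. u + t *\<^sub>R v \<in> ball u r"
        using near[OF rC(1)] rC(1) by (simp add: eventually_nhds_conv_at)
      then show thesis
        unfolding eventually_nhds_metric using that by (auto simp: dist_real_def)
    qed
    have "((\<lambda>t. pairing (\<lambda>s. partial1 f (u + t *\<^sub>R v) s b) Z) has_real_derivative
        pairing (\<lambda>s. partial2 f (u + 0 *\<^sub>R v) s v b) Z + pairing (\<lambda>s. partial1 f (u + 0 *\<^sub>R v) s b) 0) (at 0)"
    proof (rule has_derivative_pairing_bounded[OF d(1), where f' = "\<lambda>t s. partial2 f (u + t *\<^sub>R v) s v b" and R = "\<lambda>_. Z"])
      fix t s assume t: "\<bar>t\<bar> < d" and s: "s \<in> sphere (0::real^'n::_) 1"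
      have \<Omega>: "u + t *\<^sub>R v \<in> \<Omega>" using d(2)[OF t] rC(3) by blast
      show "((\<lambda>t. partial1 f (u + t *\<^sub>R v) s b) has_real_derivative partial2 f (u + t *\<^sub>R v) s v b) (at t)"
        by (rule partial_along_line[OF \<Omega> s])
      show "\<bar>partial2 f (u + t *\<^sub>R v) s v b\<bar> \<le> C * norm v * norm b" by (rule Q[OF d(2)[OF t] s])
    next
      fix t assume t: "\<bar>t\<bar> < d"
      have "u + t *\<^sub>R v \<in> \<Omega>" using d(2)[OF t] rC(3) by blast
      then show "continuous_on (sphere 0 1) (\<lambda>s. partial1 f (u + t *\<^sub>R v) s b)" by (rule continuous_on_partial)
    qed (use u in \<open>auto intro!: continuous_on_partial\<close>)
    moreover have "pairing (\<lambda>s. partial1 f (u + 0 *\<^sub>R v) s b) 0 = 0"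
      using u by (intro linear_0[OF bounded_linear.linear[OF bounded_linear_pairing]] continuous_on_partial) simp
    ultimately have "(m b has_real_derivative pairing (\<lambda>s. partial2 f u s v b) Z) (at 0)"
      by (simp add: m_def[abs_def])
    then show ?thesis by (simp add: has_field_derivative_iff m0)
  qed
  have "((\<lambda>t. linf_int (y t * Z) / t) \<longlongrightarrow> linf_int (y' * Z)) (at 0)"
  proof -
    have "((\<lambda>t. linf_int ((y t - y 0) /\<^sub>R t * Z)) \<longlongrightarrow> linf_int (y' * Z)) (at 0)"
      by (intro I.tendsto linf_mult.tendsto has_vector_derivative_quotient[THEN iffD1, OF y'] tendsto_const)
    moreover have "linf_int ((y t - y 0) /\<^sub>R t * Z) = linf_int (y t * Z) / t" for t
      by (simp only: linf_mult.scaleR_left linf_mult.diff_left I.scaleR I.diff y0 Z diff_zero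
          real_scaleR_def divide_inverse_commute)
    ultimately show ?thesis by simp
  qed
  moreover have "((\<lambda>t. linf_int (y t * Z) / t) \<longlongrightarrow> (\<Sum>e\<in>Basis. (v \<bullet> e) * pairing (\<lambda>s. partial2 f u s v e) Z)) (at 0)"
  proof (rule Lim_transform_eventually)
    show "((\<lambda>t. \<Sum>e\<in>Basis. (\<xi> t \<bullet> e) * (m e t / t)) \<longlongrightarrow> (\<Sum>e\<in>Basis. (v \<bullet> e) * pairing (\<lambda>s. partial2 f u s v e) Z)) (at 0)"
      by (intro tendsto_sum tendsto_mult tendsto_inner \<xi>t tendsto_const m')
    show "\<forall>\<^sub>F t in at 0. (\<Sum>e\<in>Basis. (\<xi> t \<bullet> e) * (m e t / t)) = linf_int (y t * Z) / t"
      using near[OF rc(1)] \<xi>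
    proof eventually_elim
      case (elim t)
      have \<Omega>: "u + t *\<^sub>R v \<in> \<Omega>" using elim(1) rc(3) by blast
      have "d\<Psi> (u + t *\<^sub>R v) (\<xi> t) = d\<Psi> (u + t *\<^sub>R v) (\<Sum>e\<in>Basis. (\<xi> t \<bullet> e) *\<^sub>R e)"
        by (simp add: euclidean_representation)
      then have "linf_int (y t * Z) = (\<Sum>e\<in>Basis. (\<xi> t \<bullet> e) * m e t)"
        unfolding elim(2) m_eq[OF \<Omega>, symmetric]
        by (simp add: linear_sum[OF linear_d\<Psi>[OF \<Omega>]] linear_cmul[OF linear_d\<Psi>[OF \<Omega>]]
            linf_mult.sum_left linf_mult.scaleR_left I.sum I.scaleR)
      then show ?case by (simp add: sum_divide_distrib)
    qed
  qed
  ultimately have "linf_int (y' * Z) = (\<Sum>e\<in>Basis. (v \<bullet> e) * pairing (\<lambda>s. partial2 f u s v e) Z)"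
    by (rule LIM_unique)
  also have "\<dots> = pairing (\<lambda>s. \<Sum>e\<in>Basis. (v \<bullet> e) * partial2 f u s v e) Z"
    by (subst pairing_sum_left) (auto intro!: continuous_intros u simp: pairing_cmult_left)
  also have "\<dots> = pairing (\<lambda>s. partial2 f u s v v) Z"
  proof (rule pairing_cong)
    fix s :: "real^'n::_" assume s: "s \<in> sphere 0 1"
    have "partial2 f u s v v = partial2 f u s v (\<Sum>e\<in>Basis. (v \<bullet> e) *\<^sub>R e)" by (simp add: euclidean_representation)
    then show "(\<Sum>e\<in>Basis. (v \<bullet> e) * partial2 f u s v e) = partial2 f u s v v"
      by (simp add: linear_sum[OF linear_partial(2)[OF u s]] linear_cmul[OF linear_partial(2)[OF u s]])
  qed
  also have "\<dots> = linf_int (linf_class (\<lambda>s. partial2 f u s v v) * Z)"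
    by (rule linf_int_class[symmetric]) (intro continuous_intros u)
  finally show ?thesis .
qed

text \<open>Pointwise on the sphere the squares add up to the squared length of the gradient.\<close>

lemma sum_squares_frame:
  assumes u: "u \<in> \<Omega>" and v: "positive_form.frame (\<gamma> u) v"
  shows "(\<Sum>i\<in>UNIV. linf_int (d\<Psi> u (v i) * d\<Psi> u (v i) * X)) = linf_int X"
proof -
  interpret \<gamma>: positive_form "\<gamma> u" by (rule positive_\<gamma>[OF u])
  have "linf_int (d\<Psi> u b * d\<Psi> u b * X) = pairing (\<lambda>s. partial1 f u s b * partial1 f u s b) X" for b
    unfolding mult.assoc d\<Psi>_def
    by (subst linf_int_class) (auto intro!: pairing_mult_class continuous_on_partial u)
  then have "(\<Sum>i\<in>UNIV. linf_int (d\<Psi> u (v i) * d\<Psi> u (v i) * X)) =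
      pairing (\<lambda>s. \<Sum>i\<in>UNIV. partial1 f u s (v i) * partial1 f u s (v i)) X"
    by (simp add: pairing_sum_left continuous_on_mult continuous_on_partial[OF u])
  also have "\<dots> = pairing (\<lambda>s. 1) X"
  proof (rule pairing_cong)
    fix s :: "real^'n::_" assume s: "s \<in> sphere 0 1"
    show "(\<Sum>i\<in>UNIV. partial1 f u s (v i) * partial1 f u s (v i)) = 1"
      using \<gamma>.frame_Parseval[OF v, of "w u s" "w u s"] eikonal[OF u s] by (simp add: gradient[OF u s])
  qed
  finally show ?thesis by (simp add: pairing_def linf_int_def)
qed

end

section \<open>Charts, tangent vectors and gradients\<close>

locale atlas =
  fixes A :: "('m::t2_space, 'n::finite) chart set"
  assumes smooth_atlas: "smooth_atlas A"
begin

lemma chart_at_in: "chart_at A x \<in> charts_at A x"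
proof -
  have "\<exists>c. c \<in> charts_at A x"
    using smooth_atlas unfolding smooth_atlas_def charts_at_def by blast
  then show ?thesis unfolding chart_at_def by (rule someI_ex)
qed

lemma charts_atD: "c \<in> charts_at A x \<Longrightarrow> c \<in> A" "c \<in> charts_at A x \<Longrightarrow> x \<in> fst c"
  by (auto simp: charts_at_def)

lemma chart_props:
  assumes "c \<in> A"
  shows "open (fst c)" "open (snd c ` fst c)"
    "homeomorphism (fst c) (snd c ` fst c) (snd c) (chart_inv c)"
  using smooth_atlas assms unfolding smooth_atlas_def by auto

lemma chart_inv_chart: "c \<in> A \<Longrightarrow> x \<in> fst c \<Longrightarrow> chart_inv c (snd c x) = x"
  using homeomorphism_apply1[OF chart_props(3)] .

lemma chart_inv_in: "u \<in> snd c ` fst c \<Longrightarrow> chart_inv c u \<in> fst c"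
  by (rule inv_into_into)

lemma chart_chart_inv: "u \<in> snd c ` fst c \<Longrightarrow> snd c (chart_inv c u) = u"
  by (rule f_inv_into_f)

lemma open_chart_image:
  assumes "c \<in> A" "open S"
  shows "open (snd c ` (fst c \<inter> S))"
proof -
  have "openin (top_of_set (fst c)) (fst c \<inter> S)" using assms(2) by (auto simp: openin_open)
  then have "openin (top_of_set (snd c ` fst c)) (snd c ` (fst c \<inter> S))"
    by (rule homeomorphism_imp_open_map[OF chart_props(3)[OF assms(1)]])
  then show ?thesis using openin_open_trans[OF _ chart_props(2)[OF assms(1)]] by blast
qed

abbreviation transition where "transition c d \<equiv> snd d \<circ> chart_inv c"

lemma has_derivative_transition:
  assumes "c \<in> charts_at A x" "d \<in> charts_at A x"
  shows "(transition c d has_derivative deriv_at (transition c d) (snd c x)) (at (snd c x))"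
proof (rule smooth_on_differentiable)
  show "open (snd c ` (fst c \<inter> fst d))"
    using assms chart_props(1) by (intro open_chart_image) (auto simp: charts_at_def)
  show "smooth_on (snd c ` (fst c \<inter> fst d)) (transition c d)"
    using smooth_atlas assms unfolding smooth_atlas_def charts_at_def by blast
  show "snd c x \<in> snd c ` (fst c \<inter> fst d)"
    using assms by (auto simp: charts_at_def)
qed

text \<open>The chain rule for \<open>F \<circ> c\<inverse> = (F \<circ> d\<inverse>) \<circ> (d \<circ> c\<inverse>)\<close>.  The cocycle rule for transition maps and the
  independence of the differential of the chart are instances.\<close>

lemma has_derivative_change_chart:
  assumes c: "c \<in> charts_at A x" and d: "d \<in> charts_at A x"
    and F: "((F \<circ> chart_inv d) has_derivative D) (at (snd d x))"
  shows "((F \<circ> chart_inv c) has_derivative (\<lambda>a. D (deriv_at (transition c d) (snd c x) a))) (at (snd c x))"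
proof -
  note cA = charts_atD[OF c] and dA = charts_atD[OF d]
  have eq: "transition c d (snd c x) = snd d x" by (simp add: chart_inv_chart cA)
  have "((\<lambda>u. (F \<circ> chart_inv d) (transition c d u)) has_derivative
      (\<lambda>a. D (deriv_at (transition c d) (snd c x) a))) (at (snd c x))"
    by (rule has_derivative_compose[OF has_derivative_transition[OF c d]]) (simp only: eq F)
  then show ?thesis
  proof (rule has_derivative_transform_within_open)
    show "open (snd c ` (fst c \<inter> fst d))" by (rule open_chart_image[OF cA(1) chart_props(1)[OF dA(1)]])
    show "snd c x \<in> snd c ` (fst c \<inter> fst d)" using cA dA by auto
    show "(F \<circ> chart_inv d) (transition c d u) = (F \<circ> chart_inv c) u" if "u \<in> snd c ` (fst c \<inter> fst d)" for u
      using that by (auto simp: chart_inv_chart cA dA)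
  qed
qed

lemma transition_cocycle:
  assumes "c \<in> charts_at A x" "d \<in> charts_at A x" "e \<in> charts_at A x"
  shows "deriv_at (transition c e) (snd c x) a =
    deriv_at (transition d e) (snd d x) (deriv_at (transition c d) (snd c x) a)"
  using frechet_derivative_at[OF has_derivative_change_chart[OF assms(1,2) has_derivative_transition[OF assms(2,3)]]]
  by (simp add: fun_eq_iff)

lemma transition_self:
  assumes "c \<in> charts_at A x"
  shows "deriv_at (transition c c) (snd c x) a = a"
proof -
  note cA = charts_atD[OF assms]
  have "(transition c c has_derivative (\<lambda>a. a)) (at (snd c x))"
    by (rule has_derivative_transform_within_open[OF has_derivative_ident chart_props(2)[OF cA(1)]])
      (use cA in \<open>auto simp: chart_inv_chart\<close>)
  from frechet_derivative_at[OF this] show ?thesis by metis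
qed

lemma coord_vec_coord: "d \<in> charts_at A x \<Longrightarrow> coord_vec A x c a d = deriv_at (transition c d) (snd c x) a"
  by (simp add: coord_vec_def)

lemma coord_vec_same: "c \<in> charts_at A x \<Longrightarrow> coord_vec A x c a c = a"
  by (simp add: coord_vec_coord transition_self)

lemma coord_vec_tangent:
  assumes "c \<in> charts_at A x" shows "coord_vec A x c a \<in> tangent_space A x"
  unfolding tangent_space_def mem_Collect_eq
proof (intro conjI allI impI ballI)
  show "coord_vec A x c a d = 0" if "d \<notin> charts_at A x" for d
    using that by (simp add: coord_vec_def)
  fix d e assume d: "d \<in> charts_at A x" and e: "e \<in> charts_at A x"
  show "coord_vec A x c a e = deriv_at (transition d e) (snd d x) (coord_vec A x c a d)"
    unfolding coord_vec_coord[OF d] coord_vec_coord[OF e] by (rule transition_cocycle[OF assms d e])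
qed

lemma tangent_coord_vec:
  assumes "v \<in> tangent_space A x" "c \<in> charts_at A x"
  shows "coord_vec A x c (v c) = v"
proof
  fix d
  show "coord_vec A x c (v c) d = v d"
  proof (cases "d \<in> charts_at A x")
    case True
    then have "v d = deriv_at (transition c d) (snd c x) (v c)"
      using assms unfolding tangent_space_def by blast
    then show ?thesis by (simp only: coord_vec_coord[OF True])
  next
    case False
    then have "v d = 0" using assms(1) unfolding tangent_space_def by blast
    then show ?thesis using False by (simp add: coord_vec_def)
  qed
qed

lemma mdiff_coords:
  assumes c: "c \<in> charts_at A x" and v: "v \<in> tangent_space A x"
    and F: "((F \<circ> chart_inv c) has_derivative D) (at (snd c x))"
  shows "mdiff A F x v = D (v c)"
proof -
  define d where "d = chart_at A x"
  have d: "d \<in> charts_at A x" by (simp add: d_def chart_at_in)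
  have "v c = deriv_at (transition d c) (snd d x) (v d)"
    using v c d unfolding tangent_space_def by blast
  moreover have "deriv_at (F \<circ> chart_inv d) (snd d x) = (\<lambda>a. D (deriv_at (transition d c) (snd d x) a))"
    using frechet_derivative_at[OF has_derivative_change_chart[OF d c F]] by simp
  ultimately show ?thesis
    by (simp add: mdiff_def d_def[symmetric] Let_def)
qed

end

locale riemannian = atlas A for A :: "('m::{t2_space, second_countable_topology}, 'n::finite) chart set" +
  fixes g :: "'m \<Rightarrow> ('m, 'n) tvec \<Rightarrow> ('m, 'n) tvec \<Rightarrow> real"
  assumes riemannian: "riemannian_manifold A g"
begin

lemma positive_metric_coords:
  assumes "c \<in> A" "u \<in> snd c ` fst c" shows "positive_form (metric_coords A g c u)"
  using riemannian assms unfolding riemannian_manifold_def positive_form_def by blast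

lemma metric_coords:
  assumes c: "c \<in> charts_at A x" and "v \<in> tangent_space A x" "w \<in> tangent_space A x"
  shows "metric_coords A g c (snd c x) (v c) (w c) = g x v w"
  using assms charts_atD[OF c] by (simp add: metric_coords_def chart_inv_chart tangent_coord_vec)

text \<open>The gradient exists by the Riesz representation in an orthonormal frame of the chart.\<close>

lemma grad_coords:
  assumes c: "c \<in> charts_at A x" and F: "((F \<circ> chart_inv c) has_derivative D) (at (snd c x))"
  shows "grad A g F x \<in> tangent_space A x"
    and "metric_coords A g c (snd c x) (grad A g F x c) b = D b"
proof -
  let ?\<gamma> = "metric_coords A g c (snd c x)"
  interpret \<gamma>: positive_form ?\<gamma>
    by (rule positive_metric_coords) (use charts_atD[OF c] in auto)
  obtain e where fr: "\<gamma>.frame e"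
    using \<gamma>.orthonormal_frame_exists unfolding \<gamma>.frame_def by metis
  have lD: "linear D" using F by (rule has_derivative_linear)
  define a where "a = (\<Sum>i\<in>UNIV. D (e i) *\<^sub>R e i)"
  have a: "?\<gamma> a b = D b" for b
  proof -
    have "D b = D (\<Sum>i\<in>UNIV. ?\<gamma> b (e i) *\<^sub>R e i)"
      by (rule arg_cong[where f = D], rule \<gamma>.frame_expansion[OF fr])
    then show ?thesis
      by (simp add: a_def linear_sum[OF lD] linear_cmul[OF lD] \<gamma>.B_sum_left \<gamma>.B_simps \<gamma>.sym_B[of b] mult.commute)
  qed
  let ?P = "\<lambda>v. v \<in> tangent_space A x \<and> (\<forall>w\<in>tangent_space A x. g x v w = mdiff A F x w)"
  have iff: "?P v \<longleftrightarrow> v \<in> tangent_space A x \<and> (\<forall>b. ?\<gamma> (v c) b = D b)" for v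
  proof (rule conj_cong[OF refl])
    assume v: "v \<in> tangent_space A x"
    have "(\<forall>w\<in>tangent_space A x. g x v w = mdiff A F x w) \<longleftrightarrow>
        (\<forall>w\<in>tangent_space A x. ?\<gamma> (v c) (w c) = D (w c))"
      by (simp add: mdiff_coords[OF c _ F] metric_coords[OF c v])
    also have "\<dots> \<longleftrightarrow> (\<forall>b. ?\<gamma> (v c) b = D b)"
      using coord_vec_tangent[OF c] coord_vec_same[OF c] by metis
    finally show "(\<forall>w\<in>tangent_space A x. g x v w = mdiff A F x w) \<longleftrightarrow> (\<forall>b. ?\<gamma> (v c) b = D b)" .
  qed
  have ex: "?P (coord_vec A x c a)"
    unfolding iff by (simp add: coord_vec_tangent[OF c] coord_vec_same[OF c] a)
  have un: "v = coord_vec A x c a" if "?P v" for v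
  proof -
    have v: "v \<in> tangent_space A x" "\<And>b. ?\<gamma> (v c) b = D b" using that unfolding iff by auto
    have "?\<gamma> (v c - a) (v c - a) = 0" by (simp add: \<gamma>.B_simps(5) v(2) a)
    then have "v c = a" using \<gamma>.pos_B[of "v c - a"] by force
    then show ?thesis using tangent_coord_vec[OF v(1) c] by simp
  qed
  have "grad A g F x = coord_vec A x c a"
    unfolding grad_def by (rule the_equality, rule ex, rule un)
  then show "grad A g F x \<in> tangent_space A x" "?\<gamma> (grad A g F x c) b = D b"
    using ex by (simp_all add: coord_vec_same[OF c] a)
qed

end

lemma smooth_on_subset_continuous_on:
  assumes "smooth_on_subset X f" shows "continuous_on X f"
  unfolding continuous_on_eq_continuous_within
proof
  fix x assume x: "x \<in> X"
  obtain W F where W: "open W" "x \<in> W" "smooth_on W F" "\<forall>y\<in>W \<inter> X. F y = f y"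
    using assms x unfolding smooth_on_subset_def by blast
  have "(F has_derivative deriv_at F x) (at x)" by (rule smooth_on_differentiable[OF W(1,3,2)])
  from has_derivative_continuous[OF this] have cont: "continuous (at x within X) F"
    by (rule continuous_at_imp_continuous_at_within)
  have ev: "\<forall>\<^sub>F y in at x within X. F y = f y"
    using W by (auto simp: eventually_at_topological)
  have "F x = f x" using W x by blast
  then show "continuous (at x within X) f"
    using Lim_transform_eventually[OF cont[unfolded continuous_within] ev]
    by (simp add: continuous_within)
qed

section \<open>Special embeddings in coordinates\<close>

locale special_pair = riemannian A g
  for A :: "('m::{t2_space, second_countable_topology}, 'n::{finite, wellorder}) chart set" and g +
  fixes \<phi> :: "real^'n::_ \<Rightarrow> 'm \<Rightarrow> real" and \<Phi> :: "'m \<Rightarrow> 'n linf"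
    and \<rho> :: "'n linf \<Rightarrow> 'n linf"
  assumes special: "special_embedding A g \<phi> \<Phi>"
    and density_pos: "AE s in sphere_measure. 0 \<le> linf_rep (\<rho> (\<Phi> x)) s"
    and density_special: "density sphere_measure (\<lambda>s. ennreal (linf_rep (\<rho> (\<Phi> x)) s)) = special_measure A g \<phi> x"
begin

lemma family_smooth:
  assumes "c \<in> A"
  shows "smooth_family (snd c ` fst c) (sphere 0 1) (\<lambda>u s. \<phi> s (chart_inv c u))"
  using special chart_props(2)[OF assms] assms
  by unfold_locales (auto simp: special_embedding_def)

lemma grad_in_chart:
  assumes c: "c \<in> charts_at A x" and s: "s \<in> sphere 0 1"
  shows "grad A g (\<phi> s) x \<in> tangent_space A x"
    and "metric_coords A g c (snd c x) (grad A g (\<phi> s) x c) b =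
      partial1 (\<lambda>u s. \<phi> s (chart_inv c u)) (snd c x) s b"
proof -
  interpret smooth_family "snd c ` fst c" "sphere 0 1" "\<lambda>u s. \<phi> s (chart_inv c u)"
    by (rule family_smooth[OF charts_atD(1)[OF c]])
  have "snd c x \<in> snd c ` fst c" using charts_atD[OF c] by auto
  from has_derivative_family(1)[OF this s]
  have "((\<phi> s \<circ> chart_inv c) has_derivative partial1 (\<lambda>u s. \<phi> s (chart_inv c u)) (snd c x) s) (at (snd c x))"
    by (simp add: o_def)
  from grad_coords[OF c this] show "grad A g (\<phi> s) x \<in> tangent_space A x"
    "metric_coords A g c (snd c x) (grad A g (\<phi> s) x c) b =
      partial1 (\<lambda>u s. \<phi> s (chart_inv c u)) (snd c x) s b" by auto
qed

lemma grad_unit: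
  assumes c: "c \<in> charts_at A x" and s: "s \<in> sphere 0 1"
  shows "metric_coords A g c (snd c x) (grad A g (\<phi> s) x c) (grad A g (\<phi> s) x c) = 1"
  using special s metric_coords[OF c grad_in_chart(1)[OF c s] grad_in_chart(1)[OF c s]]
  by (auto simp: special_embedding_def)

lemma grad_bij: "bij_betw (\<lambda>s. grad A g (\<phi> s) x) (sphere 0 1) (unit_tangent_sphere A g x)"
  using special by (simp add: special_embedding_def)

lemma grad_chart_diffeomorphism:
  assumes "c \<in> charts_at A x"
  shows "diffeomorphism (sphere 0 1) ((\<lambda>v. v c) ` unit_tangent_sphere A g x) (\<lambda>s. grad A g (\<phi> s) x c)"
  using special assms by (auto simp: special_embedding_def)

text \<open>The Borel structure of the unit tangent sphere is read in the chart, where the inverse of the gradient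
  map is smooth, hence continuous.\<close>

lemma inv_grad_measurable:
  assumes c: "c \<in> charts_at A x"
  shows "inv_into (sphere 0 1) (\<lambda>s. grad A g (\<phi> s) x) \<in>
    measurable (vimage_algebra (unit_tangent_sphere A g x) (\<lambda>v. v c) borel) sphere_measure"
proof -
  let ?UT = "unit_tangent_sphere A g x" and ?gr = "\<lambda>s. grad A g (\<phi> s) x"
  let ?Y = "(\<lambda>v. v c) ` ?UT"
  let ?\<beta> = "inv_into (sphere 0 1) (\<lambda>s. ?gr s c)"
  have bij: "bij_betw (\<lambda>s. ?gr s c) (sphere 0 1) ?Y" and sm: "smooth_on_subset ?Y ?\<beta>"
    using grad_chart_diffeomorphism[OF c] unfolding diffeomorphism_def by auto
  have "continuous_on ?Y ?\<beta>" by (rule smooth_on_subset_continuous_on[OF sm])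
  then have "?\<beta> \<in> measurable (restrict_space borel ?Y) borel"
    by (rule borel_measurable_continuous_on_restrict)
  moreover have "?\<beta> \<in> ?Y \<rightarrow> sphere 0 1"
    using bij bij_betw_inv_into[OF bij] by (auto simp: bij_betw_def)
  ultimately have \<beta>: "?\<beta> \<in> measurable (restrict_space borel ?Y) sphere_measure"
    by (subst measurable_cong_sets[OF refl sets_sphere_measure])
      (auto intro!: measurable_restrict_space2 simp: space_restrict_space)
  have ev: "(\<lambda>v. v c) \<in> measurable (vimage_algebra ?UT (\<lambda>v. v c) borel) (restrict_space borel ?Y)"
    by (rule measurable_restrict_space2) (auto intro!: measurable_vimage_algebra1 simp: space_vimage_algebra)
  have "inv_into (sphere 0 1) ?gr v = ?\<beta> (v c)" if v: "v \<in> ?UT" for v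
  proof -
    obtain s where s: "s \<in> sphere 0 1" "v = ?gr s"
      using v unfolding bij_betw_imp_surj_on[OF grad_bij, symmetric] by blast
    have "inv_into (sphere 0 1) ?gr v = s"
      unfolding s(2) by (rule inv_into_f_f[OF bij_betw_imp_inj_on[OF grad_bij] s(1)])
    moreover have "?\<beta> (v c) = s"
      unfolding s(2) by (rule inv_into_f_f[OF bij_betw_imp_inj_on[OF bij] s(1)])
    ultimately show ?thesis by simp
  qed
  then show ?thesis
    using measurable_compose[OF ev \<beta>]
    by (subst measurable_cong[where g = "\<lambda>v. ?\<beta> (v c)"]) (simp_all add: space_vimage_algebra)
qed

text \<open>By definition of \<open>special_measure\<close>, the gradient at \<open>x\<close> carries the density to the uniform
  measure of the unit tangent sphere.\<close>

lemma pairing_grad_spherical: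
  assumes c: "c \<in> charts_at A x"
  obtains J :: "real^'n::_ \<Rightarrow> real^'n::_" where "linear J"
    "\<And>a. metric_coords A g c (snd c x) (J a) (J a) = (norm a)\<^sup>2"
    "\<And>h. continuous_on UNIV h \<Longrightarrow>
      pairing (\<lambda>s. h (grad A g (\<phi> s) x c)) (\<rho> (\<Phi> x)) = (\<integral>\<theta>. h (J \<theta>) \<partial>sphere_measure)"
proof -
  define d where "d = chart_at A x"
  have d: "d \<in> charts_at A x" by (simp add: d_def chart_at_in)
  let ?UT = "unit_tangent_sphere A g x" and ?gr = "\<lambda>s. grad A g (\<phi> s) x"
  let ?N = "vimage_algebra ?UT (\<lambda>v. v d) borel"
  let ?\<alpha> = "inv_into (sphere 0 1) ?gr"
  let ?isom = "\<lambda>L :: real^'n::_ \<Rightarrow> real^'n::_. linear L \<and>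
     (\<forall>a. g x (coord_vec A x d (L a)) (coord_vec A x d (L a)) = (norm a)\<^sup>2)"
  have gd: "g x (coord_vec A x d a) (coord_vec A x d b) = metric_coords A g d (snd d x) a b" for a b
    using metric_coords[OF d coord_vec_tangent[OF d, of a] coord_vec_tangent[OF d, of b]]
    by (simp add: coord_vec_same[OF d])
  define L where "L = (SOME L. ?isom L)"
  interpret \<gamma>d: positive_form "metric_coords A g d (snd d x)"
    by (rule positive_metric_coords) (use charts_atD[OF d] in auto)
  have "\<exists>L. ?isom L"
  proof -
    obtain J :: "real^'n::_ \<Rightarrow> real^'n::_" where J: "linear J" "\<And>a. metric_coords A g d (snd d x) (J a) (J a) = (norm a)\<^sup>2"
      using \<gamma>d.isometry_exists by metis
    then show ?thesis by (intro exI[of _ J]) (simp add: gd)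
  qed
  then have L: "?isom L" unfolding L_def by (rule someI_ex)
  have linL: "linear L" and isoL: "g x (coord_vec A x d (L a)) (coord_vec A x d (L a)) = (norm a)\<^sup>2" for a
    using L by auto
  have in_UT: "coord_vec A x d (L \<theta>) \<in> ?UT" if "\<theta> \<in> sphere 0 1" for \<theta>
    using that coord_vec_tangent[OF d] isoL by (simp add: unit_tangent_sphere_def)
  have haar: "unit_tangent_haar A g x = distr sphere_measure ?N (\<lambda>\<theta>. coord_vec A x d (L \<theta>))"
    by (simp add: unit_tangent_haar_def Let_def d_def[symmetric] L_def)
  have m1: "(\<lambda>\<theta>. coord_vec A x d (L \<theta>)) \<in> measurable sphere_measure ?N"
  proof (rule measurable_vimage_algebra2)
    show "(\<lambda>\<theta>. coord_vec A x d (L \<theta>)) \<in> space sphere_measure \<rightarrow> ?UT"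
      using in_UT by (auto simp: space_sphere_measure)
    have "continuous_on (sphere 0 1) L"
      using linL by (intro linear_continuous_on) (simp add: linear_conv_bounded_linear)
    then show "(\<lambda>\<theta>. coord_vec A x d (L \<theta>) d) \<in> borel_measurable sphere_measure"
      by (simp add: coord_vec_same[OF d] measurable_sphere_continuous)
  qed
  have m2: "?\<alpha> \<in> measurable ?N sphere_measure" by (rule inv_grad_measurable[OF d])
  \<comment> \<open>the Haar measure is defined in the chart \<open>d\<close> chosen at \<open>x\<close>; \<open>T\<close> transports it to \<open>c\<close>\<close>
  define T where "T = deriv_at (transition d c) (snd d x)"
  have T: "linear T" unfolding T_def using has_derivative_transition[OF d c] by (rule has_derivative_linear)
  have Tc: "coord_vec A x d a c = T a" for a by (simp add: coord_vec_coord[OF c] T_def)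
  show thesis
  proof (rule that[of "\<lambda>a. T (L a)"])
    show "linear (\<lambda>a. T (L a))" using linear_compose[OF linL T] by (simp add: o_def)
    show "metric_coords A g c (snd c x) (T (L a)) (T (L a)) = (norm a)\<^sup>2" for a
      using metric_coords[OF c coord_vec_tangent[OF d] coord_vec_tangent[OF d], of "L a" "L a"] isoL
      by (simp add: Tc)
    fix h :: "real^'n::_ \<Rightarrow> real" assume h: "continuous_on UNIV h"
    let ?k = "\<lambda>s. h (?gr s c)"
    have "continuous_on (sphere 0 1) (\<lambda>s. ?gr s c)"
      using grad_chart_diffeomorphism[OF c] smooth_on_subset_continuous_on unfolding diffeomorphism_def by blast
    then have kc: "continuous_on (sphere 0 1) ?k" by (rule continuous_on_compose2[OF h]) simp
    note km = measurable_sphere_continuous[OF kc]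
    have "pairing ?k (\<rho> (\<Phi> x)) = (\<integral>s. ?k s \<partial>density sphere_measure (\<lambda>s. ennreal (linf_rep (\<rho> (\<Phi> x)) s)))"
      unfolding pairing_def by (subst integral_density) (use km density_pos in \<open>auto simp: mult.commute\<close>)
    also have "\<dots> = (\<integral>s. ?k s \<partial>distr (unit_tangent_haar A g x) sphere_measure ?\<alpha>)"
      by (simp add: density_special special_measure_def)
    also have "\<dots> = (\<integral>v. ?k (?\<alpha> v) \<partial>distr sphere_measure ?N (\<lambda>\<theta>. coord_vec A x d (L \<theta>)))"
      unfolding haar by (rule integral_distr) (use m2 km in auto)
    also have "\<dots> = (\<integral>\<theta>. ?k (?\<alpha> (coord_vec A x d (L \<theta>))) \<partial>sphere_measure)"
      by (rule integral_distr[OF m1]) (rule measurable_compose[OF m2 km])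
    also have "\<dots> = (\<integral>\<theta>. h (T (L \<theta>)) \<partial>sphere_measure)"
    proof (rule Bochner_Integration.integral_cong)
      fix \<theta> :: "real^'n::_" assume "\<theta> \<in> space sphere_measure"
      then have "coord_vec A x d (L \<theta>) \<in> ?UT" using in_UT by (simp add: space_sphere_measure)
      then have "?gr (?\<alpha> (coord_vec A x d (L \<theta>))) = coord_vec A x d (L \<theta>)"
        by (intro f_inv_into_f) (use grad_bij[of x] in \<open>simp add: bij_betw_def\<close>)
      then show "?k (?\<alpha> (coord_vec A x d (L \<theta>))) = h (T (L \<theta>))" by (simp add: Tc)
    qed simp
    finally show "pairing ?k (\<rho> (\<Phi> x)) = (\<integral>\<theta>. h (T (L \<theta>)) \<partial>sphere_measure)" .
  qed
qed

lemma eikonal_embedding_chart: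
  assumes c: "c \<in> A"
  shows "eikonal_embedding (snd c ` fst c) (\<lambda>u s. \<phi> s (chart_inv c u)) (metric_coords A g c)
     (\<lambda>u s. grad A g (\<phi> s) (chart_inv c u) c) (\<lambda>u. \<rho> (\<Phi> (chart_inv c u))) (\<Phi> \<circ> chart_inv c)"
proof -
  interpret smooth_family "snd c ` fst c" "sphere 0 1" "\<lambda>u s. \<phi> s (chart_inv c u)"
    by (rule family_smooth[OF c])
  show ?thesis
  proof
    fix u :: "real^'n::_" and s :: "real^'n::_" and a b
    assume u: "u \<in> snd c ` fst c"
    have cx: "c \<in> charts_at A (chart_inv c u)" using c chart_inv_in[OF u] by (simp add: charts_at_def)
    have uu: "snd c (chart_inv c u) = u" by (rule chart_chart_inv[OF u])
    interpret \<gamma>: positive_form "metric_coords A g c u" by (rule positive_metric_coords[OF c u])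
    show "bilinear (metric_coords A g c u)" "metric_coords A g c u a b = metric_coords A g c u b a"
      by (rule \<gamma>.bilinear_B, rule \<gamma>.sym_B)
    show "0 < metric_coords A g c u a a" if "a \<noteq> 0" by (rule \<gamma>.pos_B[OF that])
    show "(\<lambda>u. metric_coords A g c u a b) differentiable at u"
      using riemannian c smooth_on_differentiable[OF chart_props(2)[OF c] _ u]
      unfolding riemannian_manifold_def differentiable_def by blast
    show "inj_on (\<lambda>s. grad A g (\<phi> s) (chart_inv c u) c) (sphere 0 1)"
      using grad_chart_diffeomorphism[OF cx] unfolding diffeomorphism_def bij_betw_def by blast
    show "AE s in sphere_measure. linf_rep ((\<Phi> \<circ> chart_inv c) u) s = \<phi> s (chart_inv c u)"
    proof -
      have "AE s in sphere_measure. \<phi> s (chart_inv c u) = linf_rep (\<Phi> (chart_inv c u)) s"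
        using special unfolding special_embedding_def linf_rel_def by blast
      then show ?thesis by eventually_elim simp
    qed
    obtain J :: "real^'n::_ \<Rightarrow> real^'n::_" where "linear J"
      "\<And>a. metric_coords A g c u (J a) (J a) = (norm a)\<^sup>2"
      "\<And>h. continuous_on UNIV h \<Longrightarrow>
        pairing (\<lambda>s. h (grad A g (\<phi> s) (chart_inv c u) c)) (\<rho> (\<Phi> (chart_inv c u))) = (\<integral>\<theta>. h (J \<theta>) \<partial>sphere_measure)"
      using pairing_grad_spherical[OF cx] unfolding uu by blast
    then show "\<exists>J :: real^'n::_ \<Rightarrow> real^'n::_. linear J \<and> (\<forall>a. metric_coords A g c u (J a) (J a) = (norm a)\<^sup>2) \<and>
       (\<forall>h. continuous_on UNIV h \<longrightarrow>
        pairing (\<lambda>s. h (grad A g (\<phi> s) (chart_inv c u) c)) (\<rho> (\<Phi> (chart_inv c u))) = (\<integral>\<theta>. h (J \<theta>) \<partial>sphere_measure))"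
      by (intro exI[of _ J]) simp
    assume s: "s \<in> sphere 0 1"
    show "metric_coords A g c u (grad A g (\<phi> s) (chart_inv c u) c) b = partial1 (\<lambda>u s. \<phi> s (chart_inv c u)) u s b"
      using grad_in_chart(2)[OF cx s, of b] by (simp only: uu)
    show "metric_coords A g c u (grad A g (\<phi> s) (chart_inv c u) c) (grad A g (\<phi> s) (chart_inv c u) c) = 1"
      using grad_unit[OF cx s] by (simp only: uu)
  qed
qed

end

section \<open>Vanishing of the mean curvature\<close>

text \<open>The trace is defined by a description, so an orthonormal basis must be exhibited.\<close>

lemma form_trace_zero:
  assumes "orthonormal_basis B L E0" "\<And>E. orthonormal_basis B L E \<Longrightarrow> (\<Sum>e\<in>E. q e) = 0"
  shows "form_trace B L q = 0"
  unfolding form_trace_def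
proof (rule the_equality)
  show "r = 0" if "\<forall>E. orthonormal_basis B L E \<longrightarrow> r = (\<Sum>e\<in>E. q e)" for r
    using that assms by metis
qed (use assms(2) in simp)

context eikonal_embedding
begin

text \<open>Since \<open>d\<Psi> u\<close> is an isometry onto the tangent space, orthonormal bases of the latter are the images of
  frames.\<close>

lemma orthonormal_basis_frame:
  assumes u: "u \<in> \<Omega>" and B: "\<And>X Y. sform_app B X Y = real CARD('n) * linf_int (X * Y * R u)"
  shows "(\<exists>E. orthonormal_basis B (range (d\<Psi> u)) E) \<and>
    (\<forall>E. orthonormal_basis B (range (d\<Psi> u)) E \<longrightarrow>
      (\<exists>v. positive_form.frame (\<gamma> u) v \<and> bij_betw (\<lambda>i. d\<Psi> u (v i)) UNIV E))"
proof -
  interpret \<gamma>: positive_form "\<gamma> u" by (rule positive_\<gamma>[OF u])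
  have iso: "sform_app B (d\<Psi> u b) (d\<Psi> u c) = \<gamma> u b c" for b c
    by (simp add: B d\<Psi>_isometry[OF u])
  note inj = inj_d\<Psi>[OF u]
  show ?thesis
  proof (intro conjI allI impI)
    obtain v where v: "\<gamma>.frame v"
      using \<gamma>.orthonormal_frame_exists unfolding \<gamma>.frame_def by metis
    have vv: "\<gamma> u (v i) (v j) = (if i = j then 1 else 0)" for i j
      using v unfolding \<gamma>.frame_def by blast
    have vinj: "v i = v j \<longleftrightarrow> i = j" for i j
      using vv[of i j] vv[of i i] by (metis zero_neq_one)
    have "a \<in> span (range v)" for a
      by (subst \<gamma>.frame_expansion[OF v, of a]) (intro span_sum span_scale span_base rangeI)
    then have "span (range v) = UNIV" by blast
    then have sp: "span (d\<Psi> u ` range v) = range (d\<Psi> u)"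
      by (simp add: linear_span_image[OF linear_d\<Psi>[OF u]])
    have "orthonormal_basis B (range (d\<Psi> u)) (d\<Psi> u ` range v)"
      unfolding orthonormal_basis_def sp using inj by (auto simp: iso vv vinj inj_eq)
    then show "\<exists>E. orthonormal_basis B (range (d\<Psi> u)) E" by blast
  next
    fix E assume E: "orthonormal_basis B (range (d\<Psi> u)) E"
    define E' where "E' = d\<Psi> u -` E"
    have fin: "finite E" and sp: "span E = range (d\<Psi> u)"
      and on: "\<And>e f. e \<in> E \<Longrightarrow> f \<in> E \<Longrightarrow> sform_app B e f = (if e = f then 1 else 0)"
      using E unfolding orthonormal_basis_def by blast+
    have EE': "E = d\<Psi> u ` E'" using span_superset[of E] sp by (auto simp: E'_def)
    have fin': "finite E'" unfolding E'_def by (rule finite_vimageI[OF fin inj])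
    have on': "\<gamma> u a b = (if a = b then 1 else 0)" if "a \<in> E'" "b \<in> E'" for a b
      using on[of "d\<Psi> u a" "d\<Psi> u b"] that inj by (simp add: iso E'_def inj_eq)
    have ind: "independent E'"
    proof (rule independent_if_scalars_zero[OF fin'])
      fix h b assume h: "(\<Sum>a\<in>E'. h a *\<^sub>R a) = 0" and b: "b \<in> E'"
      have "(\<Sum>a\<in>E'. h a * \<gamma> u a b) = (\<Sum>a\<in>E'. if a = b then h a else 0)"
        by (rule sum.cong) (use b on' in auto)
      also have "\<dots> = h b" using b fin' by simp
      finally show "h b = 0"
        using arg_cong[OF h, of "\<lambda>x. \<gamma> u x b"] by (simp add: \<gamma>.B_sum_left \<gamma>.B_simps)
    qed
    have "d\<Psi> u ` span E' = range (d\<Psi> u)"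
      unfolding linear_span_image[OF linear_d\<Psi>[OF u], symmetric] EE'[symmetric] by (rule sp)
    then have "span E' = UNIV" using inj by (simp add: inj_image_eq_iff)
    then have "card E' = CARD('n)"
      using dim_eq_card[of E' UNIV] ind by simp
    then obtain v where v: "bij_betw v (UNIV :: 'n set) E'"
      using finite_same_card_bij[of "UNIV :: 'n set" E'] fin' by auto
    show "\<exists>v. \<gamma>.frame v \<and> bij_betw (\<lambda>i. d\<Psi> u (v i)) UNIV E"
    proof (intro exI[of _ v] conjI)
      have "v i \<in> E'" "v i = v j \<longleftrightarrow> i = j" for i j
        using v by (auto simp: bij_betw_def inj_eq)
      then show "\<gamma>.frame v" by (simp add: \<gamma>.frame_def on')
      have "bij_betw (d\<Psi> u) E' E"
        unfolding EE' by (rule inj_on_imp_bij_betw[OF inj_on_subset[OF inj]]) simp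
      from bij_betw_trans[OF v this] show "bij_betw (\<lambda>i. d\<Psi> u (v i)) UNIV E" by (simp add: o_def)
    qed
  qed
qed

text \<open>The trace of the three terms of the Koszul formula.  The third one vanishes because the squares
  of the derivatives along a frame add up to \<open>1\<close> and the total mass of the density is constant; the
  first two add up to the weighted divergence.\<close>

lemma frame_trace_zero:
  assumes u: "u \<in> \<Omega>" and v: "positive_form.frame (\<gamma> u) v"
    and R': "(R has_derivative (\<lambda>b. \<rho>' (d\<Psi> u b))) (at u)"
    and V: "\<And>b. linf_int (d\<Psi> u b * (V * R u)) = 0" and mass: "linf_int (\<rho>' V) = 0"
  shows "(\<Sum>i\<in>UNIV. linf_int (linf_class (\<lambda>s. partial2 f u s (v i) (v i)) * (V * R u))
     + linf_int (d\<Psi> u (v i) * V * \<rho>' (d\<Psi> u (v i)))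
     - linf_int (d\<Psi> u (v i) * d\<Psi> u (v i) * \<rho>' V) / 2) = 0"
proof -
  interpret I: bounded_linear linf_int by (rule bounded_linear_linf_int)
  obtain \<Gamma> where \<Gamma>: "(\<Sum>i\<in>UNIV. linf_class (\<lambda>s. partial2 f u s (v i) (v i)) * R u
      + linf_class (\<lambda>s. partial1 f u s (v i)) * \<rho>' (d\<Psi> u (v i))) = linf_class (\<lambda>s. partial1 f u s \<Gamma>) * R u"
    by (rule weighted_divergence[OF u R' v])
  have "(\<Sum>i\<in>UNIV. linf_int (linf_class (\<lambda>s. partial2 f u s (v i) (v i)) * (V * R u))
     + linf_int (d\<Psi> u (v i) * V * \<rho>' (d\<Psi> u (v i)))) =
    linf_int (V * (\<Sum>i\<in>UNIV. linf_class (\<lambda>s. partial2 f u s (v i) (v i)) * R u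
      + linf_class (\<lambda>s. partial1 f u s (v i)) * \<rho>' (d\<Psi> u (v i))))"
    by (simp add: d\<Psi>_def linf_mult.sum_right I.sum linf_mult.add_right I.add mult_ac)
  also have "\<dots> = linf_int (d\<Psi> u \<Gamma> * (V * R u))"
    unfolding \<Gamma> by (simp add: d\<Psi>_def mult_ac)
  finally have 1: "(\<Sum>i\<in>UNIV. linf_int (linf_class (\<lambda>s. partial2 f u s (v i) (v i)) * (V * R u))
     + linf_int (d\<Psi> u (v i) * V * \<rho>' (d\<Psi> u (v i)))) = 0" by (simp add: V)
  have 2: "(\<Sum>i\<in>UNIV. linf_int (d\<Psi> u (v i) * d\<Psi> u (v i) * \<rho>' V) / 2) = 0"
    by (simp add: sum_divide_distrib[symmetric] sum_squares_frame[OF u v] mass)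
  show ?thesis using 1 2 by (simp add: sum_subtractf)
qed

text \<open>The Koszul formula along the embedding: the coordinate line through the base point is lifted to
  the parametrization of \<open>F\<close>, and the acceleration of the tangential field along it is computed from
  the second derivatives of the family.\<close>

lemma second_fundamental_form_value:
  fixes \<psi> :: "'k::euclidean_space \<Rightarrow> 'n linf" and m :: real
  assumes u: "u \<in> \<Omega>" and lp: "local_param F W \<psi>" and z: "z \<in> W" "\<psi> z = \<Psi> u"
    and G: "\<And>w X Y. w \<in> W \<Longrightarrow> sform_app (G (\<psi> w)) X Y = m * linf_int (X * Y * \<rho> (\<psi> w))"
    and \<rho>': "(\<rho> has_derivative \<rho>') (at (\<Psi> u))" and Ru: "\<rho> (\<Psi> u) = R u"
    and lc: "levi_civita W (pullback_metric G \<psi>) nabla" and \<tau>: "smooth_on W \<tau>"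
    and tang: "\<And>w u'. w \<in> W \<Longrightarrow> u' \<in> \<Omega> \<Longrightarrow> \<psi> w = \<Psi> u' \<Longrightarrow> deriv_at \<psi> w (\<tau> w) \<in> range (d\<Psi> u')"
    and T: "deriv_at \<psi> z (\<tau> z) = d\<Psi> u v" and V: "V \<in> submanifold_tangent TYPE('k) F (\<Psi> u)"
    and N: "open N" "\<Psi> u \<in> N" "\<And>u'. u' \<in> \<Omega> \<Longrightarrow> \<Psi> u' \<in> N \<Longrightarrow> \<Psi> u' \<in> F"
    and orth: "\<And>b. linf_int (d\<Psi> u b * (V * R u)) = 0"
  shows "sform_app (G (\<Psi> u)) (deriv_at \<psi> z (nabla \<tau> z (\<tau> z))) V =
    m * (linf_int (linf_class (\<lambda>s. partial2 f u s v v) * (V * R u)) + linf_int (d\<Psi> u v * V * \<rho>' (d\<Psi> u v))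
      - linf_int (d\<Psi> u v * d\<Psi> u v * \<rho>' V) / 2)"
proof -
  have W: "open W" and smooth: "smooth_on W \<psi>" and inj: "inj (deriv_at \<psi> z)"
    using lp z unfolding local_param_def by auto
  have V': "V \<in> submanifold_tangent TYPE('k) F (\<psi> z)" using V z by simp
  obtain b where b: "deriv_at \<psi> z b = V"
    by (rule submanifold_tangent_param[OF lp z(1) V'])
  obtain D where D: "derivative_family W \<psi> D"
    by (rule smooth_on_derivative_family[OF W smooth])
  interpret D: derivative_family W \<psi> D by (rule D)
  have \<tau>d: "(\<tau> has_derivative deriv_at \<tau> z) (at z)"
    by (rule smooth_on_differentiable[OF W \<tau> z(1)])
  define X' where "X' h = D z [h, \<tau> z] + D z [deriv_at \<tau> z h]" for h
  have X': "((\<lambda>w. deriv_at \<psi> w (\<tau> w)) has_derivative X') (at z)"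
    unfolding X'_def
    by (rule has_derivative_transform_within_open[OF has_derivative_along_field[OF D z(1) \<tau>d] W z(1)])
      (simp add: D.deriv_at_f)
  define \<sigma> where "\<sigma> t = \<Psi> (u + t *\<^sub>R v)" for t
  have line: "((\<lambda>t. u + t *\<^sub>R v) \<longlongrightarrow> u) (nhds 0)"
    by (rule tendsto_eq_intros refl filterlim_ident)+ simp
  have ev\<Omega>: "\<forall>\<^sub>F t in nhds 0. u + t *\<^sub>R v \<in> \<Omega>" by (rule topological_tendstoD[OF line open_\<Omega> u])
  have \<sigma>': "(\<sigma> has_vector_derivative d\<Psi> u v) (at 0)"
  proof -
    have "(\<sigma> has_derivative (\<lambda>t. d\<Psi> u (t *\<^sub>R v))) (at 0)"
      unfolding \<sigma>_def
      by (rule has_derivative_compose[of "\<lambda>t. u + t *\<^sub>R v" "\<lambda>t. t *\<^sub>R v" _ _ \<Psi>])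
        (use has_derivative_\<Psi>[OF u] in \<open>auto intro!: derivative_eq_intros\<close>)
    then show ?thesis by (simp add: has_vector_derivative_def linear_cmul[OF linear_d\<Psi>[OF u]])
  qed
  have \<sigma>0: "\<sigma> 0 = \<psi> z" by (simp add: \<sigma>_def z)
  have "\<forall>\<^sub>F t in nhds 0. \<sigma> t \<in> N"
    by (rule topological_tendstoD[OF vector_derivative_tendsto_nhds[OF \<sigma>'] N(1)]) (simp add: \<sigma>_def N)
  with ev\<Omega> have evF: "\<forall>\<^sub>F t in nhds 0. \<sigma> t \<in> F"
    by eventually_elim (simp add: \<sigma>_def N)
  obtain \<omega> :: "real \<Rightarrow> 'k" and a where \<omega>: "\<omega> 0 = z" "\<forall>\<^sub>F t in nhds 0. \<omega> t \<in> W \<and> \<psi> (\<omega> t) = \<sigma> t"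
    "(\<omega> has_vector_derivative a) (at 0)" "deriv_at \<psi> z a = d\<Psi> u v"
    by (rule local_param_lift[OF lp z(1) \<sigma>0 evF \<sigma>'])
  have a: "a = \<tau> z" using injD[OF inj] T \<omega>(4) by metis
  define y where "y t = deriv_at \<psi> (\<omega> t) (\<tau> (\<omega> t))" for t
  have "(y has_derivative (\<lambda>t. X' (t *\<^sub>R a))) (at 0)"
    unfolding y_def
    by (rule has_derivative_compose[of \<omega> "\<lambda>t. t *\<^sub>R a" _ _ "\<lambda>w. deriv_at \<psi> w (\<tau> w)"])
      (use X' \<omega> in \<open>simp_all add: has_vector_derivative_def\<close>)
  then have y': "(y has_vector_derivative X' (\<tau> z)) (at 0)"
    by (simp add: has_vector_derivative_def linear_cmul[OF has_derivative_linear[OF X']] a)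
  have "\<forall>\<^sub>F t in nhds 0. y t \<in> range (d\<Psi> (u + t *\<^sub>R v))"
    using ev\<Omega> \<omega>(2) by eventually_elim (auto simp: y_def \<sigma>_def intro!: tang)
  then have "\<forall>\<^sub>F t in at 0. y t \<in> range (d\<Psi> (u + t *\<^sub>R v))" by (simp add: eventually_nhds_conv_at)
  from normal_acceleration[OF u y' _ this orth]
  have acc: "linf_int (X' (\<tau> z) * (V * R u)) = linf_int (linf_class (\<lambda>s. partial2 f u s v v) * (V * R u))"
    by (simp add: y_def \<omega>(1) T)
  have \<rho>z: "(\<rho> has_derivative \<rho>') (at (\<psi> z))" using \<rho>' z by simp
  from Koszul_integral_metric[where G = G, OF W smooth z(1) G \<rho>z lc \<tau> X' T b] show ?thesis
    by (simp add: z Ru acc mult.assoc)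
qed

end

theorem proposition3p7:
  fixes A :: "('m::{t2_space, second_countable_topology}, 'n::{finite, wellorder}) chart set"
    and g :: "'m \<Rightarrow> ('m, 'n) tvec \<Rightarrow> ('m, 'n) tvec \<Rightarrow> real"
    and \<phi> :: "real^'n::_ \<Rightarrow> 'm \<Rightarrow> real"
    and \<Phi> :: "'m \<Rightarrow> 'n linf"
    and U :: "'n linf set"
    and G :: "'n linf \<Rightarrow> 'n sform"
    and x :: 'm
    and V :: "'n linf"
    and F :: "'n linf set"
    and q :: "'n linf \<Rightarrow> real"
  assumes "riemannian_manifold A g"
    and "minimally_geodesic A g"
    and "special_embedding A g \<phi> \<Phi>"
    and "riemannian_metric_on U G"
    and "range \<Phi> \<subseteq> U"
    and "special_metric A g \<phi> \<Phi> U G"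
    and "\<forall>T\<in>tangent_image A \<Phi> x. sform_app (G (\<Phi> x)) V T = 0"
    and "extends_image_at TYPE('k::euclidean_space) \<Phi> U x V F"
    and "second_fundamental_form TYPE('k) A \<Phi> G F x V q"
  shows "mean_curvature A \<Phi> G x q = 0"
proof -
  let ?n = "real CARD('n)"
  have U: "open U" using assms(4) by (simp add: riemannian_metric_on_def)
  have \<Phi>U: "\<Phi> y \<in> U" for y using assms(5) by auto
  obtain \<nu> \<rho> where \<nu>: "\<forall>p\<in>U. prob_space (\<nu> p) \<and>
           (\<forall>X Y. sform_app (G p) X Y = ?n * (\<integral>s. linf_rep X s * linf_rep Y s \<partial>\<nu> p)) \<and>
           \<nu> p = density sphere_measure (\<lambda>s. ennreal (linf_rep (\<rho> p) s)) \<and>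
           (\<exists>c>0. AE s in sphere_measure. c \<le> linf_rep (\<rho> p) s)"
    and \<rho>: "smooth_on U \<rho>" and special: "\<forall>x. \<Phi> x \<in> U \<longrightarrow> \<nu> (\<Phi> x) = special_measure A g \<phi> x"
    using assms(6) unfolding special_metric_def by (elim exE conjE) (rule that)
  have dens: "\<nu> p = density sphere_measure (\<lambda>s. ennreal (linf_rep (\<rho> p) s))" if "p \<in> U" for p
    using \<nu> that by blast
  have pos: "AE s in sphere_measure. 0 \<le> linf_rep (\<rho> p) s" if p: "p \<in> U" for p
  proof -
    obtain c where "c > 0" "AE s in sphere_measure. c \<le> linf_rep (\<rho> p) s" using \<nu> p by blast
    then show ?thesis by (auto elim!: eventually_mono)
  qed
  have G: "sform_app (G p) X Y = ?n * linf_int (X * Y * \<rho> p)" if p: "p \<in> U" for p X Y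
  proof -
    have "sform_app (G p) X Y = ?n * (\<integral>s. linf_rep X s * linf_rep Y s \<partial>\<nu> p)" using \<nu> p by blast
    also have "(\<integral>s. linf_rep X s * linf_rep Y s \<partial>\<nu> p) =
        (\<integral>s. linf_rep (\<rho> p) s *\<^sub>R (linf_rep X s * linf_rep Y s) \<partial>sphere_measure)"
      unfolding dens[OF p] by (rule integral_density) (use pos[OF p] in auto)
    also have "\<dots> = linf_int (X * Y * \<rho> p)"
      unfolding linf_int_mult3 by (simp add: mult_ac)
    finally show ?thesis .
  qed
  have mass: "linf_int (\<rho> p) = 1" if p: "p \<in> U" for p
  proof -
    interpret prob_space "\<nu> p" using \<nu> p by blast
    have "1 = (\<integral>s. (1::real) \<partial>\<nu> p)" by (simp add: prob_space)
    also have "\<dots> = (\<integral>s. linf_rep (\<rho> p) s *\<^sub>R 1 \<partial>sphere_measure)"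
      unfolding dens[OF p] by (rule integral_density) (use pos[OF p] in auto)
    finally show ?thesis by (simp add: linf_int_def)
  qed
  have atlasA: "smooth_atlas A" using assms(1) by (simp add: riemannian_manifold_def)
  interpret special_pair A g \<phi> \<Phi> \<rho>
  proof
    fix x
    show "density sphere_measure (\<lambda>s. ennreal (linf_rep (\<rho> (\<Phi> x)) s)) = special_measure A g \<phi> x"
      using special dens[OF \<Phi>U[of x]] \<Phi>U[of x] by simp
  qed (use atlasA assms(1,3) pos[OF \<Phi>U] in auto)
  define c where "c = chart_at A x"
  have c: "c \<in> charts_at A x" by (simp add: c_def chart_at_in)
  note cA = charts_atD[OF c]
  define \<Omega> where "\<Omega> = snd c ` fst c"
  define f where "f u s = \<phi> s (chart_inv c u)" for u s
  define w where "w u s = grad A g (\<phi> s) (chart_inv c u) c" for u s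
  define R where "R u = \<rho> (\<Phi> (chart_inv c u))" for u
  define \<Psi> where "\<Psi> u = \<Phi> (chart_inv c u)" for u
  interpret E: eikonal_embedding \<Omega> f "metric_coords A g c" w R \<Psi>
    using eikonal_embedding_chart[OF cA(1)]
    by (simp add: \<Omega>_def f_def[abs_def] w_def[abs_def] R_def[abs_def] \<Psi>_def[abs_def] o_def)
  define u where "u = snd c x"
  have u: "u \<in> \<Omega>" using cA by (simp add: u_def \<Omega>_def)
  have \<Psi>u: "\<Psi> u = \<Phi> x" by (simp add: \<Psi>_def u_def chart_inv_chart cA)
  have Ru: "\<rho> (\<Psi> u') = R u'" for u' by (simp add: R_def \<Psi>_def)
  have tangent: "tangent_image A \<Phi> (chart_inv c u') = range (E.d\<Psi> u')" if u': "u' \<in> \<Omega>" for u'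
  proof -
    let ?y = "chart_inv c u'"
    have cy: "c \<in> charts_at A ?y" using cA(1) chart_inv_in u' by (simp add: charts_at_def \<Omega>_def)
    have "((\<Phi> \<circ> chart_inv c) has_derivative E.d\<Psi> u') (at (snd c ?y))"
      using E.has_derivative_\<Psi>[OF u'] u' by (simp add: \<Psi>_def[abs_def] o_def chart_chart_inv \<Omega>_def)
    then have m: "mdiff A \<Phi> ?y v = E.d\<Psi> u' (v c)" if "v \<in> tangent_space A ?y" for v
      by (rule mdiff_coords[OF cy that])
    show ?thesis
    proof
      show "tangent_image A \<Phi> ?y \<subseteq> range (E.d\<Psi> u')" unfolding tangent_image_def using m by auto
      show "range (E.d\<Psi> u') \<subseteq> tangent_image A \<Phi> ?y"
      proof
        fix e assume "e \<in> range (E.d\<Psi> u')"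
        then obtain b where "e = E.d\<Psi> u' b" by blast
        then have "e = mdiff A \<Phi> ?y (coord_vec A ?y c b)"
          by (simp add: m coord_vec_tangent[OF cy] coord_vec_same[OF cy])
        then show "e \<in> tangent_image A \<Phi> ?y"
          unfolding tangent_image_def using coord_vec_tangent[OF cy] by blast
      qed
    qed
  qed
  have tangent_x: "tangent_image A \<Phi> x = range (E.d\<Psi> u)"
    using tangent[OF u] by (simp add: u_def chart_inv_chart cA)
  define \<rho>' where "\<rho>' = deriv_at \<rho> (\<Phi> x)"
  have \<rho>': "(\<rho> has_derivative \<rho>') (at (\<Psi> u))"
    unfolding \<rho>'_def \<Psi>u by (rule smooth_on_differentiable[OF U \<rho> \<Phi>U])
  have R': "(R has_derivative (\<lambda>b. \<rho>' (E.d\<Psi> u b))) (at u)"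
    using has_derivative_compose[OF E.has_derivative_\<Psi>[OF u] \<rho>'] by (simp add: Ru)
  have mass': "linf_int (\<rho>' V) = 0"
  proof -
    have "((\<lambda>p. linf_int (\<rho> p)) has_derivative (\<lambda>h. linf_int (\<rho>' h))) (at (\<Psi> u))"
      by (rule bounded_linear.has_derivative[OF bounded_linear_linf_int \<rho>'])
    moreover have "((\<lambda>p. linf_int (\<rho> p)) has_derivative (\<lambda>h. 0)) (at (\<Psi> u))"
      by (rule has_derivative_transform_within_open[OF has_derivative_const U]) (simp_all add: \<Psi>u \<Phi>U mass)
    ultimately show ?thesis using has_derivative_unique by (metis (no_types, lifting))
  qed
  have orth: "linf_int (E.d\<Psi> u b * (V * R u)) = 0" for b
  proof -
    have "sform_app (G (\<Phi> x)) V (E.d\<Psi> u b) = 0" using assms(7) tangent_x by blast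
    then show ?thesis by (simp add: G[OF \<Phi>U] Ru[symmetric] \<Psi>u mult_ac)
  qed
  obtain N where N: "open N" "\<Phi> x \<in> N" "N \<inter> range \<Phi> \<subseteq> F" and FU: "F \<subseteq> U"
    and VF: "V \<in> submanifold_tangent TYPE('k) F (\<Phi> x)"
    using assms(8) unfolding extends_image_at_def by blast
  have q: "q (E.d\<Psi> u v) = ?n * (linf_int (linf_class (\<lambda>s. partial2 f u s v v) * (V * R u))
      + linf_int (E.d\<Psi> u v * V * \<rho>' (E.d\<Psi> u v)) - linf_int (E.d\<Psi> u v * E.d\<Psi> u v * \<rho>' V) / 2)" for v
  proof -
    have "E.d\<Psi> u v \<in> tangent_image A \<Phi> x" using tangent_x by blast
    then obtain W z nabla \<tau> and \<psi> :: "'k \<Rightarrow> 'n linf" where lp: "local_param F W \<psi>" and z: "z \<in> W" "\<psi> z = \<Phi> x"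
      and lc: "levi_civita W (pullback_metric G \<psi>) nabla" and \<tau>: "smooth_on W \<tau>"
      and tang: "\<forall>w\<in>W. \<forall>y. \<psi> w = \<Phi> y \<longrightarrow> deriv_at \<psi> w (\<tau> w) \<in> tangent_image A \<Phi> y"
      and T: "deriv_at \<psi> z (\<tau> z) = E.d\<Psi> u v"
      and q: "q (E.d\<Psi> u v) = sform_app (G (\<Phi> x)) (deriv_at \<psi> z (nabla \<tau> z (\<tau> z))) V"
      using assms(9) unfolding second_fundamental_form_def by blast
    have WU: "\<psi> w \<in> U" if "w \<in> W" for w
    proof -
      have "\<psi> ` W \<subseteq> F" using lp unfolding local_param_def by (intro openin_imp_subset) blast
      then show ?thesis using FU that by blast
    qed
    show ?thesis
      unfolding q \<Psi>u[symmetric]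
    proof (rule E.second_fundamental_form_value[OF u lp z(1) _ G[OF WU] \<rho>' Ru lc \<tau> _ T _ N(1) _ _ orth])
      show "deriv_at \<psi> w (\<tau> w) \<in> range (E.d\<Psi> u')" if "w \<in> W" "u' \<in> \<Omega>" "\<psi> w = \<Psi> u'" for w u'
        using tang that tangent[OF that(2)] by (auto simp: \<Psi>_def)
      show "\<Psi> u' \<in> F" if "\<Psi> u' \<in> N" for u' using N(3) that by (auto simp: \<Psi>_def)
    qed (use z VF N \<Psi>u in auto)
  qed
  have Gx: "sform_app (G (\<Phi> x)) X Y = ?n * linf_int (X * Y * R u)" for X Y
    using G[OF \<Phi>U] by (simp add: Ru[symmetric] \<Psi>u)
  note bases = E.orthonormal_basis_frame[OF u Gx]
  show ?thesis
    unfolding mean_curvature_def tangent_x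
  proof -
    obtain E0 where E0: "orthonormal_basis (G (\<Phi> x)) (range (E.d\<Psi> u)) E0" using bases by blast
    show "form_trace (G (\<Phi> x)) (range (E.d\<Psi> u)) q = 0"
    proof (rule form_trace_zero[OF E0])
      fix E assume "orthonormal_basis (G (\<Phi> x)) (range (E.d\<Psi> u)) E"
      then obtain v where v: "positive_form.frame (metric_coords A g c u) v"
        and bij: "bij_betw (\<lambda>i. E.d\<Psi> u (v i)) UNIV E" using bases by blast
      have "(\<Sum>e\<in>E. q e) = (\<Sum>i\<in>UNIV. q (E.d\<Psi> u (v i)))"
        by (rule sum.reindex_bij_betw[OF bij, symmetric])
      also have "\<dots> = ?n * 0"
        unfolding q sum_distrib_left[symmetric] E.frame_trace_zero[OF u v R' orth mass'] ..
      finally show "(\<Sum>e\<in>E. q e) = 0" by simp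
    qed
  qed
qed

end
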